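(* Let $d\in\mathbb{N}$ and let $0<\gamma,\eta\leq 1$. There exists a constant $C$ depending only on $d,\eta,\gamma$ such that the following holds. If $F,S\subseteq\mathbb{R}^d$ are Lebesgue measurable sets of finite and positive Lebesgue measure such that $F$ has finite $\gamma$-perimeter, $\operatorname{Per}_\gamma(F)<\infty$, and $S$ has finite $\eta$-perimeter, $\operatorname{Per}_\eta(S)<\infty$, then \[ \operatorname{tr}(T_{F,S}-T_{F,S}^2)\leq C\cdot \begin{cases} \operatorname{Per}_\gamma(F)\,\operatorname{Per}_\eta(S)\,\log_{+}(\delta_F\delta_S) & \text{if }\gamma=\eta,\\ \operatorname{Per}_\eta(S)\,\operatorname{Per}_\gamma(F)^{\eta/\gamma}\,|F|^{1-\eta/\gamma} & \text{if }\gamma>\eta,\\ \operatorname{Per}_\eta(S)^{\gamma/\eta}\,\operatorname{Per}_\gamma(F)\,|S|^{1-\gamma/\eta} & \text{if }\gamma<\eta, \end{cases} \] where $\delta_F=\left(|F|/\operatorname{Per}_\gamma(F)\right)^{1/\gamma}$ and $\delta_S=\left(|S|/\operatorname{Per}_\eta(S)\right)^{1/\eta}$.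
   Context: $|U|$ denotes the Lebesgue measure of a measurable set $U\subseteq\mathbb{R}^d$, and $\mathbf{1}_U$ its indicator function. The Fourier transform on $L^2(\mathbb{R}^d)$ is normalized to be unitary: $\mathcal{F}f(\xi)=(2\pi)^{-d/2}\int_{\mathbb{R}^d}f(x)e^{ix\cdot\xi}\,dx$ and $\mathcal{F}^{-1}g(x)=(2\pi)^{-d/2}\int_{\mathbb{R}^d}g(\xi)e^{-ix\cdot\xi}\,d\xi$. For measurable $F,S\subseteq\mathbb{R}^d$, define on $L^2(\mathbb{R}^d)$ the orthogonal projections $P_Ff:=\mathbf{1}_F f$ and $B_S:=\mathcal{F}^{-1}P_S\mathcal{F}$, and the spatio-spectral limiting operator $T_{F,S}:=P_FB_SP_F$. When $F$ and $S$ have finite measure, $T_{F,S}$ is a positive (semidefinite) self-adjoint trace-class contraction; $\operatorname{tr}$ denotes the operator trace. For $0<\gamma\leq1$ and $U\subseteq\mathbb{R}^d$ measurable of finite and positive measure, the $\gamma$-perimeter of $U$ is \[ \operatorname{Per}_\gamma(U):=\sup_{h\in\mathbb{R}^d\setminus\{0\}}\frac{|U\triangle(U-h)|}{|h|^\gamma}, \] where $U-h=\{x-h:x\in U\}$, $\triangle$ is the symmetric difference and $|h|$ is the Euclidean norm. $U$ has finite $\gamma$-perimeter if $\operatorname{Per}_\gamma(U)<\infty$. $\log_+(a):=\max\{1,\log(a)\}$ for $a>0$, with $\log$ the logarithm to base 2. *)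

theory Defs
  imports "HOL-Analysis.Analysis" "HOL-Library.Complex_Order"
begin

section \<open>The space \<open>L\<^sup>2\<close>\<close>

text \<open>
  Elements of $L^2(\mathbb{R}^d)$ are represented by square-integrable functions, not by
  equivalence classes. Operators act on representatives; their values matter only up to null
  sets, and every notion below that is evaluated on them (inner products, the \<open>L\<^sup>2\<close> distance)
  is invariant under changes on null sets.
\<close>

definition L2 :: "((real^'d) \<Rightarrow> complex) set" where
  "L2 = {f. f \<in> borel_measurable lebesgue \<and> integrable lebesgue (\<lambda>x. (norm (f x))\<^sup>2)}"

definition L2_inner :: "((real^'d) \<Rightarrow> complex) \<Rightarrow> ((real^'d) \<Rightarrow> complex) \<Rightarrow> complex" where
  "L2_inner f g = (LINT x|lebesgue. f x * cnj (g x))"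

text \<open>
  The squared \<open>L\<^sup>2\<close> distance is an extended nonnegative integral, so it is \<open>\<infinity>\<close>
  (rather than 0, as for the Bochner integral) if the difference is not square-integrable.
\<close>

definition L2_dist_sq :: "((real^'d) \<Rightarrow> complex) \<Rightarrow> ((real^'d) \<Rightarrow> complex) \<Rightarrow> ennreal" where
  "L2_dist_sq f g = (\<integral>\<^sup>+x. ennreal ((norm (f x - g x))\<^sup>2) \<partial>lebesgue)"

text \<open>
  $L^2(\mathbb{R}^d)$ with $d \geq 1$ is separable and infinite-dimensional, so all its
  orthonormal bases can be indexed by the natural numbers.
\<close>

definition L2_orthonormal_basis :: "(nat \<Rightarrow> (real^'d) \<Rightarrow> complex) \<Rightarrow> bool" where
  "L2_orthonormal_basis e \<longleftrightarrow>
     range e \<subseteq> L2 \<and>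
     (\<forall>m n. L2_inner (e m) (e n) = (if m = n then 1 else 0)) \<and>
     (\<forall>f\<in>L2. (\<forall>n. L2_inner f (e n) = 0) \<longrightarrow> (AE x in lebesgue. f x = 0))"

text \<open>
  The trace of a trace-class operator \<open>A\<close>: the common value of \<open>\<Sum>n. \<langle>A e\<^sub>n, e\<^sub>n\<rangle>\<close>
  over all orthonormal bases.
\<close>

definition L2_trace :: "(((real^'d) \<Rightarrow> complex) \<Rightarrow> ((real^'d) \<Rightarrow> complex)) \<Rightarrow> complex" where
  "L2_trace A =
     (THE t. \<forall>e. L2_orthonormal_basis e \<longrightarrow> (\<lambda>n. L2_inner (A (e n)) (e n)) sums t)"

section \<open>The Fourier transform on \<open>L\<^sup>2\<close>\<close>

definition fourier_integral :: "((real^'d) \<Rightarrow> complex) \<Rightarrow> ((real^'d) \<Rightarrow> complex)" where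
  "fourier_integral f = (\<lambda>\<xi>. complex_of_real ((2 * pi) powr (- real CARD('d) / 2)) *
     (LINT x|lebesgue. f x * exp (\<i> * complex_of_real (x \<bullet> \<xi>))))"

definition inverse_fourier_integral :: "((real^'d) \<Rightarrow> complex) \<Rightarrow> ((real^'d) \<Rightarrow> complex)" where
  "inverse_fourier_integral g = (\<lambda>x. complex_of_real ((2 * pi) powr (- real CARD('d) / 2)) *
     (LINT \<xi>|lebesgue. g \<xi> * exp (- \<i> * complex_of_real (x \<bullet> \<xi>))))"

text \<open>
  Plancherel extension to \<open>L\<^sup>2\<close> of an integral transform \<open>K\<close> that is given by its integral
  formula on $L^1 \cap L^2$: the \<open>L\<^sup>2\<close> limit of the transforms of the truncations to the balls
  of radius \<open>n\<close>, which lie in $L^1 \cap L^2$. The limit is unique only almost everywhere;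
  some representative is chosen.
\<close>

definition L2_extension ::
  "(((real^'d) \<Rightarrow> complex) \<Rightarrow> ((real^'d) \<Rightarrow> complex)) \<Rightarrow>
   ((real^'d) \<Rightarrow> complex) \<Rightarrow> ((real^'d) \<Rightarrow> complex)" where
  "L2_extension K f = (SOME g. g \<in> L2 \<and>
     (\<lambda>n. L2_dist_sq (K (\<lambda>x. indicator (cball 0 (real n)) x * f x)) g) \<longlonglongrightarrow> 0)"

definition L2_fourier :: "((real^'d) \<Rightarrow> complex) \<Rightarrow> ((real^'d) \<Rightarrow> complex)" where
  "L2_fourier = L2_extension fourier_integral"

definition L2_inverse_fourier :: "((real^'d) \<Rightarrow> complex) \<Rightarrow> ((real^'d) \<Rightarrow> complex)" where
  "L2_inverse_fourier = L2_extension inverse_fourier_integral"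

section \<open>Spatio-spectral limiting operators\<close>

definition space_proj :: "(real^'d) set \<Rightarrow> ((real^'d) \<Rightarrow> complex) \<Rightarrow> ((real^'d) \<Rightarrow> complex)" where
  "space_proj F f = (\<lambda>x. indicator F x * f x)"

definition band_proj :: "(real^'d) set \<Rightarrow> ((real^'d) \<Rightarrow> complex) \<Rightarrow> ((real^'d) \<Rightarrow> complex)" where
  "band_proj S = L2_inverse_fourier \<circ> space_proj S \<circ> L2_fourier"

definition limiting_op ::
  "(real^'d) set \<Rightarrow> (real^'d) set \<Rightarrow> ((real^'d) \<Rightarrow> complex) \<Rightarrow> ((real^'d) \<Rightarrow> complex)" where
  "limiting_op F S = space_proj F \<circ> band_proj S \<circ> space_proj F"

section \<open>Fractional perimeter\<close>

definition perimeter :: "real \<Rightarrow> (real^'d) set \<Rightarrow> ennreal" where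
  "perimeter \<gamma> U = (SUP h\<in>UNIV - {0}.
     emeasure lebesgue (sym_diff U ((\<lambda>x. x - h) ` U)) / ennreal (norm h powr \<gamma>))"

definition log_plus :: "real \<Rightarrow> real" where
  "log_plus a = max 1 (log 2 a)"

definition perimeter_scale :: "real \<Rightarrow> (real^'d) set \<Rightarrow> real" where
  "perimeter_scale \<gamma> U = (measure lebesgue U / enn2real (perimeter \<gamma> U)) powr (1 / \<gamma>)"

end

theory Submission
  imports Defs "HOL-Probability.Characteristic_Functions"
begin

text \<open>
  Let $k$ be the convolution kernel of $B_S$ (\<open>band_kernel\<close>), so that $T_{F,S}$ is the integral
  operator with kernel $1_F(x)\,k(x-y)\,1_F(y)$. Its trace is $(2\pi)^{-d}|F||S|$, the trace of its
  square is the integral of $|k(x-y)|^2$ over $F \times F$, and $\int |k|^2 = (2\pi)^{-d}|S|$ by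
  Plancherel. Subtracting,
  \[ \mathrm{tr}(T_{F,S}-T_{F,S}^2) = \int_F\int_{F^c} |k(x-y)|^2\,dy\,dx
       = \int |k(z)|^2\,|F \setminus (F+z)|\,dz . \]
  The weight $|F \setminus (F+z)|$ is at most $|F|$ and at most $\mathrm{Per}_\gamma(F)|z|^\gamma$.
  The kernel decays because $S$ has finite perimeter: Plancherel applied to the difference of the
  indicators of $S$ and $S-h$ gives
  $\int |k(z)|^2 |e^{ih\cdot z}-1|^2\,dz \le \mathrm{Per}_\eta(S)|h|^\eta$, and summing over
  $h = t e_1, \dots, t e_d$ with $t = 1/(2r)$ bounds the mass of $|k|^2$ on the shell $r \le |z| < 2r$
  by a multiple of $\mathrm{Per}_\eta(S) r^{-\eta}$ (\<open>band_kernel_annulus\<close>). The three cases of the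
  theorem are the three possible behaviours of the resulting dyadic sum
  $\sum_r \mathrm{Per}_\gamma(F)\mathrm{Per}_\eta(S)\, r^{\gamma-\eta}$: it is dominated by large $r$ and
  cut off at $\delta_F$, where the bound $|F|$ takes over, if $\gamma > \eta$; it is dominated by small $r$
  and cut off at $1/\delta_S$, below which the total mass of $|k|^2$ is the better bound, if
  $\gamma < \eta$; and every dyadic shell between $1/\delta_S$ and $\delta_F$ contributes the same amount
  if $\gamma = \eta$, which produces the logarithm.

  Three points need a foundation. (1) The trace is a sum over an arbitrary orthonormal basis, and it
  determines a number only if such a basis exists. Parseval's identity (\<open>Parseval\<close>) follows from
  the completeness of $L^2$, in the form \<open>Riesz_Fischer_fast\<close>; a maximal orthonormal set is a basis,
  and it is countable by Bessel's inequality against the indicators of rational boxes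
  (\<open>ex_L2_orthonormal_basis\<close>). (2) Of the Plancherel theorem two parts suffice. The Fourier integral
  is a contraction on integrable functions (\<open>fourier_integral_contraction\<close>), because inserting a
  Gaussian turns $\int|\mathcal{F}f|^2$ into a quadratic form of the heat kernel, which has norm at most 1.
  Norms are preserved for the indicator of a set $U$ of finite perimeter
  (\<open>emeasure_le_fourier_indicator\<close>): there the defect of the quadratic form is an average of
  $|U \setminus (U+z)|$ against a heat kernel, and it tends to 0 by the perimeter bound.
  (3) On functions that are also integrable the Plancherel extension agrees almost everywhere with
  the integral formula (\<open>L2_extension_eq\<close>), so that $T_{F,S}$ can be computed by Fubini's theorem.
\<close>

section \<open>Square-integrable functions\<close>

lemma borel_measurable_cnj [measurable (raw)]:
  "f \<in> borel_measurable M \<Longrightarrow> (\<lambda>x. cnj (f x)) \<in> borel_measurable M"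
  by (rule borel_measurable_continuous_on[OF continuous_on_cnj[OF continuous_on_id]])

abbreviation L2_mass :: "((real^'d) \<Rightarrow> complex) \<Rightarrow> ennreal" where
  "L2_mass f \<equiv> \<integral>\<^sup>+x. ennreal ((norm (f x))\<^sup>2) \<partial>lebesgue"

lemma L2_I: "f \<in> borel_measurable lebesgue \<Longrightarrow> L2_mass f < \<infinity> \<Longrightarrow> f \<in> L2"
  unfolding L2_def by (auto intro!: integrableI_bounded)

lemma L2_measurable [measurable_dest]: "f \<in> L2 \<Longrightarrow> f \<in> borel_measurable lebesgue"
  by (simp add: L2_def)

lemma L2_integrable_square: "f \<in> L2 \<Longrightarrow> integrable lebesgue (\<lambda>x. (norm (f x))\<^sup>2)"
  by (simp add: L2_def)

lemma L2_integrable_mult: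
  assumes "f \<in> L2" "g \<in> L2"
  shows "integrable lebesgue (\<lambda>x. f x * cnj (g x))"
proof (rule Bochner_Integration.integrable_bound)
  show "integrable lebesgue (\<lambda>x. (norm (f x))\<^sup>2 + (norm (g x))\<^sup>2)"
    using assms by (auto simp: L2_def)
  show "(\<lambda>x. f x * cnj (g x)) \<in> borel_measurable lebesgue"
    using assms[THEN L2_measurable] by measurable
  show "AE x in lebesgue. norm (f x * cnj (g x)) \<le> norm ((norm (f x))\<^sup>2 + (norm (g x))\<^sup>2)"
  proof (rule AE_I2)
    fix x
    have "0 \<le> (norm (f x) - norm (g x))\<^sup>2" by simp
    then have "2 * (norm (f x) * norm (g x)) \<le> (norm (f x))\<^sup>2 + (norm (g x))\<^sup>2"
      by (simp add: power2_diff)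
    moreover have "0 \<le> norm (f x) * norm (g x)" by simp
    ultimately have "norm (f x) * norm (g x) \<le> (norm (f x))\<^sup>2 + (norm (g x))\<^sup>2"
      by linarith
    then show "norm (f x * cnj (g x)) \<le> norm ((norm (f x))\<^sup>2 + (norm (g x))\<^sup>2)"
      by (simp add: norm_mult)
  qed
qed

lemma L2_add: assumes "f \<in> L2" "g \<in> L2" shows "(\<lambda>x. f x + g x) \<in> L2"
proof -
  have [measurable]: "f \<in> borel_measurable lebesgue" "g \<in> borel_measurable lebesgue"
    using assms by (auto simp: L2_def)
  have "integrable lebesgue (\<lambda>x. (norm (f x + g x))\<^sup>2)"
  proof (rule Bochner_Integration.integrable_bound)
    show "integrable lebesgue (\<lambda>x. 2 * (norm (f x))\<^sup>2 + 2 * (norm (g x))\<^sup>2)"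
      using assms by (auto simp: L2_def)
    show "AE x in lebesgue. norm ((norm (f x + g x))\<^sup>2) \<le> norm (2 * (norm (f x))\<^sup>2 + 2 * (norm (g x))\<^sup>2)"
    proof (rule AE_I2)
      fix x
      have "(norm (f x + g x))\<^sup>2 \<le> (norm (f x) + norm (g x))\<^sup>2"
        by (intro power_mono norm_triangle_ineq) auto
      also have "\<dots> \<le> 2 * (norm (f x))\<^sup>2 + 2 * (norm (g x))\<^sup>2"
        using sum_squares_bound[of "norm (f x)" "norm (g x)"] by (simp add: power2_sum)
      finally show "norm ((norm (f x + g x))\<^sup>2) \<le> norm (2 * (norm (f x))\<^sup>2 + 2 * (norm (g x))\<^sup>2)"
        by simp
    qed
  qed measurable
  then show ?thesis by (simp add: L2_def)
qed

lemma L2_cmult: assumes "f \<in> L2" shows "(\<lambda>x. c * f x) \<in> L2"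
  using assms by (auto simp: L2_def norm_mult power_mult_distrib)

lemma L2_diff: assumes "f \<in> L2" "g \<in> L2" shows "(\<lambda>x. f x - g x) \<in> L2"
  using L2_add[OF assms(1) L2_cmult[OF assms(2), of "-1"]] by simp

lemma L2_sum:
  assumes "\<And>i. i \<in> I \<Longrightarrow> f i \<in> L2"
  shows "(\<lambda>x. \<Sum>i\<in>I. f i x) \<in> L2"
  using assms
proof (induction I rule: infinite_finite_induct)
  case (insert i I)
  then show ?case by (simp add: L2_add)
qed (auto simp: L2_def)

lemma L2_AE_cong:
  assumes "f \<in> L2" "AE x in lebesgue. f x = g x"
  shows "g \<in> L2"
proof -
  have "g \<in> borel_measurable lebesgue"
    using borel_measurable_AE assms L2_measurable by blast
  moreover have "L2_mass g = L2_mass f"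
    using assms(2) by (intro nn_integral_cong_AE) auto
  moreover have "\<dots> < \<infinity>"
    using L2_integrable_square[OF assms(1)] by (simp add: integrable_iff_bounded)
  ultimately show ?thesis by (intro L2_I) auto
qed

lemma L2_inner_diff_left: "f \<in> L2 \<Longrightarrow> g \<in> L2 \<Longrightarrow> h \<in> L2 \<Longrightarrow>
    L2_inner (\<lambda>x. f x - g x) h = L2_inner f h - L2_inner g h"
  unfolding L2_inner_def
  by (simp add: algebra_simps L2_integrable_mult)

lemma L2_inner_cmult_left: "L2_inner (\<lambda>x. c * f x) h = c * L2_inner f h"
  unfolding L2_inner_def by (simp add: mult.assoc)

lemma L2_inner_commute: "L2_inner f g = cnj (L2_inner g f)"
proof -
  have "cnj (L2_inner g f) = (LINT x|lebesgue. cnj (g x * cnj (f x)))"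
    unfolding L2_inner_def by (rule Bochner_Integration.integral_cnj[symmetric])
  then show ?thesis unfolding L2_inner_def by (simp add: mult.commute)
qed

lemma L2_inner_sum_left:
  assumes "\<And>i. i \<in> I \<Longrightarrow> f i \<in> L2" "h \<in> L2"
  shows "L2_inner (\<lambda>x. \<Sum>i\<in>I. f i x) h = (\<Sum>i\<in>I. L2_inner (f i) h)"
  using assms unfolding L2_inner_def
  by (simp add: sum_distrib_right L2_integrable_mult)

lemma L2_inner_diff_right: "f \<in> L2 \<Longrightarrow> g \<in> L2 \<Longrightarrow> h \<in> L2 \<Longrightarrow>
    L2_inner h (\<lambda>x. f x - g x) = L2_inner h f - L2_inner h g"
  by (subst L2_inner_commute) (simp add: L2_inner_diff_left flip: L2_inner_commute)

lemma L2_inner_cmult_right: "L2_inner h (\<lambda>x. c * f x) = cnj c * L2_inner h f"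
  by (subst L2_inner_commute) (simp add: L2_inner_cmult_left flip: L2_inner_commute)

lemma L2_inner_sum_right:
  assumes "\<And>i. i \<in> I \<Longrightarrow> f i \<in> L2" "h \<in> L2"
  shows "L2_inner h (\<lambda>x. \<Sum>i\<in>I. f i x) = (\<Sum>i\<in>I. L2_inner h (f i))"
  by (subst L2_inner_commute) (simp add: assms L2_inner_sum_left flip: L2_inner_commute)

definition L2_norm_sq :: "((real^'d) \<Rightarrow> complex) \<Rightarrow> real" where
  "L2_norm_sq f = (LINT x|lebesgue. (norm (f x))\<^sup>2)"

lemma L2_inner_self: "L2_inner f f = complex_of_real (L2_norm_sq f)"
  unfolding L2_inner_def L2_norm_sq_def
  unfolding integral_complex_of_real[symmetric]
  by (intro Bochner_Integration.integral_cong refl) (simp add: complex_norm_square del: of_real_power)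

lemma L2_norm_sq_nonneg: "0 \<le> L2_norm_sq f"
  unfolding L2_norm_sq_def by simp

lemma nn_integral_L2: "f \<in> L2 \<Longrightarrow> L2_mass f = ennreal (L2_norm_sq f)"
  unfolding L2_norm_sq_def by (intro nn_integral_eq_integral L2_integrable_square) auto

lemma L2_norm_sq_eq_0_iff:
  assumes "f \<in> L2" shows "L2_norm_sq f = 0 \<longleftrightarrow> (AE x in lebesgue. f x = 0)"
  unfolding L2_norm_sq_def
  by (subst integral_nonneg_eq_0_iff_AE) (auto intro: L2_integrable_square[OF assms])

lemma L2_inner_cong_AE:
  assumes "f \<in> L2" "g \<in> L2" "AE x in lebesgue. f x = f' x" "AE x in lebesgue. g x = g' x"
  shows "L2_inner f g = L2_inner f' g'"
  unfolding L2_inner_def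
proof (rule Bochner_Integration.integral_cong_AE)
  show "(\<lambda>x. f x * cnj (g x)) \<in> borel_measurable lebesgue"
    using assms(1,2)[THEN L2_measurable] by measurable
  show "(\<lambda>x. f' x * cnj (g' x)) \<in> borel_measurable lebesgue"
    using L2_AE_cong[OF assms(1,3), THEN L2_measurable] L2_AE_cong[OF assms(2,4), THEN L2_measurable]
    by measurable
  show "AE x in lebesgue. f x * cnj (g x) = f' x * cnj (g' x)"
    using assms(3,4) by eventually_elim simp
qed

lemma L2_Cauchy_Schwarz:
  assumes "f \<in> L2" "g \<in> L2"
  shows "(cmod (L2_inner f g))\<^sup>2 \<le> L2_norm_sq f * L2_norm_sq g"
proof -
  note [measurable] = assms[THEN L2_measurable]
  have "cmod (L2_inner f g) \<le> (LINT x|lebesgue. norm (f x * cnj (g x)))"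
    unfolding L2_inner_def by (rule integral_norm_bound)
  then have "ennreal (cmod (L2_inner f g)) \<le> ennreal (LINT x|lebesgue. norm (f x * cnj (g x)))"
    by (rule ennreal_leI)
  also have "\<dots> = (\<integral>\<^sup>+x. ennreal (norm (f x)) * ennreal (norm (g x)) \<partial>lebesgue)"
    using nn_integral_eq_integral[OF integrable_norm[OF L2_integrable_mult[OF assms]]]
    by (simp add: norm_mult ennreal_mult')
  finally have "(ennreal (cmod (L2_inner f g)))\<^sup>2 \<le> (\<integral>\<^sup>+x. ennreal (norm (f x)) * ennreal (norm (g x)) \<partial>lebesgue)\<^sup>2"
    by (rule power_mono) simp
  also have "\<dots> \<le> (\<integral>\<^sup>+x. ennreal (norm (f x)) ^ 2 \<partial>lebesgue) * (\<integral>\<^sup>+x. ennreal (norm (g x)) ^ 2 \<partial>lebesgue)"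
    by (rule Cauchy_Schwarz_nn_integral) measurable
  also have "\<dots> = ennreal (L2_norm_sq f * L2_norm_sq g)"
    by (simp add: ennreal_power nn_integral_L2 assms ennreal_mult L2_norm_sq_nonneg)
  finally show ?thesis
    by (simp add: ennreal_power L2_norm_sq_nonneg)
qed

section \<open>Bessel's inequality and Parseval's identity\<close>

definition orthonormal_on :: "'i set \<Rightarrow> ('i \<Rightarrow> (real^'d) \<Rightarrow> complex) \<Rightarrow> bool" where
  "orthonormal_on I e \<longleftrightarrow> (\<forall>i\<in>I. e i \<in> L2) \<and>
     (\<forall>i\<in>I. \<forall>j\<in>I. L2_inner (e i) (e j) = (if i = j then 1 else 0))"

lemma orthonormal_on_subset: "orthonormal_on I e \<Longrightarrow> J \<subseteq> I \<Longrightarrow> orthonormal_on J e"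
  unfolding orthonormal_on_def by blast

lemma orthonormal_sum_norm_sq:
  assumes "orthonormal_on A e" "finite A"
  shows "L2_norm_sq (\<lambda>x. \<Sum>i\<in>A. c i * e i x) = (\<Sum>i\<in>A. (cmod (c i))\<^sup>2)"
proof -
  have mem: "\<And>i. i \<in> A \<Longrightarrow> e i \<in> L2" and
    on: "\<And>i j. i \<in> A \<Longrightarrow> j \<in> A \<Longrightarrow> L2_inner (e i) (e j) = (if i = j then 1 else 0)"
    using assms by (auto simp: orthonormal_on_def)
  have "complex_of_real (L2_norm_sq (\<lambda>x. \<Sum>i\<in>A. c i * e i x)) =
     (\<Sum>i\<in>A. \<Sum>j\<in>A. c i * (cnj (c j) * L2_inner (e i) (e j)))"
    by (simp flip: L2_inner_self
      add: L2_inner_sum_left L2_inner_sum_right L2_cmult L2_sum mem L2_inner_cmult_left L2_inner_cmult_right sum_distrib_left)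
  also have "\<dots> = (\<Sum>i\<in>A. \<Sum>j\<in>A. if i = j then c i * cnj (c j) else 0)"
    by (intro sum.cong refl) (auto simp: on)
  also have "\<dots> = (\<Sum>i\<in>A. c i * cnj (c i))"
    using assms(2) by (simp)
  also have "\<dots> = complex_of_real (\<Sum>i\<in>A. (cmod (c i))\<^sup>2)"
    by (simp add: complex_norm_square del: of_real_power)
  finally show ?thesis using of_real_eq_iff by blast
qed

definition residual :: "((real^'d) \<Rightarrow> complex) \<Rightarrow> 'i set \<Rightarrow> ('i \<Rightarrow> (real^'d) \<Rightarrow> complex) \<Rightarrow> (real^'d) \<Rightarrow> complex" where
  "residual f A e = (\<lambda>x. f x - (\<Sum>i\<in>A. L2_inner f (e i) * e i x))"

lemma residual_L2: "orthonormal_on A e \<Longrightarrow> f \<in> L2 \<Longrightarrow> residual f A e \<in> L2"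
  unfolding residual_def orthonormal_on_def by (intro L2_diff L2_sum L2_cmult) auto

lemma residual_inner:
  assumes "orthonormal_on I e" "A \<subseteq> I" "finite A" "f \<in> L2" "j \<in> I"
  shows "L2_inner (residual f A e) (e j) = (if j \<in> A then 0 else L2_inner f (e j))"
proof -
  have mem: "\<And>i. i \<in> I \<Longrightarrow> e i \<in> L2" and
    on: "\<And>i j. i \<in> I \<Longrightarrow> j \<in> I \<Longrightarrow> L2_inner (e i) (e j) = (if i = j then 1 else 0)"
    using assms by (auto simp: orthonormal_on_def)
  have mem': "\<And>i. i \<in> A \<Longrightarrow> e i \<in> L2" using mem assms by auto
  have "L2_inner (residual f A e) (e j) = L2_inner f (e j) - (\<Sum>i\<in>A. L2_inner f (e i) * L2_inner (e i) (e j))"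
    unfolding residual_def using assms mem mem'
    by (simp add: L2_inner_diff_left L2_inner_sum_left L2_cmult L2_sum L2_inner_cmult_left)
  also have "(\<Sum>i\<in>A. L2_inner f (e i) * L2_inner (e i) (e j)) = (\<Sum>i\<in>A. if i = j then L2_inner f (e i) else 0)"
    using assms by (intro sum.cong refl) (auto simp: on subset_iff)
  finally show ?thesis using assms by simp
qed

lemma residual_norm_sq:
  assumes "orthonormal_on A e" "finite A" "f \<in> L2"
  shows "L2_norm_sq (residual f A e) = L2_norm_sq f - (\<Sum>i\<in>A. (cmod (L2_inner f (e i)))\<^sup>2)"
proof -
  let ?r = "residual f A e"
  have mem: "\<And>i. i \<in> A \<Longrightarrow> e i \<in> L2" using assms by (auto simp: orthonormal_on_def)
  have r: "?r \<in> L2" using assms by (intro residual_L2)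
  have 0: "L2_inner ?r (e i) = 0" if "i \<in> A" for i
    using residual_inner[OF assms(1) subset_refl assms(2,3) that] that by simp
  have "complex_of_real (L2_norm_sq ?r) = L2_inner ?r (\<lambda>x. f x - (\<Sum>i\<in>A. L2_inner f (e i) * e i x))"
    by (simp flip: L2_inner_self add: residual_def)
  also have "\<dots> = L2_inner ?r f"
    using assms r 0 by (simp add: L2_inner_diff_right L2_inner_sum_right mem L2_cmult L2_sum L2_inner_cmult_right)
  also have "\<dots> = L2_inner f f - (\<Sum>i\<in>A. L2_inner f (e i) * L2_inner (e i) f)"
    unfolding residual_def using assms mem
    by (simp add: L2_inner_diff_left L2_inner_sum_left L2_cmult L2_sum L2_inner_cmult_left)
  also have "(\<Sum>i\<in>A. L2_inner f (e i) * L2_inner (e i) f) = complex_of_real (\<Sum>i\<in>A. (cmod (L2_inner f (e i)))\<^sup>2)"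
    unfolding of_real_sum complex_norm_square
    by (intro sum.cong refl) (metis L2_inner_commute)
  finally show ?thesis
    unfolding L2_inner_self of_real_diff[symmetric] of_real_eq_iff .
qed

lemma Bessel:
  assumes "orthonormal_on A e" "finite A" "f \<in> L2"
  shows "(\<Sum>i\<in>A. (cmod (L2_inner f (e i)))\<^sup>2) \<le> L2_norm_sq f"
  using residual_norm_sq[OF assms] L2_norm_sq_nonneg[of "residual f A e"] by simp

text \<open>
  The increments have squared norms at most $4^{-k}$, so the sum of $2^k|r_k-r_{k+1}|^2$ has a finite
  integral and is finite almost everywhere. At such a point the increments are
  $O(2^{-k/2})$, hence summable. The weight $2^k$ replaces Minkowski's inequality.
\<close>

lemma nn_integral_fast_Cauchy_imp_AE_convergent:
  fixes r :: "nat \<Rightarrow> 'a \<Rightarrow> complex"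
  assumes [measurable]: "\<And>k. r k \<in> borel_measurable M"
    and close: "\<And>k. (\<integral>\<^sup>+x. ennreal ((norm (r k x - r (Suc k) x))\<^sup>2) \<partial>M) \<le> ennreal ((1/4)^k)"
  shows "AE x in M. convergent (\<lambda>k. r k x)"
proof -
  have "(\<integral>\<^sup>+x. (\<Sum>k. ennreal (2^k * (norm (r k x - r (Suc k) x))\<^sup>2)) \<partial>M)
      = (\<Sum>k. \<integral>\<^sup>+x. ennreal (2^k * (norm (r k x - r (Suc k) x))\<^sup>2) \<partial>M)"
    by (rule nn_integral_suminf) measurable
  also have "\<dots> = (\<Sum>k. ennreal (2^k) * (\<integral>\<^sup>+x. ennreal ((norm (r k x - r (Suc k) x))\<^sup>2) \<partial>M))"
    by (simp add: ennreal_mult' nn_integral_cmult)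
  also have "\<dots> \<le> (\<Sum>k. ennreal (2^k) * ennreal ((1/4)^k))"
    by (intro suminf_le mult_left_mono close) auto
  also have "\<dots> = (\<Sum>k. ennreal ((1/2)^k))"
  proof (intro arg_cong[where f=suminf] ext)
    fix k :: nat
    have "(2::real)^k * (1/4)^k = (1/2)^k" by (simp flip: power_mult_distrib)
    then show "ennreal (2^k) * ennreal ((1/4)^k) = ennreal ((1/2)^k)"
      by (simp flip: ennreal_mult')
  qed
  also have "\<dots> = ennreal (\<Sum>k. (1/2)^k)"
    by (rule suminf_ennreal2) auto
  also have "\<dots> < \<infinity>" by simp
  finally have "(\<integral>\<^sup>+x. (\<Sum>k. ennreal (2^k * (norm (r k x - r (Suc k) x))\<^sup>2)) \<partial>M) \<noteq> \<infinity>"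
    by simp
  then have "AE x in M. (\<Sum>k. ennreal (2^k * (norm (r k x - r (Suc k) x))\<^sup>2)) \<noteq> \<infinity>"
    by (intro nn_integral_PInf_AE) measurable
  then show ?thesis
  proof eventually_elim
    fix x assume "(\<Sum>k. ennreal (2^k * (norm (r k x - r (Suc k) x))\<^sup>2)) \<noteq> \<infinity>"
    then have sum: "summable (\<lambda>k. 2^k * (norm (r k x - r (Suc k) x))\<^sup>2)"
      by (intro summable_suminf_not_top) auto
    then obtain B where B: "\<And>k. 2^k * (norm (r k x - r (Suc k) x))\<^sup>2 \<le> B"
      using BseqD[OF summable_imp_Bseq[OF sum]] by (fastforce simp: abs_le_iff)
    have "norm (r (Suc k) x - r k x) \<le> sqrt B * (1 / sqrt 2)^k" for k
    proof -
      have "(norm (r (Suc k) x - r k x))\<^sup>2 \<le> B / 2^k"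
        using B[of k] by (simp add: field_simps norm_minus_commute)
      then have "norm (r (Suc k) x - r k x) \<le> sqrt (B / 2^k)"
        by (rule real_le_rsqrt)
      also have "\<dots> = sqrt B * (1 / sqrt 2)^k"
        by (simp add: real_sqrt_divide real_sqrt_power power_divide)
      finally show ?thesis .
    qed
    moreover have "summable (\<lambda>k. sqrt B * (1 / sqrt 2)^k)"
      by (intro summable_mult summable_geometric) simp
    ultimately have "summable (\<lambda>k. r (Suc k) x - r k x)"
      by (rule summable_comparison_test'[rotated])
    then have "convergent (\<lambda>n. \<Sum>k<n. r (Suc k) x - r k x)"
      by (simp only: summable_iff_convergent)
    then have "convergent (\<lambda>n. r n x - r 0 x)"
      by (simp only: sum_lessThan_telescope[of "\<lambda>k. r k x"])
    then have "convergent (\<lambda>n. (r n x - r 0 x) + r 0 x)"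
      by (intro convergent_add convergent_const)
    then show "convergent (\<lambda>k. r k x)" by simp
  qed
qed

text \<open>
  Completeness of $L^2$ along a rapidly converging sequence: the limit exists pointwise almost
  everywhere, and Fatou's lemma transfers the Cauchy bounds to it.
\<close>

lemma Riesz_Fischer_fast:
  fixes r :: "nat \<Rightarrow> (real^'d) \<Rightarrow> complex"
  assumes mem: "\<And>k. r k \<in> L2"
    and close: "\<And>j k. j \<le> k \<Longrightarrow> L2_norm_sq (\<lambda>x. r j x - r k x) \<le> (1/4)^j"
  obtains r' where "r' \<in> L2" "\<And>k. L2_norm_sq (\<lambda>x. r k x - r' x) \<le> (1/4)^k"
proof
  note [measurable] = mem[THEN L2_measurable]
  define r' where "r' = (\<lambda>x. lim (\<lambda>k. r k x))"
  have meas [measurable]: "r' \<in> borel_measurable lebesgue"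
    unfolding r'_def by (rule borel_measurable_lim_metric) measurable
  have nn: "(\<integral>\<^sup>+x. ennreal ((norm (r j x - r k x))\<^sup>2) \<partial>lebesgue) \<le> ennreal ((1/4)^j)" if "j \<le> k" for j k
    using close[OF that] by (simp add: nn_integral_L2[OF L2_diff] mem)
  have "AE x in lebesgue. convergent (\<lambda>k. r k x)"
    by (rule nn_integral_fast_Cauchy_imp_AE_convergent) (auto intro!: nn simp del: power_divide)
  then have lim: "AE x in lebesgue. (\<lambda>k. r k x) \<longlonglongrightarrow> r' x"
    by eventually_elim (simp add: r'_def convergent_LIMSEQ_iff)
  have bound: "(\<integral>\<^sup>+x. ennreal ((norm (r j x - r' x))\<^sup>2) \<partial>lebesgue) \<le> ennreal ((1/4)^j)" for j
  proof -
    have "(\<integral>\<^sup>+x. ennreal ((norm (r j x - r' x))\<^sup>2) \<partial>lebesgue)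
       = (\<integral>\<^sup>+x. liminf (\<lambda>k. ennreal ((norm (r j x - r k x))\<^sup>2)) \<partial>lebesgue)"
    proof (rule nn_integral_cong_AE)
      show "AE x in lebesgue. ennreal ((norm (r j x - r' x))\<^sup>2) = liminf (\<lambda>k. ennreal ((norm (r j x - r k x))\<^sup>2))"
        using lim
      proof eventually_elim
        fix x assume "(\<lambda>k. r k x) \<longlonglongrightarrow> r' x"
        then have "(\<lambda>k. ennreal ((norm (r j x - r k x))\<^sup>2)) \<longlonglongrightarrow> ennreal ((norm (r j x - r' x))\<^sup>2)"
          by (intro tendsto_intros)
        from lim_imp_Liminf[OF _ this]
        show "ennreal ((norm (r j x - r' x))\<^sup>2) = liminf (\<lambda>k. ennreal ((norm (r j x - r k x))\<^sup>2))"
          by simp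
      qed
    qed
    also have "\<dots> \<le> liminf (\<lambda>k. \<integral>\<^sup>+x. ennreal ((norm (r j x - r k x))\<^sup>2) \<partial>lebesgue)"
      by (rule nn_integral_liminf) measurable
    also have "\<dots> \<le> limsup (\<lambda>k. \<integral>\<^sup>+x. ennreal ((norm (r j x - r k x))\<^sup>2) \<partial>lebesgue)"
      by (rule Liminf_le_Limsup) simp
    also have "\<dots> \<le> ennreal ((1/4)^j)"
      using nn by (intro Limsup_bounded eventually_sequentiallyI[of j]) (simp del: power_divide)
    finally show ?thesis .
  qed
  have diff: "(\<lambda>x. r k x - r' x) \<in> L2" for k
  proof (rule L2_I)
    show "(\<integral>\<^sup>+x. ennreal ((norm (r k x - r' x))\<^sup>2) \<partial>lebesgue) < \<infinity>"
      by (rule le_less_trans[OF bound]) simp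
  qed measurable
  show "r' \<in> L2"
    using L2_diff[OF mem[of 0] diff[of 0]] by simp
  show "L2_norm_sq (\<lambda>x. r k x - r' x) \<le> (1/4)^k" for k
    using bound[of k] by (simp add: nn_integral_L2[OF diff])
qed

lemma residual_diff_norm_sq:
  assumes "orthonormal_on B e" "finite B" "A \<subseteq> B"
  shows "L2_norm_sq (\<lambda>x. residual f A e x - residual f B e x) = (\<Sum>i\<in>B - A. (cmod (L2_inner f (e i)))\<^sup>2)"
proof -
  have "(\<lambda>x. residual f A e x - residual f B e x) = (\<lambda>x. \<Sum>i\<in>B - A. L2_inner f (e i) * e i x)"
    unfolding residual_def using assms(2,3) by (simp add: sum_diff)
  then show ?thesis
    using assms orthonormal_sum_norm_sq[OF orthonormal_on_subset[OF assms(1) Diff_subset[of B A]]] by simp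
qed

text \<open>
  The residuals of the expansion along a sufficiently sparse sequence of partial sums converge in
  $L^2$. The limit is orthogonal to every basis vector, so it vanishes, and the norms of the residuals,
  which are the defects in Bessel's inequality, tend to 0.
\<close>

lemma Parseval:
  assumes e: "L2_orthonormal_basis e" and f: "f \<in> L2"
  shows "(\<lambda>n. (cmod (L2_inner f (e n)))\<^sup>2) sums L2_norm_sq f"
proof -
  let ?c = "\<lambda>n. (cmod (L2_inner f (e n)))\<^sup>2"
  have on: "orthonormal_on A e" for A
    using e unfolding L2_orthonormal_basis_def orthonormal_on_def by auto
  have mem: "e n \<in> L2" for n using e unfolding L2_orthonormal_basis_def by auto
  have summable: "summable ?c"
    by (rule summableI_nonneg_bounded[where x="L2_norm_sq f"]) (auto intro!: Bessel on f)
  have "\<exists>N. \<forall>m\<ge>N. \<forall>n. norm (sum ?c {m..<n}) < (1/4)^k" for k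
    using summable unfolding summable_Cauchy by (auto simp del: power_divide)
  then obtain N where N: "\<And>k m n. N k \<le> m \<Longrightarrow> norm (sum ?c {m..<n}) < (1/4)^k"
    by metis
  \<comment> \<open>Made monotone and at least $k$, so that the partial sums exhaust all indices.\<close>
  define L where "L k = k + Max (N ` {..k})" for k
  have LN: "N k \<le> L k" for k unfolding L_def by (intro trans_le_add2 Max_ge) auto
  have Lmono: "L j \<le> L k" if "j \<le> k" for j k
    unfolding L_def using that by (intro add_mono Max_mono) auto
  have Lk: "k \<le> L k" for k unfolding L_def by simp
  \<comment> \<open>Consecutive residuals are close enough for the completeness lemma.\<close>
  define r where "r k = residual f {..<L k} e" for k
  have rmem: "r k \<in> L2" for k unfolding r_def by (intro residual_L2 on f)
  have close: "L2_norm_sq (\<lambda>x. r j x - r k x) \<le> (1/4)^j" if "j \<le> k" for j k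
  proof -
    have "L2_norm_sq (\<lambda>x. r j x - r k x) = sum ?c ({..<L k} - {..<L j})"
      unfolding r_def using Lmono[OF that] by (intro residual_diff_norm_sq on) auto
    also have "{..<L k} - {..<L j} = {L j..<L k}" by auto
    also have "sum ?c {L j..<L k} \<le> (1/4)^j"
      using N[OF LN[of j], of "L k"] by (simp add: sum_nonneg del: power_divide)
    finally show ?thesis .
  qed
  obtain r' where r': "r' \<in> L2" "\<And>k. L2_norm_sq (\<lambda>x. r k x - r' x) \<le> (1/4)^k"
    using Riesz_Fischer_fast[OF rmem close] by blast
  have "L2_inner r' (e m) = 0" for m
  proof -
    have norm1: "L2_norm_sq (e m) = 1"
      using e unfolding L2_orthonormal_basis_def by (metis L2_inner_self of_real_eq_1_iff)
    have "(cmod (L2_inner r' (e m)))\<^sup>2 \<le> (1/4)^k" if "m < k" for k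
    proof -
      have "L2_inner (r k) (e m) = 0"
        unfolding r_def using that Lk[of k] by (subst residual_inner[OF on[of UNIV]]) (auto simp: f)
      then have "L2_inner (\<lambda>x. r k x - r' x) (e m) = - L2_inner r' (e m)"
        by (simp add: L2_inner_diff_left rmem r' mem)
      then have "(cmod (L2_inner r' (e m)))\<^sup>2 \<le> L2_norm_sq (\<lambda>x. r k x - r' x) * L2_norm_sq (e m)"
        using L2_Cauchy_Schwarz[OF L2_diff[OF rmem[of k] r'(1)] mem[of m]] by simp
      then show ?thesis using r'(2)[of k] norm1 by simp
    qed
    then have "(cmod (L2_inner r' (e m)))\<^sup>2 \<le> 0"
      by (intro LIMSEQ_le_const[OF LIMSEQ_realpow_zero[of "1/4"]] exI[of _ "Suc m"]) (auto simp del: power_divide)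
    then show ?thesis by simp
  qed
  then have "AE x in lebesgue. r' x = 0"
    using e r'(1) unfolding L2_orthonormal_basis_def by blast
  then have "L2_norm_sq (\<lambda>x. r k x - r' x) = L2_norm_sq (r k)" for k
    unfolding L2_norm_sq_def using r'(1) rmem[of k]
    by (intro Bochner_Integration.integral_cong_AE) (auto simp: L2_def elim!: eventually_mono)
  then have small: "L2_norm_sq (r k) \<le> (1/4)^k" for k using r'(2) by metis
  have part: "L2_norm_sq (r k) = L2_norm_sq f - sum ?c {..<L k}" for k
    unfolding r_def by (intro residual_norm_sq on f) auto
  have "(\<lambda>k. L2_norm_sq f - sum ?c {..<L k}) \<longlonglongrightarrow> 0"
  proof (rule tendsto_sandwich[OF _ _ tendsto_const LIMSEQ_realpow_zero[of "1/4"]])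
    show "eventually (\<lambda>k. 0 \<le> L2_norm_sq f - sum ?c {..<L k}) sequentially"
      unfolding part[symmetric] by (simp add: L2_norm_sq_nonneg)
    show "eventually (\<lambda>k. L2_norm_sq f - sum ?c {..<L k} \<le> (1/4)^k) sequentially"
      unfolding part[symmetric] using small by auto
  qed auto
  moreover have "(\<lambda>k. L2_norm_sq f - sum ?c {..<L k}) \<longlonglongrightarrow> L2_norm_sq f - suminf ?c"
    using filterlim_at_top_mono[OF filterlim_ident always_eventually[rule_format, OF Lk]]
    by (intro tendsto_intros filterlim_compose[OF summable_LIMSEQ[OF summable]])
  ultimately have "suminf ?c = L2_norm_sq f"
    using LIMSEQ_unique by fastforce
  then show ?thesis using summable by (simp add: sums_iff)
qed

section \<open>Existence of an orthonormal basis\<close>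

lemma countable_nonzero_coefficients:
  assumes on: "orthonormal_on M (\<lambda>e. e)" and f: "f \<in> L2"
  shows "countable {e\<in>M. L2_inner f e \<noteq> 0}"
proof -
  have "(\<lambda>e. (cmod (L2_inner f e))\<^sup>2) summable_on M"
  proof (rule nonneg_bdd_above_summable_on)
    show "bdd_above (sum (\<lambda>e. (cmod (L2_inner f e))\<^sup>2) ` {F. F \<subseteq> M \<and> finite F})"
      using Bessel[OF orthonormal_on_subset[OF on] _ f]
      by (intro bdd_aboveI[of _ "L2_norm_sq f"]) auto
  qed auto
  then have "countable {e\<in>M. (cmod (L2_inner f e))\<^sup>2 \<noteq> 0}"
    by (intro summable_countable_real)
  then show ?thesis by simp
qed

lemma ex_maximal_orthonormal:
  obtains M :: "((real^'d) \<Rightarrow> complex) set" where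
    "orthonormal_on M (\<lambda>e. e)"
    "\<And>f. f \<in> L2 \<Longrightarrow> (\<And>e. e \<in> M \<Longrightarrow> L2_inner f e = 0) \<Longrightarrow> AE x in lebesgue. f x = 0"
proof -
  let ?\<A> = "{M :: ((real^'d) \<Rightarrow> complex) set. orthonormal_on M (\<lambda>e. e)}"
  have "\<exists>M\<in>?\<A>. \<forall>X\<in>?\<A>. M \<subseteq> X \<longrightarrow> X = M"
  proof (rule Zorn_Lemma, intro ballI)
    fix C assume C: "C \<in> chains ?\<A>"
    have "e \<in> L2 \<and> L2_inner e e' = (if e = e' then 1 else 0)" if "e \<in> X" "X \<in> C" "e' \<in> X'" "X' \<in> C" for e e' X X'
    proof -
      have "X \<subseteq> X' \<or> X' \<subseteq> X" using C that by (auto simp: chains_def chain_subset_def)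
      then have "\<exists>Y\<in>C. e \<in> Y \<and> e' \<in> Y" using that by auto
      then obtain Y where "Y \<in> C" "e \<in> Y" "e' \<in> Y" by auto
      moreover then have "orthonormal_on Y (\<lambda>e. e)" using C by (auto simp: chains_def)
      ultimately show ?thesis unfolding orthonormal_on_def by auto
    qed
    then show "\<Union>C \<in> ?\<A>" unfolding orthonormal_on_def by blast
  qed
  then obtain M :: "((real^'d) \<Rightarrow> complex) set" where M: "orthonormal_on M (\<lambda>e. e)" and
    max: "\<And>X. orthonormal_on X (\<lambda>e. e) \<Longrightarrow> M \<subseteq> X \<Longrightarrow> X = M" by auto
  show thesis
  proof (rule that[OF M])
    fix f assume f: "f \<in> L2" "\<And>e. e \<in> M \<Longrightarrow> L2_inner f e = 0"
    show "AE x in lebesgue. f x = 0"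
    proof (rule ccontr)
      assume "\<not> (AE x in lebesgue. f x = 0)"
      then have pos: "L2_norm_sq f > 0"
        using L2_norm_sq_eq_0_iff[OF f(1)] L2_norm_sq_nonneg[of f] by linarith
      define g where "g = (\<lambda>x. complex_of_real (1 / sqrt (L2_norm_sq f)) * f x)"
      have g: "g \<in> L2" unfolding g_def by (intro L2_cmult f)
      have gg: "L2_inner g g = 1"
        unfolding g_def L2_inner_cmult_left L2_inner_cmult_right L2_inner_self
        using pos by (simp flip: of_real_mult add: real_sqrt_mult_self)
      have ge: "L2_inner g e = 0" "L2_inner e g = 0" if "e \<in> M" for e
        using f(2)[OF that] L2_inner_commute[of e f] unfolding g_def L2_inner_cmult_left L2_inner_cmult_right
        by auto
      then have "g \<notin> M" using gg by force
      moreover have "orthonormal_on (insert g M) (\<lambda>e. e)"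
        using M g gg ge unfolding orthonormal_on_def by auto
      ultimately show False using max[of "insert g M"] by auto
    qed
  qed
qed

definition rational_points :: "'a::euclidean_space set" where
  "rational_points = {a. \<forall>i\<in>Basis. a \<bullet> i \<in> \<rat>}"

lemma countable_rational_points: "countable (rational_points :: 'a::euclidean_space set)"
proof (rule countable_subset)
  show "rational_points \<subseteq> (\<lambda>f. \<Sum>i\<in>Basis. f i *\<^sub>R (i::'a)) ` (Basis \<rightarrow>\<^sub>E \<rat>)"
  proof
    fix a :: 'a assume "a \<in> rational_points"
    then have "(\<lambda>i\<in>Basis. a \<bullet> i) \<in> Basis \<rightarrow>\<^sub>E \<rat>" by (auto simp: rational_points_def)
    moreover have "a = (\<Sum>i\<in>Basis. (\<lambda>i\<in>Basis. a \<bullet> i) i *\<^sub>R i)"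
      by (simp add: euclidean_representation)
    ultimately show "a \<in> (\<lambda>f. \<Sum>i\<in>Basis. f i *\<^sub>R (i::'a)) ` (Basis \<rightarrow>\<^sub>E \<rat>)" by blast
  qed
  show "countable ((\<lambda>f. \<Sum>i\<in>Basis. f i *\<^sub>R (i::'a)) ` (Basis \<rightarrow>\<^sub>E \<rat>))"
    by (intro countable_image countable_PiE) (auto simp: countable_rat)
qed

text \<open>
  The positive and the negative part of $h$ are densities of two measures that agree on all boxes
  with rational corners. These boxes are stable under intersection and generate the Borel sets, so
  the measures, and hence their densities, coincide.
\<close>

lemma AE_zero_if_rational_box_integrals_zero:
  fixes h :: "'a::euclidean_space \<Rightarrow> real"
  assumes [measurable]: "h \<in> borel_measurable lborel"
    and int: "\<And>a b. integrable lborel (\<lambda>x. indicator (box a b) x * h x)"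
    and zero: "\<And>a b. a \<in> rational_points \<Longrightarrow> b \<in> rational_points \<Longrightarrow>
       (LINT x|lborel. indicator (box a b) x * h x) = 0"
  shows "AE x in lborel. h x = 0"
proof -
  define M where "M = density lborel (\<lambda>x. ennreal (h x))"
  define N where "N = density lborel (\<lambda>x. ennreal (- h x))"
  define E where "E = {box a b :: 'a set |a b. a \<in> rational_points \<and> b \<in> rational_points}"
  have ME: "emeasure M (box a b) = (\<integral>\<^sup>+x. ennreal (indicator (box a b) x * h x) \<partial>lborel)"
    and NE: "emeasure N (box a b) = (\<integral>\<^sup>+x. ennreal (- (indicator (box a b) x * h x)) \<partial>lborel)" for a b
    unfolding M_def N_def
    by (auto simp: emeasure_density intro!: nn_integral_cong split: split_indicator)
  have finM: "emeasure M (box a b) \<noteq> \<infinity>" and finN: "emeasure N (box a b) \<noteq> \<infinity>" for a b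
    unfolding ME NE using int[of a b] real_integrable_def by auto
  have eqE: "emeasure M X = emeasure N X" if "X \<in> E" for X
  proof -
    obtain a b where X: "X = box a b" and ab: "a \<in> rational_points" "b \<in> rational_points"
      using \<open>X \<in> E\<close> unfolding E_def by auto
    have "0 = enn2real (emeasure M X) - enn2real (emeasure N X)"
      unfolding X ME NE zero[OF ab, symmetric] by (rule real_lebesgue_integral_def[OF int])
    then show ?thesis
      using finM[of a b] finN[of a b] unfolding X
      by (metis diff_eq_diff_eq diff_self ennreal_enn2real infinity_ennreal_def less_top)
  qed
  have "sigma_sets UNIV {S. open S} = sigma_sets UNIV E"
  proof (rule sigma_sets_eqI)
    fix S :: "'a set" assume "S \<in> {S. open S}"
    then have S: "open S" by simp
    define I where "I = {f\<in>Basis \<rightarrow>\<^sub>E \<rat> \<times> \<rat>. box (\<Sum>i\<in>Basis. fst (f i) *\<^sub>R i) (\<Sum>i\<in>Basis. snd (f i) *\<^sub>R i) \<subseteq> S}"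
    have "S = (\<Union>f\<in>I. box (\<Sum>i\<in>Basis. fst (f i) *\<^sub>R i) (\<Sum>i\<in>Basis. snd (f i) *\<^sub>R i))"
      using open_UNION_box[OF S] unfolding I_def by simp
    moreover have "(\<Union>f\<in>I. box (\<Sum>i\<in>Basis. fst (f i) *\<^sub>R i) (\<Sum>i\<in>Basis. snd (f i) *\<^sub>R i)) \<in> sigma_sets UNIV E"
    proof (rule sigma_sets_UNION)
      show "countable ((\<lambda>f. box (\<Sum>i\<in>Basis. fst (f i) *\<^sub>R i) (\<Sum>i\<in>Basis. snd (f i) *\<^sub>R (i::'a))) ` I)"
        unfolding I_def
        by (intro countable_image countable_Collect countable_PiE) (auto simp: countable_rat)
      fix X assume "X \<in> (\<lambda>f. box (\<Sum>i\<in>Basis. fst (f i) *\<^sub>R i) (\<Sum>i\<in>Basis. snd (f i) *\<^sub>R (i::'a))) ` I"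
      then obtain f where f: "f \<in> I" "X = box (\<Sum>i\<in>Basis. fst (f i) *\<^sub>R i) (\<Sum>i\<in>Basis. snd (f i) *\<^sub>R (i::'a))" by auto
      then have "(\<Sum>i\<in>Basis. fst (f i) *\<^sub>R (i::'a)) \<in> rational_points" "(\<Sum>i\<in>Basis. snd (f i) *\<^sub>R (i::'a)) \<in> rational_points"
        unfolding rational_points_def I_def by (auto simp: PiE_iff mem_Times_iff)
      then have "X \<in> E" unfolding f(2) E_def by blast
      then show "X \<in> sigma_sets UNIV E" by auto
    qed
    ultimately show "S \<in> sigma_sets UNIV E" by simp
  next
    fix S assume "S \<in> E"
    then have "open S" unfolding E_def by auto
    then show "S \<in> sigma_sets UNIV {S. open S}" by auto
  qed
  then have gen: "sets borel = sigma_sets UNIV E"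
    by (simp add: borel_def)
  have "M = N"
  proof (rule measure_eqI_generator_eq)
    show "Int_stable E"
    proof (rule Int_stableI)
      fix X Y assume "X \<in> E" "Y \<in> E"
      then obtain a b c d where ab: "X = box a b" "Y = box c d"
        "a \<in> rational_points" "b \<in> rational_points" "c \<in> rational_points" "d \<in> rational_points"
        unfolding E_def by auto
      have "X \<inter> Y = box (\<Sum>i\<in>Basis. max (a \<bullet> i) (c \<bullet> i) *\<^sub>R i) (\<Sum>i\<in>Basis. min (b \<bullet> i) (d \<bullet> i) *\<^sub>R i)"
        unfolding ab by (rule box_Int_box)
      moreover have "(\<Sum>i\<in>Basis. max (a \<bullet> i) (c \<bullet> i) *\<^sub>R i) \<in> rational_points"
        "(\<Sum>i\<in>Basis. min (b \<bullet> i) (d \<bullet> i) *\<^sub>R i) \<in> rational_points"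
        using ab unfolding rational_points_def by (auto simp: max_def min_def)
      ultimately show "X \<inter> Y \<in> E" unfolding E_def by blast
    qed
    show "E \<subseteq> Pow UNIV" by simp
    show "\<And>X. X \<in> E \<Longrightarrow> emeasure M X = emeasure N X" by (rule eqE)
    show "sets M = sigma_sets UNIV E" "sets N = sigma_sets UNIV E"
      unfolding M_def N_def by (simp_all add: gen)
    show "range (\<lambda>n. box (- real n *\<^sub>R One) (real n *\<^sub>R One)) \<subseteq> E"
      unfolding E_def rational_points_def by (auto intro!: exI)
    show "(\<Union>n. box (- real n *\<^sub>R One) (real n *\<^sub>R One)) = (UNIV :: 'a set)"
      using UN_box_eq_UNIV by simp
    show "\<And>n. emeasure M (box (- real n *\<^sub>R One) (real n *\<^sub>R One)) \<noteq> \<infinity>"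
      by (rule finM)
  qed
  then have "AE x in lborel. ennreal (h x) = ennreal (- h x)"
    unfolding M_def N_def by (intro sigma_finite_measure.density_unique[OF sigma_finite_lborel]) auto
  then show ?thesis
    by eventually_elim (metis ennreal_eq_0_iff ennreal_neg linorder_le_cases neg_le_0_iff_le order_antisym)
qed

lemma indicator_L2:
  assumes "A \<in> sets lebesgue" "emeasure lebesgue A < \<infinity>"
  shows "(indicator A :: (real^'d) \<Rightarrow> complex) \<in> L2"
proof (rule L2_I)
  show "(indicator A :: (real^'d) \<Rightarrow> complex) \<in> borel_measurable lebesgue"
    using assms(1) by (rule borel_measurable_indicator)
  have "(\<integral>\<^sup>+x. ennreal ((norm (indicator A x :: complex))\<^sup>2) \<partial>lebesgue) = (\<integral>\<^sup>+x. indicator A x \<partial>lebesgue)"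
    by (intro nn_integral_cong) (auto split: split_indicator)
  then show "(\<integral>\<^sup>+x. ennreal ((norm (indicator A x :: complex))\<^sup>2) \<partial>lebesgue) < \<infinity>"
    using assms by simp
qed

lemma emeasure_lebesgue_box_finite: "emeasure lebesgue (box a b) < \<infinity>"
  using emeasure_lborel_box_finite[of a b] by (simp add: top.not_eq_extremum)

lemma L2_zero_if_orthogonal_to_rational_boxes:
  fixes f :: "(real^'d) \<Rightarrow> complex"
  assumes f: "f \<in> L2"
    and orth: "\<And>a b. a \<in> rational_points \<Longrightarrow> b \<in> rational_points \<Longrightarrow> L2_inner f (indicator (box a b)) = 0"
  shows "AE x in lebesgue. f x = 0"
proof -
  have box: "(indicator (box a b) :: (real^'d) \<Rightarrow> complex) \<in> L2" for a b
    by (intro indicator_L2 emeasure_lebesgue_box_finite) auto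
  have "integrable lebesgue (\<lambda>x. f x * cnj (indicator (box a b) x))" for a b
    by (rule L2_integrable_mult[OF f box])
  then have int: "integrable lebesgue (\<lambda>x. indicator (box a b) x * f x)" for a b
    by (rule back_subst[of "integrable lebesgue"]) (auto split: split_indicator)
  have zero: "(LINT x|lebesgue. indicator (box a b) x * f x) = 0"
    if "a \<in> rational_points" "b \<in> rational_points" for a b
    using orth[OF that] unfolding L2_inner_def
    by (rule back_subst[of "\<lambda>z. z = 0"]) (auto intro!: Bochner_Integration.integral_cong split: split_indicator)
  have part: "AE x in lebesgue. T (f x) = 0" if T: "bounded_linear T" for T :: "complex \<Rightarrow> real"
  proof -
    have "(\<lambda>x. T (f x)) \<in> borel_measurable lebesgue"
      using borel_measurable_continuous_on[OF linear_continuous_on[OF T] L2_measurable[OF f]] .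
    then obtain h where h[measurable]: "h \<in> borel_measurable lborel" and ae: "AE x in lborel. T (f x) = h x"
      using completion_ex_borel_measurable_real by blast
    have ae': "AE x in lebesgue. indicator (box a b) x * h x = T (indicator (box a b) x * f x)" for a b
      using AE_completion[OF ae]
      by eventually_elim (auto split: split_indicator simp: linear_0[OF bounded_linear.linear[OF T]])
    have meas: "(\<lambda>x. indicator (box a b) x * h x) \<in> borel_measurable lborel" for a b by measurable
    have meas': "(\<lambda>x. indicator (box a b) x * h x) \<in> borel_measurable lebesgue" for a b
      using meas by (rule measurable_completion)
    have intT: "integrable lebesgue (\<lambda>x. T (indicator (box a b) x * f x))" for a b
      by (rule integrable_bounded_linear[OF T int])
    have int': "integrable lebesgue (\<lambda>x. indicator (box a b) x * h x)" for a b
      using intT by (rule integrable_cong_AE_imp) (use ae'[of a b] meas'[of a b] in \<open>auto elim!: eventually_mono\<close>)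
    have eq: "(LINT x|lebesgue. indicator (box a b) x * h x) = (LINT x|lebesgue. T (indicator (box a b) x * f x))" for a b
      by (rule Bochner_Integration.integral_cong_AE[OF meas' borel_measurable_integrable[OF intT] ae'])
    have "AE x in lborel. h x = 0"
    proof (rule AE_zero_if_rational_box_integrals_zero[OF h])
      show "integrable lborel (\<lambda>x. indicator (box a b) x * h x)" for a b
        using int' integrable_completion[OF meas] by blast
      show "(LINT x|lborel. indicator (box a b) x * h x) = 0" if "a \<in> rational_points" "b \<in> rational_points" for a b
      proof -
        have "(LINT x|lborel. indicator (box a b) x * h x) = (LINT x|lebesgue. indicator (box a b) x * h x)"
          by (rule integral_completion[OF meas, symmetric])
        also have "\<dots> = T (LINT x|lebesgue. indicator (box a b) x * f x)"
          unfolding eq by (rule integral_bounded_linear[OF T int])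
        finally show ?thesis using zero[OF that] by (simp add: linear_0[OF bounded_linear.linear[OF T]])
      qed
    qed
    with ae have "AE x in lborel. T (f x) = 0" by eventually_elim simp
    then show ?thesis by (rule AE_completion)
  qed
  show ?thesis
    using part[OF bounded_linear_Re] part[OF bounded_linear_Im]
    by eventually_elim (simp add: complex_eq_iff)
qed

text \<open>
  Indicators of disjoint unit cubes. They show that $L^2$ is not finite-dimensional, so that a basis can be
  indexed by all natural numbers.
\<close>

lemma ex_orthonormal_sequence:
  "\<exists>h :: nat \<Rightarrow> (real^'d) \<Rightarrow> complex. orthonormal_on UNIV h"
proof
  let ?B = "\<lambda>j::nat. box (real j *\<^sub>R One) (real (Suc j) *\<^sub>R One) :: (real^'d) set"
  have mem: "indicator (?B j) \<in> L2" for j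
    by (intro indicator_L2 emeasure_lebesgue_box_finite) auto
  have disj: "?B i \<inter> ?B j = {}" if "i \<noteq> j" for i j
  proof -
    have "False" if "i < j" "x \<in> ?B i" "x \<in> ?B j" for i j x
    proof -
      obtain b :: "real^'d" where "b \<in> Basis" by (meson nonempty_Basis ex_in_conv)
      then have "x \<bullet> b < real (Suc i)" "real j < x \<bullet> b" using that(2,3) by (auto simp: mem_box)
      then show False using that(1) by linarith
    qed
    then show ?thesis using \<open>i \<noteq> j\<close> by (metis disjoint_iff linorder_neqE_nat)
  qed
  have vol: "measure lebesgue (?B j) = 1" for j
    by (simp add: measure_lborel_box_eq algebra_simps inner_diff_left)
  have "L2_inner (indicator (?B i)) (indicator (?B j)) = (if i = j then 1 else 0)" for i j
  proof (cases "i = j")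
    case True
    have "L2_inner (indicator (?B i)) (indicator (?B i)) = (LINT x|lebesgue. complex_of_real (indicator (?B i) x))"
      unfolding L2_inner_def by (intro Bochner_Integration.integral_cong refl) (auto split: split_indicator)
    also have "\<dots> = complex_of_real (measure lebesgue (?B i))"
      by (simp only: integral_complex_of_real integral_indicator) simp
    finally show ?thesis unfolding vol using True by simp
  next
    case False
    then have "L2_inner (indicator (?B i)) (indicator (?B j)) = (LINT x|(lebesgue :: (real^'d) measure). 0)"
      unfolding L2_inner_def using disj[OF False]
      by (intro Bochner_Integration.integral_cong refl) (auto simp: disjoint_iff split: split_indicator)
    then show ?thesis using False by simp
  qed
  then show "orthonormal_on UNIV (\<lambda>j. indicator (?B j))"
    unfolding orthonormal_on_def using mem by blast
qed

text \<open>
  A maximal orthonormal set $M$ is total. It is countable because each of its elements has a nonzero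
  coefficient against the indicator of one of countably many boxes, and by Bessel each indicator has
  only countably many nonzero coefficients. If $M$ were finite, expanding one more than
  $|M|$ orthonormal vectors in $M$ and counting squared coefficients would contradict Bessel.
\<close>

theorem ex_L2_orthonormal_basis: "\<exists>e :: nat \<Rightarrow> (real^'d) \<Rightarrow> complex. L2_orthonormal_basis e"
proof -
  obtain M :: "((real^'d) \<Rightarrow> complex) set" where on: "orthonormal_on M (\<lambda>e. e)" and
    total: "\<And>f. f \<in> L2 \<Longrightarrow> (\<And>e. e \<in> M \<Longrightarrow> L2_inner f e = 0) \<Longrightarrow> AE x in lebesgue. f x = 0"
    using ex_maximal_orthonormal by blast
  have mem: "e \<in> L2" if "e \<in> M" for e using on that by (auto simp: orthonormal_on_def)
  have unit: "L2_norm_sq e = 1" if "e \<in> M" for e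
    using on that unfolding orthonormal_on_def by (metis L2_inner_self of_real_eq_1_iff)
  define Q where "Q = (rational_points :: (real^'d) set)"
  have box: "(indicator (box a b) :: (real^'d) \<Rightarrow> complex) \<in> L2" for a b
    by (intro indicator_L2 emeasure_lebesgue_box_finite) auto
  have "M \<subseteq> (\<Union>(a, b)\<in>Q \<times> Q. {e\<in>M. L2_inner (indicator (box a b)) e \<noteq> 0})"
  proof
    fix e assume e: "e \<in> M"
    show "e \<in> (\<Union>(a, b)\<in>Q \<times> Q. {e\<in>M. L2_inner (indicator (box a b)) e \<noteq> 0})"
    proof (rule ccontr)
      assume *: "e \<notin> (\<Union>(a, b)\<in>Q \<times> Q. {e\<in>M. L2_inner (indicator (box a b)) e \<noteq> 0})"
      have "L2_inner e (indicator (box a b)) = 0" if "a \<in> Q" "b \<in> Q" for a b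
        using * e that by (subst L2_inner_commute) auto
      then have "AE x in lebesgue. e x = 0"
        unfolding Q_def using L2_zero_if_orthogonal_to_rational_boxes[OF mem[OF e]] by blast
      then show False using L2_norm_sq_eq_0_iff[OF mem[OF e]] unit[OF e] by simp
    qed
  qed
  moreover have "countable \<dots>"
    using countable_rational_points countable_nonzero_coefficients[OF on box]
    by (intro countable_UN) (auto simp: Q_def)
  ultimately have count: "countable M" by (rule countable_subset)
  have inf: "infinite M"
  proof
    assume fin: "finite M"
    have expand: "L2_norm_sq f = (\<Sum>e\<in>M. (cmod (L2_inner f e))\<^sup>2)" if f: "f \<in> L2" for f
    proof -
      let ?r = "residual f M (\<lambda>e. e)"
      have r: "?r \<in> L2" by (rule residual_L2[OF on f])
      have "AE x in lebesgue. ?r x = 0"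
        by (rule total[OF r]) (simp add: residual_inner[OF on subset_refl fin f])
      then have "L2_norm_sq ?r = 0" using L2_norm_sq_eq_0_iff[OF r] by simp
      then show ?thesis using residual_norm_sq[OF on fin f] by simp
    qed
    obtain h :: "nat \<Rightarrow> (real^'d) \<Rightarrow> complex" where h: "orthonormal_on UNIV h"
      using ex_orthonormal_sequence by blast
    have hmem: "h j \<in> L2" and hunit: "L2_norm_sq (h j) = 1" for j
      using h unfolding orthonormal_on_def
      by (auto simp: L2_inner_self) (metis L2_inner_self of_real_eq_1_iff)
    let ?N = "{..<Suc (card M)}"
    have "real (Suc (card M)) = (\<Sum>j\<in>?N. L2_norm_sq (h j))" by (simp add: hunit)
    also have "\<dots> = (\<Sum>j\<in>?N. \<Sum>e\<in>M. (cmod (L2_inner (h j) e))\<^sup>2)"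
      by (intro sum.cong refl expand hmem)
    also have "\<dots> = (\<Sum>e\<in>M. \<Sum>j\<in>?N. (cmod (L2_inner (h j) e))\<^sup>2)"
      by (rule sum.swap)
    also have "\<dots> = (\<Sum>e\<in>M. \<Sum>j\<in>?N. (cmod (L2_inner e (h j)))\<^sup>2)"
      by (subst L2_inner_commute) simp
    also have "\<dots> \<le> (\<Sum>e\<in>M. L2_norm_sq e)"
      by (intro sum_mono Bessel orthonormal_on_subset[OF h] mem) auto
    also have "\<dots> = real (card M)" by (simp add: unit)
    finally show False by simp
  qed
  define e where "e = from_nat_into M"
  have bij: "bij_betw e UNIV M" unfolding e_def by (rule bij_betw_from_nat_into[OF count inf])
  then have range: "range e = M" and inj: "inj e" by (auto simp: bij_betw_def)
  have eM: "e n \<in> M" for n using range by auto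
  have "L2_orthonormal_basis e"
    unfolding L2_orthonormal_basis_def
  proof (intro conjI allI ballI impI)
    show "range e \<subseteq> L2" using range mem by auto
    show "L2_inner (e m) (e n) = (if m = n then 1 else 0)" for m n
      using on eM[of m] eM[of n] inj_eq[OF inj] unfolding orthonormal_on_def by auto
    fix f :: "(real^'d) \<Rightarrow> complex" assume "f \<in> L2" "\<forall>n. L2_inner f (e n) = 0"
    then show "AE x in lebesgue. f x = 0"
      using range by (intro total) auto
  qed
  then show ?thesis by blast
qed

section \<open>Fubini's theorem for bounded kernels\<close>

lemma sigma_finite_lebesgue: "sigma_finite_measure (lebesgue :: 'a::euclidean_space measure)"
proof -
  obtain A :: "'a set set" where "countable A" "A \<subseteq> sets lborel" "\<Union>A = space lborel" "\<forall>a\<in>A. emeasure lborel a \<noteq> \<infinity>"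
    using sigma_finite_lborel unfolding sigma_finite_measure_def by metis
  then show ?thesis
    unfolding sigma_finite_measure_def
    by (intro exI[of _ A]) (auto simp: subset_eq)
qed

interpretation lebesgue: sigma_finite_measure "lebesgue :: 'a::euclidean_space measure"
  by (rule sigma_finite_lebesgue)

interpretation lebesgue_pair: pair_sigma_finite "lebesgue :: 'a::euclidean_space measure" "lebesgue :: 'b::euclidean_space measure" ..

lemma measurable_lebesgue_borel: "f \<in> borel_measurable borel \<Longrightarrow> f \<in> borel_measurable lebesgue"
  by (intro measurable_completion) simp

text \<open>
  Lebesgue measurability does not pass to functions of $x-y$ on the product of the completed
  measures. Kernels therefore enter as continuous or Borel functions of the pair, and sets are replaced by
  Borel sets where they have to be translated.
\<close>

lemma continuous_imp_measurable_lebesgue_pair: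
  fixes K :: "'a::euclidean_space \<times> 'b::euclidean_space \<Rightarrow> 'c::topological_space"
  assumes "continuous_on UNIV K"
  shows "K \<in> borel_measurable (lebesgue \<Otimes>\<^sub>M lebesgue)"
proof -
  have id: "(\<lambda>x::'z::euclidean_space. x) \<in> lebesgue \<rightarrow>\<^sub>M borel"
    by (intro measurable_completion) simp
  have "(\<lambda>p. (fst p, snd p)) \<in> (lebesgue :: 'a measure) \<Otimes>\<^sub>M (lebesgue :: 'b measure) \<rightarrow>\<^sub>M borel \<Otimes>\<^sub>M borel"
    by (intro measurable_Pair measurable_compose[OF measurable_fst id] measurable_compose[OF measurable_snd id])
  then have "(\<lambda>p. p) \<in> (lebesgue :: 'a measure) \<Otimes>\<^sub>M (lebesgue :: 'b measure) \<rightarrow>\<^sub>M borel"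
    by (simp add: borel_prod)
  from measurable_compose[OF this borel_measurable_continuous_onI[OF assms]] show ?thesis by simp
qed

lemma
  fixes f :: "'a \<Rightarrow> complex" and g :: "'b \<Rightarrow> complex" and K :: "'a \<times> 'b \<Rightarrow> complex"
  assumes "pair_sigma_finite M N" and f: "integrable M f" and g: "integrable N g"
    and K[measurable]: "K \<in> borel_measurable (M \<Otimes>\<^sub>M N)" and B: "\<And>p. norm (K p) \<le> B"
  shows integral_swap_bounded_kernel:
      "(LINT y|N. (LINT x|M. f x * K (x, y)) * g y) = (LINT x|M. f x * (LINT y|N. K (x, y) * g y))"
    and integrable_bounded_kernel_left: "integrable N (\<lambda>y. (LINT x|M. f x * K (x, y)) * g y)"
    and integrable_bounded_kernel_right: "integrable M (\<lambda>x. f x * (LINT y|N. K (x, y) * g y))"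
proof -
  interpret pair_sigma_finite M N by fact
  note [measurable] = borel_measurable_integrable[OF f] borel_measurable_integrable[OF g]
  have B0: "0 \<le> B" using B[of undefined] norm_ge_zero order_trans by blast
  have inner: "integrable N (\<lambda>y. K (x, y) * g y)" if "x \<in> space M" for x
  proof (rule Bochner_Integration.integrable_bound)
    show "integrable N (\<lambda>y. B * norm (g y))" using g by simp
    show "(\<lambda>y. K (x, y) * g y) \<in> borel_measurable N" using that by measurable
    show "AE y in N. norm (K (x, y) * g y) \<le> norm (B * norm (g y))"
      using B B0 by (intro AE_I2) (auto simp: norm_mult intro!: mult_right_mono)
  qed
  have "integrable (M \<Otimes>\<^sub>M N) (\<lambda>p. f (fst p) * K p * g (snd p))"
  proof (rule Fubini_integrable)
    show "(\<lambda>p. f (fst p) * K p * g (snd p)) \<in> borel_measurable (M \<Otimes>\<^sub>M N)" by measurable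
    show "integrable M (\<lambda>x. LINT y|N. norm (f (fst (x, y)) * K (x, y) * g (snd (x, y))))"
    proof (rule Bochner_Integration.integrable_bound)
      show "integrable M (\<lambda>x. norm (f x) * (B * (LINT y|N. norm (g y))))"
        using f by (intro integrable_mult_left) auto
      show "(\<lambda>x. LINT y|N. norm (f (fst (x, y)) * K (x, y) * g (snd (x, y)))) \<in> borel_measurable M"
        by measurable
      show "AE x in M. norm (LINT y|N. norm (f (fst (x, y)) * K (x, y) * g (snd (x, y))))
          \<le> norm (norm (f x) * (B * (LINT y|N. norm (g y))))"
      proof (rule AE_I2)
        fix x assume x: "x \<in> space M"
        have "(LINT y|N. norm (f x * K (x, y) * g y)) \<le> (LINT y|N. norm (f x) * (B * norm (g y)))"
        proof (rule integral_mono)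
          show "integrable N (\<lambda>y. norm (f x * K (x, y) * g y))"
            using integrable_mult_right[OF inner[OF x], of "f x"] by (auto simp: mult.assoc)
          show "integrable N (\<lambda>y. norm (f x) * (B * norm (g y)))" using g by simp
          show "norm (f x * K (x, y) * g y) \<le> norm (f x) * (B * norm (g y))" for y
            using B by (auto simp: norm_mult mult.assoc intro!: mult_left_mono mult_right_mono)
        qed
        then show "norm (LINT y|N. norm (f (fst (x, y)) * K (x, y) * g (snd (x, y))))
          \<le> norm (norm (f x) * (B * (LINT y|N. norm (g y))))"
          using B0 by (simp add: abs_mult)
      qed
    qed
    show "AE x in M. integrable N (\<lambda>y. f (fst (x, y)) * K (x, y) * g (snd (x, y)))"
      using integrable_mult_right[OF inner] by (intro AE_I2) (auto simp: mult.assoc)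
  qed
  then have int: "integrable (M \<Otimes>\<^sub>M N) (\<lambda>(x, y). f x * K (x, y) * g y)"
    by (simp add: split_def)
  have 1: "(LINT x|M. f x * K (x, y) * g y) = (LINT x|M. f x * K (x, y)) * g y" for y
    by simp
  have 2: "(LINT y|N. f x * K (x, y) * g y) = f x * (LINT y|N. K (x, y) * g y)" for x
    by (simp add: mult.assoc)
  show "(LINT y|N. (LINT x|M. f x * K (x, y)) * g y) = (LINT x|M. f x * (LINT y|N. K (x, y) * g y))"
    using Fubini_integral[OF int] unfolding 1 2 .
  show "integrable N (\<lambda>y. (LINT x|M. f x * K (x, y)) * g y)"
    using integrable_snd[OF int] unfolding 1 .
  show "integrable M (\<lambda>x. f x * (LINT y|N. K (x, y) * g y))"
    using integrable_fst[OF int] unfolding 2 .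
qed

section \<open>Gaussians\<close>

abbreviation gaussian :: "real \<Rightarrow> 'a::real_normed_vector \<Rightarrow> real" where
  "gaussian t \<xi> \<equiv> exp (- t * (norm \<xi>)\<^sup>2 / 2)"

text \<open>
  The characteristic function of the standard normal distribution, rescaled.
\<close>

lemma gaussian_fourier_real:
  fixes a t :: real assumes t: "0 < t"
  shows "integrable lborel (\<lambda>u. complex_of_real (exp (- t * u\<^sup>2 / 2)) * iexp (a * u))"
    and "(LINT u|lborel. complex_of_real (exp (- t * u\<^sup>2 / 2)) * iexp (a * u))
     = complex_of_real (sqrt (2 * pi / t) * exp (- a\<^sup>2 / (2 * t)))"
proof -
  define F where "F u = complex_of_real (exp (- t * u\<^sup>2 / 2)) * iexp (a * u)" for u :: real
  let ?s = "1 / sqrt t"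
  have s: "?s \<noteq> 0" "\<bar>?s\<bar> = ?s" using t by auto
  have F: "F (0 + ?s * v) = complex_of_real (sqrt (2 * pi)) * (std_normal_density v *\<^sub>R iexp ((a * ?s) * v))" for v
  proof -
    have "t * (?s * v)\<^sup>2 = v\<^sup>2" using t by (simp add: power_mult_distrib power_divide)
    then show ?thesis
      unfolding F_def std_normal_density_def by (simp add: scaleR_conv_of_real mult_ac flip: of_real_mult)
  qed
  have int: "integrable lborel (\<lambda>v. std_normal_density v *\<^sub>R iexp ((a * ?s) * v))"
    by (rule Bochner_Integration.integrable_bound[of _ std_normal_density]) (auto simp: integrable_normal_density)
  have val: "(LINT v|lborel. std_normal_density v *\<^sub>R iexp ((a * ?s) * v)) = complex_of_real (exp (- (a * ?s)\<^sup>2 / 2))"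
  proof -
    have "(LINT v|lborel. std_normal_density v *\<^sub>R iexp ((a * ?s) * v)) = char std_normal_distribution (a * ?s)"
      unfolding char_def by (subst integral_density) auto
    then show ?thesis by (simp add: char_std_normal_distribution exp_of_real)
  qed
  have "integrable lborel (\<lambda>v. F (0 + ?s * v))"
    unfolding F using int by (rule integrable_mult_right)
  then show "integrable lborel F"
    using lborel_integrable_real_affine_iff[OF s(1), of F 0] by simp
  have "(LINT u|lborel. F u) = ?s *\<^sub>R (LINT v|lborel. F (0 + ?s * v))"
    using lborel_integral_real_affine[OF s(1), of F 0] s(2) by simp
  also have "\<dots> = ?s *\<^sub>R (complex_of_real (sqrt (2 * pi)) * complex_of_real (exp (- (a * ?s)\<^sup>2 / 2)))"
    by (simp only: F integral_mult_right_zero val)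
  also have "\<dots> = complex_of_real (sqrt (2 * pi / t) * exp (- a\<^sup>2 / (2 * t)))"
    using t by (simp add: scaleR_conv_of_real real_sqrt_divide power_mult_distrib power_divide field_simps flip: of_real_mult)
  finally show "(LINT u|lborel. F u) = complex_of_real (sqrt (2 * pi / t) * exp (- a\<^sup>2 / (2 * t)))" .
qed

lemma gaussian_fourier_lborel:
  fixes x :: "'a::euclidean_space" assumes t: "0 < t"
  shows "integrable lborel (\<lambda>\<xi>::'a. complex_of_real (gaussian t \<xi>) * iexp (x \<bullet> \<xi>))"
    (is "integrable lborel ?F")
    and "(LINT \<xi>|lborel. complex_of_real (gaussian t \<xi>) * iexp (x \<bullet> \<xi>))
     = complex_of_real ((2 * pi / t) powr (real DIM('a) / 2) * exp (- (norm x)\<^sup>2 / (2 * t)))"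
proof -
  interpret P: product_sigma_finite "\<lambda>_::'a. lborel :: real measure" ..
  let ?g = "\<lambda>b u. complex_of_real (exp (- t * u\<^sup>2 / 2)) * iexp ((x \<bullet> b) * u)"
  have meas: "?F \<in> borel_measurable borel" by measurable
  have emb: "(\<lambda>f. \<Sum>b\<in>Basis. f b *\<^sub>R b) \<in> (\<Pi>\<^sub>M b\<in>(Basis::'a set). lborel) \<rightarrow>\<^sub>M borel" by measurable
  have F: "?F (\<Sum>b\<in>Basis. f b *\<^sub>R b) = (\<Prod>b\<in>Basis. ?g b (f b))" for f
  proof -
    have n: "(norm (\<Sum>b\<in>Basis. f b *\<^sub>R b :: 'a))\<^sup>2 = (\<Sum>b\<in>(Basis::'a set). (f b)\<^sup>2)"
      by (subst norm_sum_Pythagorean) (auto simp: pairwise_def orthogonal_def inner_Basis power_mult_distrib)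
    have i: "x \<bullet> (\<Sum>b\<in>Basis. f b *\<^sub>R b) = (\<Sum>b\<in>Basis. (x \<bullet> b) * f b)"
      by (simp add: inner_sum_right mult.commute)
    have e1: "exp (- t * (\<Sum>b\<in>(Basis::'a set). (f b)\<^sup>2) / 2) = (\<Prod>b\<in>(Basis::'a set). exp (- t * (f b)\<^sup>2 / 2))"
      by (subst exp_sum[symmetric]) (simp_all add: sum_distrib_left sum_divide_distrib sum_negf)
    have e2: "iexp (\<Sum>b\<in>Basis. (x \<bullet> b) * f b) = (\<Prod>b\<in>Basis. iexp ((x \<bullet> b) * f b))"
      by (subst exp_sum[symmetric]) (simp_all add: sum_distrib_left)
    show ?thesis unfolding n i e1 e2 by (simp add: prod.distrib)
  qed
  have int: "integrable (\<Pi>\<^sub>M b\<in>(Basis::'a set). lborel) (\<lambda>f. \<Prod>b\<in>Basis. ?g b (f b))"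
    by (intro P.product_integrable_prod gaussian_fourier_real t) auto
  show "integrable lborel ?F"
    by (subst lborel_eq, subst integrable_distr_eq[OF emb meas]) (simp only: F int)
  have "integral\<^sup>L lborel ?F = integral\<^sup>L (\<Pi>\<^sub>M b\<in>(Basis::'a set). lborel) (\<lambda>f. \<Prod>b\<in>Basis. ?g b (f b))"
    by (subst lborel_eq, subst integral_distr[OF emb meas]) (simp only: F)
  also have "\<dots> = (\<Prod>b\<in>Basis. complex_of_real (sqrt (2 * pi / t) * exp (- (x \<bullet> b)\<^sup>2 / (2 * t))))"
    by (subst P.product_integral_prod) (auto simp only: gaussian_fourier_real[OF t] finite_Basis)
  also have "\<dots> = complex_of_real (sqrt (2 * pi / t) ^ DIM('a) * exp (\<Sum>b\<in>Basis. - (x \<bullet> b)\<^sup>2 / (2 * t)))"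
    by (simp only: of_real_prod[symmetric] prod.distrib prod_constant exp_sum[OF finite_Basis])
  also have "sqrt (2 * pi / t) ^ DIM('a) = (2 * pi / t) powr (real DIM('a) / 2)"
    using t by (simp add: powr_half_sqrt[symmetric] powr_powr flip: powr_realpow)
  also have "(\<Sum>b\<in>Basis. - (x \<bullet> b)\<^sup>2 / (2 * t)) = - (norm x)\<^sup>2 / (2 * t)"
    unfolding power2_norm_eq_inner euclidean_inner[of x x] by (simp add: sum_negf sum_divide_distrib power2_eq_square)
  finally show "integral\<^sup>L lborel ?F = complex_of_real ((2 * pi / t) powr (real DIM('a) / 2) * exp (- (norm x)\<^sup>2 / (2 * t)))" .
qed

section \<open>The Fourier integral is a contraction\<close>

text \<open>
  The inverse Fourier transform of the Gaussian \<open>gaussian t\<close>, normalized so that it is the density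
  of a normal distribution with variance $t$ in each coordinate.
\<close>

definition heat_kernel :: "real \<Rightarrow> real^'d \<Rightarrow> real" where
  "heat_kernel t z = (2 * pi * t) powr (- real CARD('d) / 2) * exp (- (norm z)\<^sup>2 / (2 * t))"

abbreviation plane_wave :: "(real^'d) \<times> (real^'d) \<Rightarrow> complex" where
  "plane_wave p \<equiv> iexp (fst p \<bullet> snd p)"

lemma plane_wave_measurable [measurable]:
  "(plane_wave :: (real^'d) \<times> (real^'d) \<Rightarrow> complex) \<in> borel_measurable (lebesgue \<Otimes>\<^sub>M lebesgue)"
  by (intro continuous_imp_measurable_lebesgue_pair continuous_intros)

lemma cnj_plane_wave_measurable [measurable]:
  "(\<lambda>p :: (real^'d) \<times> (real^'d). cnj (plane_wave p)) \<in> borel_measurable (lebesgue \<Otimes>\<^sub>M lebesgue)"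
  by (intro continuous_imp_measurable_lebesgue_pair continuous_intros)

lemma heat_kernel_nonneg: "0 \<le> heat_kernel t z"
  unfolding heat_kernel_def by simp

lemma heat_kernel_measurable [measurable]: "heat_kernel t \<in> borel_measurable borel"
  unfolding heat_kernel_def by measurable

lemma heat_kernel_diff_measurable [measurable]:
  "0 < t \<Longrightarrow> (\<lambda>p :: (real^'d) \<times> (real^'d). heat_kernel t (fst p - snd p)) \<in> borel_measurable (lebesgue \<Otimes>\<^sub>M lebesgue)"
  unfolding heat_kernel_def
  by (intro continuous_imp_measurable_lebesgue_pair continuous_intros) auto

lemma nn_integral_lborel_reflect:
  fixes f :: "'a::euclidean_space \<Rightarrow> ennreal"
  assumes [measurable]: "f \<in> borel_measurable borel"
  shows "(\<integral>\<^sup>+y. f (x - y) \<partial>lborel) = (\<integral>\<^sup>+y. f y \<partial>lborel)"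
  by (subst (2) lborel_affine[of "-1" x]) (simp_all add: nn_integral_density nn_integral_distr)

lemma nn_integral_heat_kernel:
  fixes x :: "real^'d"
  assumes t: "0 < t"
  shows "(\<integral>\<^sup>+y. ennreal (heat_kernel t (y::real^'d)) \<partial>lborel) = 1"
    and "(\<integral>\<^sup>+y. ennreal (heat_kernel t (x - y)) \<partial>lebesgue) = 1"
    and "(\<integral>\<^sup>+y. ennreal (heat_kernel t (y - x)) \<partial>lebesgue) = 1"
proof -
  let ?c = "(2 * pi * t) powr (- real CARD('d) / 2)"
  have t': "0 < 1 / t" using t by simp
  have eq: "complex_of_real (exp (- (1 / t) * (norm \<xi>)\<^sup>2 / 2)) * iexp (0 \<bullet> \<xi>)
     = complex_of_real (exp (- (norm \<xi>)\<^sup>2 / (2 * t)))" for \<xi> :: "real^'d"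
    by simp
  have int: "integrable lborel (\<lambda>\<xi>::real^'d. exp (- (norm \<xi>)\<^sup>2 / (2 * t)))"
    using gaussian_fourier_lborel(1)[OF t', of "0::real^'d"] unfolding eq by (simp only: complex_of_real_integrable_eq)
  have "complex_of_real (LINT \<xi>|(lborel :: (real^'d) measure). exp (- (norm \<xi>)\<^sup>2 / (2 * t))) =
     complex_of_real ((2 * pi * t) powr (real CARD('d) / 2))"
    using gaussian_fourier_lborel(2)[OF t', of "0::real^'d"] unfolding eq integral_complex_of_real
    by simp
  then have val: "(LINT \<xi>|(lborel :: (real^'d) measure). exp (- (norm \<xi>)\<^sup>2 / (2 * t))) = (2 * pi * t) powr (real CARD('d) / 2)"
    unfolding of_real_eq_iff .
  have "(\<integral>\<^sup>+y. ennreal (heat_kernel t (y::real^'d)) \<partial>lborel) = ennreal (LINT y|(lborel :: (real^'d) measure). heat_kernel t y)"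
    unfolding heat_kernel_def using int by (intro nn_integral_eq_integral) auto
  also have "(LINT y|(lborel :: (real^'d) measure). heat_kernel t y) = 1"
    unfolding heat_kernel_def integral_mult_right_zero val using t by (simp flip: powr_add)
  finally show 1: "(\<integral>\<^sup>+y. ennreal (heat_kernel t (y::real^'d)) \<partial>lborel) = 1" by simp
  show "(\<integral>\<^sup>+y. ennreal (heat_kernel t (x - y)) \<partial>lebesgue) = 1"
    using nn_integral_lborel_reflect[of "\<lambda>y. ennreal (heat_kernel t y)" x] 1
    by (simp add: nn_integral_completion)
  moreover have "heat_kernel t (y - x) = heat_kernel t (x - y)" for y
    unfolding heat_kernel_def by (simp add: norm_minus_commute)
  ultimately show "(\<integral>\<^sup>+y. ennreal (heat_kernel t (y - x)) \<partial>lebesgue) = 1"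
    by simp
qed

lemma gaussian_fourier_heat:
  fixes z :: "real^'d"
  assumes t: "0 < t"
  shows "integrable lebesgue (\<lambda>\<xi>::real^'d. complex_of_real (gaussian t \<xi>))"
    and "complex_of_real ((2 * pi) powr (- real CARD('d))) *
      (LINT \<xi>|lebesgue. complex_of_real (gaussian t \<xi>) * iexp (z \<bullet> \<xi>))
     = complex_of_real (heat_kernel t z)"
proof -
  show "integrable lebesgue (\<lambda>\<xi>::real^'d. complex_of_real (gaussian t \<xi>))"
    using gaussian_fourier_lborel(1)[OF t, of "0::real^'d"]
    by (subst integrable_completion) auto
  have "(LINT \<xi>|lebesgue. complex_of_real (gaussian t \<xi>) * iexp (z \<bullet> \<xi>))
     = complex_of_real ((2 * pi / t) powr (real CARD('d) / 2) * exp (- (norm z)\<^sup>2 / (2 * t)))"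
    using gaussian_fourier_lborel(2)[OF t, of z] by (subst integral_completion) auto
  moreover have "(2 * pi) powr (- real CARD('d)) * (2 * pi / t) powr (real CARD('d) / 2) = (2 * pi * t) powr (- real CARD('d) / 2)"
  proof -
    have "(2 * pi) powr (- real CARD('d)) = (2 * pi) powr (- real CARD('d) / 2) * (2 * pi) powr (- real CARD('d) / 2)"
      by (simp flip: powr_add)
    then show ?thesis using t
      by (simp add: powr_divide powr_mult powr_minus field_simps)
  qed
  ultimately show "complex_of_real ((2 * pi) powr (- real CARD('d))) *
      (LINT \<xi>|lebesgue. complex_of_real (gaussian t \<xi>) * iexp (z \<bullet> \<xi>))
     = complex_of_real (heat_kernel t z)"
    unfolding heat_kernel_def by (simp only: of_real_mult[symmetric] mult.assoc[symmetric])
qed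

lemma fourier_integral_measurable_borel:
  fixes f :: "(real^'d) \<Rightarrow> complex"
  assumes f: "f \<in> borel_measurable lebesgue"
  shows "fourier_integral f \<in> borel_measurable borel"
proof -
  have id: "(\<lambda>x. x) \<in> (lebesgue :: (real^'d) measure) \<rightarrow>\<^sub>M borel"
    by (intro measurable_completion) simp
  have pw: "(plane_wave :: (real^'d) \<times> (real^'d) \<Rightarrow> complex) \<in> borel_measurable (borel \<Otimes>\<^sub>M borel)"
    unfolding borel_prod by (intro borel_measurable_continuous_onI continuous_intros)
  have pair: "(\<lambda>p. (snd p, fst p)) \<in> (borel :: (real^'d) measure) \<Otimes>\<^sub>M (lebesgue :: (real^'d) measure) \<rightarrow>\<^sub>M borel \<Otimes>\<^sub>M borel"
    by (intro measurable_Pair measurable_compose[OF measurable_snd id] measurable_fst)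
  have "(\<lambda>(\<xi>, x). f x * plane_wave (x, \<xi>)) \<in> borel_measurable (borel \<Otimes>\<^sub>M lebesgue)"
    unfolding split_def
    using measurable_compose[OF pair pw]
    by (intro borel_measurable_times measurable_compose[OF measurable_snd f]) simp
  then have "(\<lambda>\<xi>. LINT x|lebesgue. f x * plane_wave (x, \<xi>)) \<in> borel_measurable borel"
    by (rule lebesgue.borel_measurable_lebesgue_integral)
  then show ?thesis unfolding fourier_integral_def by simp
qed

lemma fourier_integral_measurable:
  fixes f :: "(real^'d) \<Rightarrow> complex"
  shows "f \<in> borel_measurable lebesgue \<Longrightarrow> fourier_integral f \<in> borel_measurable lebesgue"
  by (rule measurable_lebesgue_borel[OF fourier_integral_measurable_borel])

lemma norm_fourier_integral_le:
  "norm (fourier_integral f \<xi>) \<le> (2 * pi) powr (- real CARD('d) / 2) * (LINT x|lebesgue. norm (f x))"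
  for f :: "(real^'d) \<Rightarrow> complex"
  unfolding fourier_integral_def norm_mult
  using integral_norm_bound[of lebesgue "\<lambda>x. f x * iexp (x \<bullet> \<xi>)"]
  by (intro mult_mono) (auto simp: norm_mult)

text \<open>
  Expanding $|\mathcal{F}f|^2$ as a double integral and integrating the Gaussian weight first replaces the
  oscillating factor $e^{i(x-y)\cdot\xi}$ by the heat kernel at $x-y$.
\<close>

lemma fourier_energy_heat_kernel:
  fixes f :: "(real^'d) \<Rightarrow> complex"
  assumes f: "integrable lebesgue f" and t: "0 < t"
  shows "integrable lebesgue (\<lambda>\<xi>. complex_of_real (gaussian t \<xi> * (norm (fourier_integral f \<xi>))\<^sup>2))"
    and "(LINT \<xi>|lebesgue. complex_of_real (gaussian t \<xi> * (norm (fourier_integral f \<xi>))\<^sup>2))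
     = (LINT x|lebesgue. f x * (LINT y|lebesgue. cnj (f y) * complex_of_real (heat_kernel t (x - y))))"
proof -
  define c where "c = complex_of_real ((2 * pi) powr (- real CARD('d) / 2))"
  define w where "w \<xi> = complex_of_real (gaussian t \<xi>)" for \<xi> :: "real^'d"
  have wint: "integrable lebesgue w" unfolding w_def by (rule gaussian_fourier_heat(1)[OF t])
  have [measurable]: "w \<in> borel_measurable lebesgue" using wint by auto
  have [measurable]: "f \<in> borel_measurable lebesgue" using f by auto
  note [measurable] = fourier_integral_measurable
  \<comment> \<open>Two applications of the exchange lemma: first over $x$ and $\xi$ with this $g$, then over $y$ and $\xi$.\<close>
  define g where "g \<xi> = c * w \<xi> * cnj (fourier_integral f \<xi>)" for \<xi>
  have g: "integrable lebesgue g"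
  proof (rule Bochner_Integration.integrable_bound)
    define B where "B = (2 * pi) powr (- real CARD('d) / 2) * (LINT x|lebesgue. norm (f x))"
    show "integrable lebesgue (\<lambda>\<xi>. c * w \<xi> * complex_of_real B)" using wint by simp
    show "g \<in> borel_measurable lebesgue" unfolding g_def by measurable
    have "0 \<le> B" unfolding B_def by simp
    moreover have "norm (fourier_integral f \<xi>) \<le> B" for \<xi>
      unfolding B_def by (rule norm_fourier_integral_le)
    ultimately show "AE \<xi> in lebesgue. norm (g \<xi>) \<le> norm (c * w \<xi> * complex_of_real B)"
      unfolding g_def by (intro AE_I2) (auto simp: norm_mult intro!: mult_left_mono)
  qed
  have Ff: "fourier_integral f \<xi> = c * (LINT x|lebesgue. f x * plane_wave (x, \<xi>))" for \<xi>
    unfolding fourier_integral_def c_def by simp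
  have cc: "cnj c = c" unfolding c_def by simp
  have c2: "c * c = complex_of_real ((2 * pi) powr (- real CARD('d)))"
    unfolding c_def by (simp flip: of_real_mult powr_add)
  have cnjF: "cnj (fourier_integral f \<xi>) = c * (LINT y|lebesgue. cnj (f y) * cnj (plane_wave (y, \<xi>)))" for \<xi>
    unfolding Ff complex_cnj_mult cc Bochner_Integration.integral_cnj[symmetric] by simp
  have sq: "complex_of_real (gaussian t \<xi> * (norm (fourier_integral f \<xi>))\<^sup>2)
     = (LINT x|lebesgue. f x * plane_wave (x, \<xi>)) * g \<xi>" for \<xi>
    unfolding of_real_mult complex_norm_square g_def w_def Ff by (simp add: mult_ac)
  note swap = lebesgue_pair.pair_sigma_finite_axioms f g plane_wave_measurable
  have nb: "norm (plane_wave p) \<le> 1" "norm (cnj (plane_wave p)) \<le> 1" for p :: "(real^'d) \<times> (real^'d)" by simp_all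
  show "integrable lebesgue (\<lambda>\<xi>. complex_of_real (gaussian t \<xi> * (norm (fourier_integral f \<xi>))\<^sup>2))"
    unfolding sq by (rule integrable_bounded_kernel_left[OF swap nb(1)])
  have inner: "(LINT \<xi>|lebesgue. plane_wave (x, \<xi>) * g \<xi>)
     = (LINT y|lebesgue. cnj (f y) * complex_of_real (heat_kernel t (x - y)))" for x
  proof -
    have wp: "integrable lebesgue (\<lambda>\<xi>. plane_wave (x, \<xi>) * w \<xi>)"
    proof (rule Bochner_Integration.integrable_bound[OF wint])
      show "(\<lambda>\<xi>. plane_wave (x, \<xi>) * w \<xi>) \<in> borel_measurable lebesgue"
        unfolding w_def by (intro measurable_lebesgue_borel borel_measurable_continuous_onI) (auto intro!: continuous_intros)
    qed (simp add: norm_mult)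
    have "(LINT \<xi>|lebesgue. plane_wave (x, \<xi>) * g \<xi>)
      = c * c * (LINT \<xi>|lebesgue. (LINT y|lebesgue. cnj (f y) * cnj (plane_wave (y, \<xi>))) * (plane_wave (x, \<xi>) * w \<xi>))"
      unfolding g_def cnjF by (subst integral_mult_right_zero[symmetric]) (simp add: mult_ac)
    also have "\<dots> = c * c * (LINT y|lebesgue. cnj (f y) * (LINT \<xi>|lebesgue. cnj (plane_wave (y, \<xi>)) * (plane_wave (x, \<xi>) * w \<xi>)))"
      by (subst integral_swap_bounded_kernel[OF lebesgue_pair.pair_sigma_finite_axioms _ wp cnj_plane_wave_measurable nb(2)])
         (use f in auto)
    also have "\<dots> = (LINT y|lebesgue. cnj (f y) * (c * c * (LINT \<xi>|lebesgue. cnj (plane_wave (y, \<xi>)) * (plane_wave (x, \<xi>) * w \<xi>))))"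
      by (subst integral_mult_right_zero[symmetric]) (simp add: mult_ac)
    also have "(\<lambda>y. c * c * (LINT \<xi>|lebesgue. cnj (plane_wave (y, \<xi>)) * (plane_wave (x, \<xi>) * w \<xi>))) =
       (\<lambda>y. complex_of_real (heat_kernel t (x - y)))"
    proof
      fix y
      have "iexp ((x - y) \<bullet> \<xi>) = cnj (plane_wave (y, \<xi>)) * plane_wave (x, \<xi>)" for \<xi>
        by (simp add: exp_cnj inner_diff_left right_diff_distrib flip: exp_add)
      then have eq: "cnj (plane_wave (y, \<xi>)) * (plane_wave (x, \<xi>) * w \<xi>)
          = complex_of_real (gaussian t \<xi>) * iexp ((x - y) \<bullet> \<xi>)" for \<xi>
        unfolding w_def by (simp add: mult_ac)
      show "c * c * (LINT \<xi>|lebesgue. cnj (plane_wave (y, \<xi>)) * (plane_wave (x, \<xi>) * w \<xi>)) = complex_of_real (heat_kernel t (x - y))"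
        unfolding c2 eq by (rule gaussian_fourier_heat(2)[OF t])
    qed
    finally show ?thesis .
  qed
  show "(LINT \<xi>|lebesgue. complex_of_real (gaussian t \<xi> * (norm (fourier_integral f \<xi>))\<^sup>2))
     = (LINT x|lebesgue. f x * (LINT y|lebesgue. cnj (f y) * complex_of_real (heat_kernel t (x - y))))"
    unfolding sq integral_swap_bounded_kernel[OF swap nb(1)] inner ..
qed

lemma norm_integral_le_nn_integral:
  fixes f :: "'a \<Rightarrow> complex"
  shows "ennreal (norm (integral\<^sup>L M f)) \<le> (\<integral>\<^sup>+x. ennreal (norm (f x)) \<partial>M)"
  by (cases "integrable M f") (auto simp: integral_norm_bound_ennreal not_integrable_integral_eq)

text \<open>
  Schur's test for the heat kernel, whose rows and columns have total mass 1: bound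
  $|f(x)||f(y)|$ by the mean of $|f(x)|^2$ and $|f(y)|^2$.
\<close>

lemma nn_integral_gaussian_fourier_le:
  fixes f :: "(real^'d) \<Rightarrow> complex"
  assumes f: "integrable lebesgue f" and t: "0 < t"
  shows "(\<integral>\<^sup>+\<xi>. ennreal (gaussian t \<xi> * (norm (fourier_integral f \<xi>))\<^sup>2) \<partial>lebesgue)
    \<le> L2_mass f"
proof -
  let ?G = "\<lambda>\<xi>. gaussian t \<xi> * (norm (fourier_integral f \<xi>))\<^sup>2"
  let ?h = "\<lambda>x y. ennreal (heat_kernel t (x - y))"
  let ?q = "\<lambda>x. ennreal ((norm (f x))\<^sup>2 / 2)"
  have [measurable]: "f \<in> borel_measurable lebesgue" using f by auto
  have hq: "(\<lambda>p :: (real^'d) \<times> (real^'d). ?h (fst p) (snd p) * ?q (snd p)) \<in> borel_measurable (lebesgue \<Otimes>\<^sub>M lebesgue)"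
    by (intro borel_measurable_times_ennreal measurable_compose[OF heat_kernel_diff_measurable[OF t] measurable_ennreal]
      measurable_compose[OF measurable_snd]) measurable
  have heat_left [measurable]: "(\<lambda>y. ?h x y) \<in> borel_measurable lebesgue" for x :: "real^'d"
    by (intro measurable_lebesgue_borel) measurable
  have int: "integrable lebesgue ?G"
    using fourier_energy_heat_kernel(1)[OF f t] by (simp only: complex_of_real_integrable_eq)
  have "(\<integral>\<^sup>+\<xi>. ennreal (?G \<xi>) \<partial>lebesgue) = ennreal (norm (LINT \<xi>|lebesgue. complex_of_real (?G \<xi>)))"
    unfolding integral_complex_of_real norm_of_real
    by (subst nn_integral_eq_integral[OF int]) auto
  also have "\<dots> \<le> (\<integral>\<^sup>+x. ennreal (norm (f x * (LINT y|lebesgue. cnj (f y) * complex_of_real (heat_kernel t (x - y))))) \<partial>lebesgue)"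
    unfolding fourier_energy_heat_kernel(2)[OF f t] by (rule norm_integral_le_nn_integral)
  also have "\<dots> \<le> (\<integral>\<^sup>+x. (\<integral>\<^sup>+y. ?q x * ?h x y + ?h x y * ?q y \<partial>lebesgue) \<partial>lebesgue)"
  proof (rule nn_integral_mono)
    fix x
    have "ennreal (norm (f x * (LINT y|lebesgue. cnj (f y) * complex_of_real (heat_kernel t (x - y)))))
      \<le> ennreal (norm (f x)) * (\<integral>\<^sup>+y. ennreal (norm (cnj (f y) * complex_of_real (heat_kernel t (x - y)))) \<partial>lebesgue)"
      unfolding norm_mult[of "f x"] by (subst ennreal_mult) (auto intro!: mult_left_mono norm_integral_le_nn_integral)
    also have "\<dots> = (\<integral>\<^sup>+y. ennreal (norm (f x)) * (ennreal (norm (f y)) * ?h x y) \<partial>lebesgue)"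
      by (subst nn_integral_cmult[symmetric])
         (auto simp: norm_mult ennreal_mult heat_kernel_nonneg intro!: nn_integral_cong)
    also have "\<dots> \<le> (\<integral>\<^sup>+y. ?q x * ?h x y + ?h x y * ?q y \<partial>lebesgue)"
    proof (rule nn_integral_mono)
      fix y
      have "0 \<le> (norm (f x) - norm (f y))\<^sup>2" by simp
      then have "norm (f x) * norm (f y) \<le> (norm (f x))\<^sup>2 / 2 + (norm (f y))\<^sup>2 / 2"
        by (simp add: power2_diff)
      then have "(norm (f x) * norm (f y)) * heat_kernel t (x - y) \<le> ((norm (f x))\<^sup>2 / 2 + (norm (f y))\<^sup>2 / 2) * heat_kernel t (x - y)"
        by (intro mult_right_mono heat_kernel_nonneg)
      then have "ennreal (norm (f x) * (norm (f y) * heat_kernel t (x - y)))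
        \<le> ennreal ((norm (f x))\<^sup>2 / 2 * heat_kernel t (x - y) + heat_kernel t (x - y) * ((norm (f y))\<^sup>2 / 2))"
        by (intro ennreal_leI) (simp add: algebra_simps)
      then show "ennreal (norm (f x)) * (ennreal (norm (f y)) * ?h x y) \<le> ?q x * ?h x y + ?h x y * ?q y"
        by (simp add: heat_kernel_nonneg flip: ennreal_mult ennreal_plus)
    qed
    finally show "ennreal (norm (f x * (LINT y|lebesgue. cnj (f y) * complex_of_real (heat_kernel t (x - y)))))
      \<le> (\<integral>\<^sup>+y. ?q x * ?h x y + ?h x y * ?q y \<partial>lebesgue)" .
  qed
  also have "\<dots> = (\<integral>\<^sup>+x. ?q x + (\<integral>\<^sup>+y. ?h x y * ?q y \<partial>lebesgue) \<partial>lebesgue)"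
    by (intro nn_integral_cong) (simp add: nn_integral_add nn_integral_cmult nn_integral_heat_kernel[OF t])
  also have "\<dots> = (\<integral>\<^sup>+x. ?q x \<partial>lebesgue) + (\<integral>\<^sup>+x. (\<integral>\<^sup>+y. ?h x y * ?q y \<partial>lebesgue) \<partial>lebesgue)"
  proof (rule nn_integral_add)
    show "(\<lambda>x. \<integral>\<^sup>+y. ?h x y * ?q y \<partial>lebesgue) \<in> borel_measurable lebesgue"
      using lebesgue.borel_measurable_nn_integral_fst[OF hq] by simp
  qed measurable
  also have "(\<integral>\<^sup>+x. (\<integral>\<^sup>+y. ?h x y * ?q y \<partial>lebesgue) \<partial>lebesgue) = (\<integral>\<^sup>+y. (\<integral>\<^sup>+x. ?h x y * ?q y \<partial>lebesgue) \<partial>lebesgue)"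
    using hq by (intro lebesgue_pair.Fubini'[symmetric]) (simp add: split_def)
  also have "\<dots> = (\<integral>\<^sup>+y. ?q y \<partial>lebesgue)"
  proof (rule nn_integral_cong)
    fix y :: "real^'d"
    have "(\<lambda>x. ?h x y) \<in> borel_measurable lebesgue"
      by (intro measurable_lebesgue_borel) measurable
    then show "(\<integral>\<^sup>+x. ?h x y * ?q y \<partial>lebesgue) = ?q y"
      by (simp add: nn_integral_multc nn_integral_heat_kernel[OF t])
  qed
  also have "(\<integral>\<^sup>+x. ?q x \<partial>lebesgue) + (\<integral>\<^sup>+x. ?q x \<partial>lebesgue) = L2_mass f"
    by (subst nn_integral_add[symmetric]) (auto simp flip: ennreal_plus)
  finally show ?thesis .
qed

text \<open>
  Remove the Gaussian weight by letting $t \to 0$ in Fatou's lemma.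
\<close>

lemma fourier_integral_contraction:
  fixes f :: "(real^'d) \<Rightarrow> complex"
  assumes f: "integrable lebesgue f"
  shows "L2_mass (fourier_integral f) \<le> L2_mass f"
proof -
  let ?u = "\<lambda>n \<xi>. ennreal (exp (- (1 / real (Suc n)) * (norm \<xi>)\<^sup>2 / 2) * (norm (fourier_integral f \<xi>))\<^sup>2)"
  have [measurable]: "fourier_integral f \<in> borel_measurable lebesgue"
    using f by (intro fourier_integral_measurable) auto
  have [measurable]: "(\<lambda>\<xi>::real^'d. exp (- a * (norm \<xi>)\<^sup>2 / 2)) \<in> borel_measurable lebesgue" for a
    by (intro measurable_lebesgue_borel) measurable
  have lim: "(\<lambda>n. ?u n \<xi>) \<longlonglongrightarrow> ennreal ((norm (fourier_integral f \<xi>))\<^sup>2)" for \<xi>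
  proof -
    have "(\<lambda>n. exp (- (1 / real (Suc n)) * (norm \<xi>)\<^sup>2 / 2) * (norm (fourier_integral f \<xi>))\<^sup>2)
      \<longlonglongrightarrow> exp (- 0 * (norm \<xi>)\<^sup>2 / 2) * (norm (fourier_integral f \<xi>))\<^sup>2"
      by (intro tendsto_intros LIMSEQ_Suc[OF lim_1_over_n]) auto
    then show ?thesis by (intro tendsto_ennrealI) simp
  qed
  have "L2_mass (fourier_integral f) = (\<integral>\<^sup>+\<xi>. liminf (\<lambda>n. ?u n \<xi>) \<partial>lebesgue)"
    using lim_imp_Liminf[OF _ lim] by simp
  also have "\<dots> \<le> liminf (\<lambda>n. \<integral>\<^sup>+\<xi>. ?u n \<xi> \<partial>lebesgue)"
    by (rule nn_integral_liminf) measurable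
  also have "\<dots> \<le> limsup (\<lambda>n. \<integral>\<^sup>+\<xi>. ?u n \<xi> \<partial>lebesgue)"
    by (rule Liminf_le_Limsup) simp
  also have "\<dots> \<le> L2_mass f"
    by (intro Limsup_bounded always_eventually allI nn_integral_gaussian_fourier_le f) simp
  finally show ?thesis .
qed

lemma inverse_fourier_integral_eq: "inverse_fourier_integral f x = cnj (fourier_integral (\<lambda>y. cnj (f y)) x)"
proof -
  have "cnj (LINT y|lebesgue. cnj (f y) * iexp (y \<bullet> x))
     = (LINT y|lebesgue. cnj (cnj (f y) * iexp (y \<bullet> x)))"
    by (rule Bochner_Integration.integral_cnj[symmetric])
  then show ?thesis
    unfolding inverse_fourier_integral_def fourier_integral_def
    by (simp add: exp_cnj inner_commute)
qed

section \<open>The Plancherel extension on integrable functions\<close>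

lemma L2_dist_sq_triangle:
  assumes "u \<in> borel_measurable lebesgue" "g \<in> L2" "h \<in> L2"
  shows "L2_dist_sq g h \<le> 2 * L2_dist_sq u g + 2 * L2_dist_sq u h"
proof -
  note [measurable] = assms(1) assms(2,3)[THEN L2_measurable]
  have "L2_dist_sq g h \<le> (\<integral>\<^sup>+x. 2 * ennreal ((norm (u x - g x))\<^sup>2) + 2 * ennreal ((norm (u x - h x))\<^sup>2) \<partial>lebesgue)"
    unfolding L2_dist_sq_def
  proof (rule nn_integral_mono)
    fix x
    have "norm (g x - h x) \<le> norm (u x - g x) + norm (u x - h x)"
      using norm_triangle_ineq4[of "u x - h x" "u x - g x"] by simp
    then have "(norm (g x - h x))\<^sup>2 \<le> (norm (u x - g x) + norm (u x - h x))\<^sup>2"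
      by (intro power_mono) auto
    also have "\<dots> \<le> 2 * (norm (u x - g x))\<^sup>2 + 2 * (norm (u x - h x))\<^sup>2"
      using sum_squares_bound[of "norm (u x - g x)" "norm (u x - h x)"] by (simp add: power2_sum)
    finally show "ennreal ((norm (g x - h x))\<^sup>2) \<le> 2 * ennreal ((norm (u x - g x))\<^sup>2) + 2 * ennreal ((norm (u x - h x))\<^sup>2)"
      unfolding ennreal_numeral[symmetric] by (simp add: flip: ennreal_mult ennreal_plus del: ennreal_numeral)
  qed
  also have "\<dots> = 2 * L2_dist_sq u g + 2 * L2_dist_sq u h"
    unfolding L2_dist_sq_def by (simp add: nn_integral_add nn_integral_cmult)
  finally show ?thesis .
qed

text \<open>
  A contraction that is additive on integrable functions is its own Plancherel extension there: the
  transforms of the truncations of $f$ converge to that of $f$, and $L^2$ limits are unique up to null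
  sets.
\<close>

lemma L2_extension_eq:
  fixes f :: "(real^'d) \<Rightarrow> complex"
  assumes f: "f \<in> L2" "integrable lebesgue f"
    and meas: "\<And>u. integrable lebesgue u \<Longrightarrow> K u \<in> borel_measurable lebesgue"
    and contr: "\<And>u. integrable lebesgue u \<Longrightarrow>
      L2_mass (K u) \<le> L2_mass u"
    and diff: "\<And>u v x. integrable lebesgue u \<Longrightarrow> integrable lebesgue v \<Longrightarrow> K u x - K v x = K (\<lambda>y. u y - v y) x"
  shows "L2_extension K f \<in> L2" "AE x in lebesgue. L2_extension K f x = K f x" "K f \<in> L2"
proof -
  let ?f = "\<lambda>n x. indicator (cball 0 (real n)) x * f x"
  note [measurable] = L2_measurable[OF f(1)]
  have [measurable]: "cball 0 r \<in> sets (lebesgue :: (real^'d) measure)" for r by simp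
  have fin: "L2_mass f < \<infinity>"
    using nn_integral_L2[OF f(1)] by simp
  have Kf: "K f \<in> L2"
    by (intro L2_I meas f le_less_trans[OF contr[OF f(2)] fin])
  then show "K f \<in> L2" .
  have intn: "integrable lebesgue (?f n)" for n
    by (rule Bochner_Integration.integrable_bound[OF f(2)]) (auto simp: norm_mult split: split_indicator)
  have lim: "(\<lambda>n. L2_dist_sq (K (?f n)) (K f)) \<longlonglongrightarrow> 0"
  proof (rule tendsto_sandwich[OF _ _ tendsto_const])
    have "(\<lambda>n. \<integral>\<^sup>+x. ennreal ((norm (?f n x - f x))\<^sup>2) \<partial>lebesgue) \<longlonglongrightarrow> (\<integral>\<^sup>+x. 0 \<partial>(lebesgue :: (real^'d) measure))"
    proof (rule nn_integral_dominated_convergence[where w="\<lambda>x. ennreal ((norm (f x))\<^sup>2)"])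
      show "L2_mass f < \<infinity>" by (rule fin)
      show "AE x in lebesgue. (\<lambda>n. ennreal ((norm (?f n x - f x))\<^sup>2)) \<longlonglongrightarrow> 0"
      proof (rule AE_I2)
        fix x :: "real^'d"
        obtain N :: nat where N: "norm x \<le> real N" using real_arch_simple by blast
        have "eventually (\<lambda>n. ennreal ((norm (?f n x - f x))\<^sup>2) = 0) sequentially"
          using N by (intro eventually_sequentiallyI[of N]) auto
        then show "(\<lambda>n. ennreal ((norm (?f n x - f x))\<^sup>2)) \<longlonglongrightarrow> 0"
          by (rule tendsto_eventually)
      qed
      show "AE x in lebesgue. ennreal ((norm (?f n x - f x))\<^sup>2) \<le> ennreal ((norm (f x))\<^sup>2)" for n
        by (intro AE_I2) (auto split: split_indicator)
    qed measurable
    then show "(\<lambda>n. \<integral>\<^sup>+x. ennreal ((norm (?f n x - f x))\<^sup>2) \<partial>lebesgue) \<longlonglongrightarrow> 0" by simp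
    show "eventually (\<lambda>n. L2_dist_sq (K (?f n)) (K f) \<le> (\<integral>\<^sup>+x. ennreal ((norm (?f n x - f x))\<^sup>2) \<partial>lebesgue)) sequentially"
      unfolding L2_dist_sq_def diff[OF intn f(2)]
      by (intro always_eventually allI contr Bochner_Integration.integrable_diff intn f)
  qed simp
  define g where "g = L2_extension K f"
  have "g \<in> L2 \<and> (\<lambda>n. L2_dist_sq (K (?f n)) g) \<longlonglongrightarrow> 0"
    unfolding g_def L2_extension_def
    by (rule someI[of "\<lambda>g. g \<in> L2 \<and> (\<lambda>n. L2_dist_sq (K (?f n)) g) \<longlonglongrightarrow> 0" "K f"])
       (use Kf lim in simp)
  then have g: "g \<in> L2" "(\<lambda>n. L2_dist_sq (K (?f n)) g) \<longlonglongrightarrow> 0" by auto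
  show "L2_extension K f \<in> L2" using g(1) unfolding g_def .
  have "(\<lambda>n. 2 * L2_dist_sq (K (?f n)) g + 2 * L2_dist_sq (K (?f n)) (K f)) \<longlonglongrightarrow> 2 * 0 + 2 * 0"
    by (intro tendsto_add ennreal_tendsto_cmult g lim) auto
  then have "L2_dist_sq g (K f) \<le> 2 * 0 + 2 * 0"
    by (rule LIMSEQ_le_const) (auto intro!: L2_dist_sq_triangle meas intn g Kf)
  then have "L2_dist_sq g (K f) = 0" by simp
  moreover note [measurable] = L2_measurable[OF g(1)] L2_measurable[OF Kf]
  ultimately have "AE x in lebesgue. ennreal ((norm (g x - K f x))\<^sup>2) = 0"
    unfolding L2_dist_sq_def by (subst (asm) nn_integral_0_iff_AE) auto
  then show "AE x in lebesgue. L2_extension K f x = K f x"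
    unfolding g_def by eventually_elim auto
qed

lemma integrable_plane_wave_mult:
  fixes u :: "(real^'d) \<Rightarrow> complex"
  assumes "integrable lebesgue u"
  shows "integrable lebesgue (\<lambda>x. u x * iexp (x \<bullet> \<xi>))"
proof (rule Bochner_Integration.integrable_bound[OF assms])
  have "(\<lambda>x. iexp (x \<bullet> \<xi>)) \<in> borel_measurable lebesgue"
    by (intro measurable_lebesgue_borel borel_measurable_continuous_onI continuous_intros)
  then show "(\<lambda>x. u x * iexp (x \<bullet> \<xi>)) \<in> borel_measurable lebesgue"
    using assms by (intro borel_measurable_times) auto
qed (simp add: norm_mult)

lemma fourier_integral_diff:
  fixes u v :: "(real^'d) \<Rightarrow> complex"
  assumes "integrable lebesgue u" "integrable lebesgue v"
  shows "fourier_integral u x - fourier_integral v x = fourier_integral (\<lambda>y. u y - v y) x"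
  unfolding fourier_integral_def
  by (simp add: left_diff_distrib integrable_plane_wave_mult assms right_diff_distrib)

lemma L2_fourier_eq:
  fixes f :: "(real^'d) \<Rightarrow> complex"
  assumes "f \<in> L2" "integrable lebesgue f"
  shows "L2_fourier f \<in> L2" "AE x in lebesgue. L2_fourier f x = fourier_integral f x" "fourier_integral f \<in> L2"
  unfolding L2_fourier_def
  by (rule L2_extension_eq[OF assms]; auto intro!: fourier_integral_measurable fourier_integral_contraction fourier_integral_diff)+

lemma L2_inverse_fourier_eq:
  fixes f :: "(real^'d) \<Rightarrow> complex"
  assumes "f \<in> L2" "integrable lebesgue f"
  shows "L2_inverse_fourier f \<in> L2" "AE x in lebesgue. L2_inverse_fourier f x = inverse_fourier_integral f x"
    "inverse_fourier_integral f \<in> L2"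
proof -
  have meas: "inverse_fourier_integral u \<in> borel_measurable lebesgue" if "integrable lebesgue u" for u :: "(real^'d) \<Rightarrow> complex"
    unfolding inverse_fourier_integral_eq[abs_def]
    using that by (intro borel_measurable_cnj fourier_integral_measurable) auto
  have contr: "L2_mass (inverse_fourier_integral u) \<le> L2_mass u"
    if "integrable lebesgue u" for u :: "(real^'d) \<Rightarrow> complex"
    using fourier_integral_contraction[of "\<lambda>y. cnj (u y)"] that by (simp add: inverse_fourier_integral_eq)
  have diff: "inverse_fourier_integral u x - inverse_fourier_integral v x = inverse_fourier_integral (\<lambda>y. u y - v y) x"
    if "integrable lebesgue u" "integrable lebesgue v" for u v x
    using fourier_integral_diff[of "\<lambda>y. cnj (u y)" "\<lambda>y. cnj (v y)" x] that
    by (simp add: inverse_fourier_integral_eq flip: complex_cnj_diff)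
  show "L2_inverse_fourier f \<in> L2" "AE x in lebesgue. L2_inverse_fourier f x = inverse_fourier_integral f x"
    "inverse_fourier_integral f \<in> L2"
    unfolding L2_inverse_fourier_def
    using L2_extension_eq[OF assms, of inverse_fourier_integral] meas contr diff by blast+
qed

section \<open>Translates and the perimeter\<close>

lemma measurable_lebesgue_translation: "(\<lambda>x. c + x) \<in> lebesgue \<rightarrow>\<^sub>M (lebesgue :: 'a::euclidean_space measure)"
  and lebesgue_translation: "distr lebesgue lebesgue (\<lambda>x. c + x) = (lebesgue :: 'a::euclidean_space measure)"
proof -
  have eq: "(\<lambda>x. c + (\<Sum>j\<in>Basis. (1 * (x \<bullet> j)) *\<^sub>R j)) = (\<lambda>x. c + x)"
    by (simp add: euclidean_representation)
  show "(\<lambda>x. c + x) \<in> lebesgue \<rightarrow>\<^sub>M (lebesgue :: 'a::euclidean_space measure)"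
    using lebesgue_affine_measurable[of "\<lambda>_. 1" c] unfolding eq by simp
  show "distr lebesgue lebesgue (\<lambda>x. c + x) = (lebesgue :: 'a::euclidean_space measure)"
    using lebesgue_affine_euclidean[of "\<lambda>_. 1" c] unfolding eq by (simp add: density_1)
qed

lemma integral_lebesgue_translation:
  fixes f :: "'a::euclidean_space \<Rightarrow> complex"
  assumes "f \<in> borel_measurable lebesgue"
  shows "(LINT x|lebesgue. f (c + x)) = (LINT x|lebesgue. f x)"
  using integral_distr[OF measurable_lebesgue_translation assms, of c] by (simp add: lebesgue_translation)

lemma AE_lebesgue_translation:
  fixes c :: "'a::euclidean_space"
  assumes "AE x in lebesgue. P x"
  shows "AE x in lebesgue. P (c + x)"
proof -
  obtain N where N: "negligible N" "{x. \<not> P x} \<subseteq> N"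
    using assms unfolding eventually_ae_filter_negligible by blast
  have "{x. \<not> P (c + x)} \<subseteq> (+) (- c) ` N"
  proof
    fix x assume "x \<in> {x. \<not> P (c + x)}"
    then have "c + x \<in> N" using N(2) by auto
    then show "x \<in> (+) (- c) ` N" by (intro image_eqI[of _ _ "c + x"]) auto
  qed
  then show ?thesis
    unfolding eventually_ae_filter_negligible using negligible_translation[OF N(1), of "- c"] by blast
qed

lemma translate_eq_vimage: "(\<lambda>x. x - h) ` U = {x. x + h \<in> (U :: 'a::euclidean_space set)}"
  by (auto intro: image_eqI[of _ _ "_ + h"])

lemma translate_sets: "U \<in> sets lebesgue \<Longrightarrow> {x. x + h \<in> (U :: 'a::euclidean_space set)} \<in> sets lebesgue"
  using measurable_sets[OF measurable_lebesgue_translation[of h], of U] by (simp add: vimage_def add.commute)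

text \<open>
  If $U$ has finite measure, the measure of \<open>exit_set U z\<close> is half the measure of the symmetric difference
  of $U$ and $U + z$ in the definition of the perimeter.
\<close>

definition exit_set :: "'a::euclidean_space set \<Rightarrow> 'a \<Rightarrow> 'a set" where
  "exit_set U z = {x\<in>U. x - z \<notin> U}"

lemma exit_set_sets: "U \<in> sets lebesgue \<Longrightarrow> exit_set U z \<in> sets lebesgue"
proof -
  assume U: "U \<in> sets lebesgue"
  have "exit_set U z = U - {x. x + (- z) \<in> U}" unfolding exit_set_def by auto
  also have "\<dots> \<in> sets lebesgue" by (rule sets.Diff[OF U translate_sets[OF U]])
  finally show ?thesis .
qed

lemma emeasure_sym_diff_le_perimeter:
  fixes U :: "(real^'d) set"
  shows "emeasure lebesgue (sym_diff U ((\<lambda>x. x - h) ` U)) \<le> perimeter \<gamma> U * ennreal (norm h powr \<gamma>)"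
proof (cases "h = 0")
  case False
  let ?m = "emeasure lebesgue (sym_diff U ((\<lambda>x. x - h) ` U))" and ?b = "ennreal (norm h powr \<gamma>)"
  have b: "?b \<noteq> 0" "?b < top" using False by auto
  have "?m = ?m / ?b * ?b" using b by (simp add: ennreal_divide_times)
  also have "\<dots> \<le> perimeter \<gamma> U * ?b"
    unfolding perimeter_def using False by (intro mult_right_mono SUP_upper) auto
  finally show ?thesis .
qed simp

lemma emeasure_exit_set_le_perimeter:
  fixes U :: "(real^'d) set"
  assumes U: "U \<in> sets lebesgue"
  shows "emeasure lebesgue (exit_set U z) \<le> perimeter \<gamma> U * ennreal (norm z powr \<gamma>)"
proof -
  have "sym_diff U ((\<lambda>x. x - (- z)) ` U) \<in> sets lebesgue"
    unfolding translate_eq_vimage by (intro sets.Un sets.Diff U translate_sets)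
  moreover have "exit_set U z \<subseteq> sym_diff U ((\<lambda>x. x - (- z)) ` U)"
    unfolding translate_eq_vimage exit_set_def by auto
  ultimately have "emeasure lebesgue (exit_set U z) \<le> emeasure lebesgue (sym_diff U ((\<lambda>x. x - (- z)) ` U))"
    by (intro emeasure_mono)
  also have "\<dots> \<le> perimeter \<gamma> U * ennreal (norm z powr \<gamma>)"
    using emeasure_sym_diff_le_perimeter[of U "- z" \<gamma>] by simp
  finally show ?thesis .
qed

lemma lebesgue_set_AE_borel:
  fixes U :: "'a::euclidean_space set"
  assumes "U \<in> sets lebesgue"
  obtains V where "V \<in> sets borel" "AE x in lebesgue. x \<in> U \<longleftrightarrow> x \<in> V"
proof -
  have "(indicator U :: 'a \<Rightarrow> real) \<in> borel_measurable lebesgue" using assms by simp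
  then obtain h where [measurable]: "h \<in> borel_measurable lborel" and ae: "AE x in lborel. (indicator U x :: real) = h x"
    using completion_ex_borel_measurable_real by blast
  have "{x. h x = 1} \<in> sets borel" by measurable
  moreover have "AE x in lebesgue. x \<in> U \<longleftrightarrow> x \<in> {x. h x = 1}"
    using AE_completion[OF ae] by eventually_elim (auto simp: indicator_def split: if_splits)
  ultimately show thesis using that by blast
qed

text \<open>
  Substituting $z = x - y$ and exchanging the integrals. The joint measurability that this requires
  holds after replacing $U$ by a Borel set that differs from it by a null set.
\<close>

lemma nn_integral_exit_set:
  fixes U :: "'a::euclidean_space set"
  assumes U: "U \<in> sets lebesgue" and w[measurable]: "w \<in> borel_measurable borel"
  shows "(\<integral>\<^sup>+x. (\<integral>\<^sup>+y. indicator U x * indicator (- U) y * w (x - y) \<partial>lebesgue) \<partial>lebesgue)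
       = (\<integral>\<^sup>+z. w z * emeasure lebesgue (exit_set U z) \<partial>lborel)"
    and "(\<lambda>z. emeasure lebesgue (exit_set U z)) \<in> borel_measurable borel"
proof -
  let ?f = "\<lambda>X x. \<integral>\<^sup>+y. indicator X x * indicator (- X) y * w (x - y) \<partial>lebesgue"
  obtain V where V[measurable]: "V \<in> sets borel" and ae: "AE x in lebesgue. x \<in> U \<longleftrightarrow> x \<in> V"
    using lebesgue_set_AE_borel[OF U] .
  have VL: "V \<in> sets lebesgue" using V by simp
  have exit: "emeasure lebesgue (exit_set U z) = (\<integral>\<^sup>+x. indicator V x * indicator (- V) (x - z) \<partial>lborel)" for z
  proof -
    have "emeasure lebesgue (exit_set U z) = emeasure lebesgue (exit_set V z)"
    proof (rule emeasure_eq_AE)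
      show "AE x in lebesgue. x \<in> exit_set U z \<longleftrightarrow> x \<in> exit_set V z"
        using ae AE_lebesgue_translation[OF ae, of "- z"]
        by eventually_elim (auto simp: exit_set_def)
    qed (auto intro: exit_set_sets U VL)
    also have "\<dots> = emeasure lborel (exit_set V z)"
      unfolding exit_set_def by (subst emeasure_completion) auto
    also have "\<dots> = (\<integral>\<^sup>+x. indicator (exit_set V z) x \<partial>lborel)"
      unfolding exit_set_def by simp
    also have "\<dots> = (\<integral>\<^sup>+x. indicator V x * indicator (- V) (x - z) \<partial>lborel)"
      by (intro nn_integral_cong) (auto simp: exit_set_def split: split_indicator)
    finally show ?thesis .
  qed
  show "(\<lambda>z. emeasure lebesgue (exit_set U z)) \<in> borel_measurable borel"
    unfolding exit by measurable
  have "(\<integral>\<^sup>+x. ?f U x \<partial>lebesgue)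
      = (\<integral>\<^sup>+x. ?f V x \<partial>lebesgue)"
  proof (rule nn_integral_cong_AE)
    show "AE x in lebesgue. ?f U x
       = ?f V x"
      using ae
    proof eventually_elim
      fix x assume "x \<in> U \<longleftrightarrow> x \<in> V"
      then show "?f U x
         = ?f V x"
        by (intro nn_integral_cong_AE eventually_mono[OF ae]) (auto split: split_indicator)
    qed
  qed
  also have "\<dots> = (\<integral>\<^sup>+x. (\<integral>\<^sup>+y. indicator V x * indicator (- V) y * w (x - y) \<partial>lborel) \<partial>lborel)"
    by (simp add: nn_integral_completion)
  also have "\<dots> = (\<integral>\<^sup>+x. (\<integral>\<^sup>+z. indicator V x * indicator (- V) (x - z) * w z \<partial>lborel) \<partial>lborel)"
  proof (rule nn_integral_cong)
    fix x :: 'a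
    show "(\<integral>\<^sup>+y. indicator V x * indicator (- V) y * w (x - y) \<partial>lborel) = (\<integral>\<^sup>+z. indicator V x * indicator (- V) (x - z) * w z \<partial>lborel)"
      by (subst nn_integral_lborel_reflect[of "\<lambda>y. indicator V x * indicator (- V) y * w (x - y)" x, symmetric]) auto
  qed
  also have "\<dots> = (\<integral>\<^sup>+z. (\<integral>\<^sup>+x. indicator V x * indicator (- V) (x - z) * w z \<partial>lborel) \<partial>lborel)"
    by (intro lborel_pair.Fubini') measurable
  also have "\<dots> = (\<integral>\<^sup>+z. w z * emeasure lebesgue (exit_set U z) \<partial>lborel)"
    unfolding exit
  proof (rule nn_integral_cong)
    fix z :: 'a
    show "(\<integral>\<^sup>+x. indicator V x * indicator (- V) (x - z) * w z \<partial>lborel) = w z * (\<integral>\<^sup>+x. indicator V x * indicator (- V) (x - z) \<partial>lborel)"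
      by (subst nn_integral_multc) (simp_all add: mult.commute)
  qed
  finally show "(\<integral>\<^sup>+x. ?f U x \<partial>lebesgue)
       = (\<integral>\<^sup>+z. w z * emeasure lebesgue (exit_set U z) \<partial>lborel)" .
qed

text \<open>
  If all translates of $U$ agreed with $U$ up to null sets, the identity above with weight 1 would give
  $|U|\,|U^c| = 0$, although $U^c$ has infinite measure.
\<close>

lemma perimeter_pos:
  fixes U :: "(real^'d) set"
  assumes U: "U \<in> sets lebesgue" "0 < emeasure lebesgue U" "emeasure lebesgue U < \<infinity>"
  shows "0 < perimeter \<gamma> U"
proof (rule ccontr)
  assume "\<not> 0 < perimeter \<gamma> U"
  then have "emeasure lebesgue (exit_set U z) = 0" for z
    using emeasure_exit_set_le_perimeter[OF U(1), of z \<gamma>] by (simp add: not_gr_zero)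
  then have "(\<integral>\<^sup>+x. (\<integral>\<^sup>+y. indicator U x * indicator (- U) y * 1 \<partial>lebesgue) \<partial>lebesgue) = 0"
    using nn_integral_exit_set(1)[OF U(1), of "\<lambda>_. 1"] by simp
  then have "emeasure lebesgue U * emeasure lebesgue (- U) = 0"
    using U by (simp add: nn_integral_cmult nn_integral_multc sets.compl_sets[of U lebesgue, simplified] Compl_eq_Diff_UNIV del: emeasure_completion)
  then have "emeasure lebesgue (- U) = 0" using U(2) by auto
  moreover have "emeasure lebesgue (UNIV :: (real^'d) set) \<le> emeasure lebesgue U + emeasure lebesgue (- U)"
    using emeasure_subadditive[of U lebesgue "- U"] U(1) sets.compl_sets[OF U(1)]
    by (simp add: Compl_eq_Diff_UNIV del: emeasure_completion)
  ultimately show False using U(3) by (simp add: emeasure_lborel_UNIV)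
qed

section \<open>The Fourier transform of an indicator function\<close>

lemma indicator_integrable:
  assumes "U \<in> sets lebesgue" "emeasure lebesgue U < \<infinity>"
  shows "integrable lebesgue (indicator U :: 'a::euclidean_space \<Rightarrow> complex)"
proof -
  have "(\<lambda>x. complex_of_real (indicator U x)) = indicator U"
    by (auto split: split_indicator)
  then show ?thesis
    using integrable_of_real[OF integrable_real_indicator[OF assms], where 'a=complex] by simp
qed

lemma nn_integral_indicator_sq:
  assumes "U \<in> sets lebesgue"
  shows "(\<integral>\<^sup>+x. ennreal ((norm (indicator U x :: complex))\<^sup>2) \<partial>lebesgue) = emeasure lebesgue (U :: 'a::euclidean_space set)"
proof -
  have "(\<integral>\<^sup>+x. ennreal ((norm (indicator U x :: complex))\<^sup>2) \<partial>lebesgue) = (\<integral>\<^sup>+x. indicator U x \<partial>lebesgue)"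
    by (intro nn_integral_cong) (auto split: split_indicator)
  then show ?thesis using assms by (simp del: emeasure_completion)
qed

text \<open>
  The Fourier integral of the indicator of $U - h$ is that of the indicator of $U$, times a phase.
  Apply the contraction property to the difference of the two indicators, whose square is the indicator of the
  symmetric difference.
\<close>

lemma fourier_integral_indicator_translation:
  fixes U :: "(real^'d) set"
  assumes U: "U \<in> sets lebesgue" "emeasure lebesgue U < \<infinity>"
  shows "(\<integral>\<^sup>+\<xi>. ennreal ((norm (iexp (h \<bullet> \<xi>) - 1))\<^sup>2 * (norm (fourier_integral (indicator U) \<xi>))\<^sup>2) \<partial>lebesgue)
    \<le> emeasure lebesgue (sym_diff U ((\<lambda>x. x - h) ` U))"
proof -
  let ?V = "{x. x + h \<in> U}"
  have V: "?V \<in> sets lebesgue" by (rule translate_sets[OF U(1)])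
  have Vfin: "emeasure lebesgue ?V < \<infinity>"
  proof -
    have "emeasure lebesgue ?V = emeasure (distr lebesgue lebesgue (\<lambda>x. h + x)) U"
      using U(1) by (subst emeasure_distr[OF measurable_lebesgue_translation]) (auto simp: vimage_def add.commute simp del: emeasure_completion)
    then show ?thesis using U(2) by (simp add: lebesgue_translation del: emeasure_completion)
  qed
  let ?u = "\<lambda>x. indicator ?V x - indicator U x :: complex"
  have int: "integrable lebesgue (indicator U :: _ \<Rightarrow> complex)" "integrable lebesgue (indicator ?V :: _ \<Rightarrow> complex)"
    by (intro indicator_integrable U V Vfin)+
  have shift: "fourier_integral (indicator U) \<xi> = iexp (h \<bullet> \<xi>) * fourier_integral (indicator ?V) \<xi>" for \<xi>
  proof -
    have "(LINT x|lebesgue. indicator U x * iexp (x \<bullet> \<xi>))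
        = (LINT x|lebesgue. indicator U (h + x) * iexp ((h + x) \<bullet> \<xi>))"
      using integrable_plane_wave_mult[OF int(1)] by (subst integral_lebesgue_translation) auto
    also have "\<dots> = (LINT x|lebesgue. iexp (h \<bullet> \<xi>) * (indicator ?V x * iexp (x \<bullet> \<xi>)))"
      by (intro Bochner_Integration.integral_cong refl)
         (auto simp: inner_add_left distrib_left exp_add add.commute split: split_indicator)
    also have "\<dots> = iexp (h \<bullet> \<xi>) * (LINT x|lebesgue. indicator ?V x * iexp (x \<bullet> \<xi>))"
      by (rule integral_mult_right_zero)
    finally show ?thesis unfolding fourier_integral_def by (simp only: mult.left_commute)
  qed
  have "(norm (iexp (h \<bullet> \<xi>) - 1))\<^sup>2 * (norm (fourier_integral (indicator U) \<xi>))\<^sup>2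
      = (norm (fourier_integral ?u \<xi>))\<^sup>2" for \<xi>
  proof -
    have "fourier_integral ?u \<xi> = (1 - iexp (h \<bullet> \<xi>)) * fourier_integral (indicator ?V) \<xi>"
      by (simp add: fourier_integral_diff[OF int(2,1), symmetric] shift algebra_simps)
    then show ?thesis
      by (simp add: shift norm_mult power_mult_distrib norm_minus_commute)
  qed
  then have "(\<integral>\<^sup>+\<xi>. ennreal ((norm (iexp (h \<bullet> \<xi>) - 1))\<^sup>2 * (norm (fourier_integral (indicator U) \<xi>))\<^sup>2) \<partial>lebesgue)
     = L2_mass (fourier_integral ?u)" by simp
  also have "\<dots> \<le> L2_mass ?u"
    by (intro fourier_integral_contraction Bochner_Integration.integrable_diff int)
  also have "\<dots> = (\<integral>\<^sup>+x. indicator (sym_diff U ?V) x \<partial>lebesgue)"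
    by (intro nn_integral_cong) (auto split: split_indicator)
  also have "\<dots> = emeasure lebesgue (sym_diff U ?V)"
    by (intro nn_integral_indicator sets.Un sets.Diff U V)
  finally show ?thesis unfolding translate_eq_vimage .
qed

lemma heat_kernel_tail:
  fixes z :: "real^'d"
  assumes t: "0 < t" and z: "\<delta> \<le> norm z" and \<delta>: "0 < \<delta>"
  shows "heat_kernel t z \<le> 2 powr (real CARD('d) / 2) * exp (- (\<delta>\<^sup>2 / (4 * t))) * heat_kernel (2 * t) z"
proof -
  have "exp (- (norm z)\<^sup>2 / (2 * t)) = exp (- ((norm z)\<^sup>2 / (4 * t))) * exp (- (norm z)\<^sup>2 / (2 * (2 * t)))"
    by (simp flip: exp_add)
  also have "\<dots> \<le> exp (- (\<delta>\<^sup>2 / (4 * t))) * exp (- (norm z)\<^sup>2 / (2 * (2 * t)))"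
    using t z \<delta> by (intro mult_right_mono) (auto intro!: divide_right_mono power_mono)
  finally have *: "exp (- (norm z)\<^sup>2 / (2 * t)) \<le> exp (- (\<delta>\<^sup>2 / (4 * t))) * exp (- (norm z)\<^sup>2 / (2 * (2 * t)))" .
  have "2 * pi * (2 * t) = 2 * (2 * pi * t)" by simp
  then have "(2 * pi * (2 * t)) powr (- real CARD('d) / 2) = 2 powr (- real CARD('d) / 2) * (2 * pi * t) powr (- real CARD('d) / 2)"
    using t by (simp only: powr_mult)
  then have **: "(2 * pi * t) powr (- real CARD('d) / 2) = 2 powr (real CARD('d) / 2) * (2 * pi * (2 * t)) powr (- real CARD('d) / 2)"
    by (simp flip: mult.assoc powr_add)
  have "heat_kernel t z \<le> (2 * pi * t) powr (- real CARD('d) / 2) * (exp (- (\<delta>\<^sup>2 / (4 * t))) * exp (- (norm z)\<^sup>2 / (2 * (2 * t))))"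
    unfolding heat_kernel_def using * by (intro mult_left_mono) auto
  also have "\<dots> = 2 powr (real CARD('d) / 2) * exp (- (\<delta>\<^sup>2 / (4 * t))) * heat_kernel (2 * t) z"
    unfolding heat_kernel_def ** by (simp only: mult_ac)
  finally show ?thesis .
qed

abbreviation heat_escape :: "real \<Rightarrow> (real^'d) set \<Rightarrow> ennreal" where
  "heat_escape t U \<equiv> \<integral>\<^sup>+x. (\<integral>\<^sup>+y. indicator U x * indicator (- U) y * ennreal (heat_kernel t (x - y)) \<partial>lebesgue) \<partial>lebesgue"

text \<open>
  As a double integral, \<open>heat_escape t U\<close> is the average of $|U \setminus (U+z)|$ against the heat kernel.
  The perimeter bounds the contribution of $|z| < \delta$, and the rest is an exponentially small tail.
\<close>

lemma heat_escape_le: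
  fixes U :: "(real^'d) set"
  assumes U: "U \<in> sets lebesgue" "emeasure lebesgue U < \<infinity>" and P: "perimeter \<eta> U < \<infinity>" and \<eta>: "0 < \<eta>"
    and t: "0 < t" and \<delta>: "0 < \<delta>"
  shows "heat_escape t U \<le> ennreal (enn2real (perimeter \<eta> U) * \<delta> powr \<eta>)
     + ennreal (measure lebesgue U * 2 powr (real CARD('d) / 2) * exp (- (\<delta>\<^sup>2 / (4 * t))))"
proof -
  define m where "m = measure lebesgue U"
  define p where "p = enn2real (perimeter \<eta> U)"
  have m: "emeasure lebesgue U = ennreal m"
    unfolding m_def using U(2) by (simp add: emeasure_eq_ennreal_measure less_top)
  have p: "perimeter \<eta> U = ennreal p" unfolding p_def using P by (simp add: less_top)
  have m0: "0 \<le> m" and p0: "0 \<le> p" unfolding m_def p_def by auto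
  have exit_meas [measurable]: "(\<lambda>z. emeasure lebesgue (exit_set U z)) \<in> borel_measurable borel"
    by (rule nn_integral_exit_set(2)[OF U(1), of "\<lambda>_. 0"]) simp
  define c where "c = m * 2 powr (real CARD('d) / 2)"
  have "heat_escape t U = (\<integral>\<^sup>+z. ennreal (heat_kernel t z) * emeasure lebesgue (exit_set U z) \<partial>lborel)"
    using nn_integral_exit_set(1)[OF U(1), of "\<lambda>z. ennreal (heat_kernel t z)"] by simp
  also have "\<dots> \<le> (\<integral>\<^sup>+z. ennreal (p * \<delta> powr \<eta>) * ennreal (heat_kernel t z)
      + ennreal (c * exp (- (\<delta>\<^sup>2 / (4 * t)))) * ennreal (heat_kernel (2 * t) (z :: real^'d)) \<partial>lborel)"
  proof (rule nn_integral_mono)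
    fix z :: "real^'d"
    show "ennreal (heat_kernel t z) * emeasure lebesgue (exit_set U z)
       \<le> ennreal (p * \<delta> powr \<eta>) * ennreal (heat_kernel t z) + ennreal (c * exp (- (\<delta>\<^sup>2 / (4 * t)))) * ennreal (heat_kernel (2 * t) z)"
    proof (cases "norm z < \<delta>")
      case True
      have "emeasure lebesgue (exit_set U z) \<le> ennreal p * ennreal (norm z powr \<eta>)"
        using emeasure_exit_set_le_perimeter[OF U(1), of z \<eta>] unfolding p .
      also have "\<dots> \<le> ennreal (p * \<delta> powr \<eta>)"
        using True \<eta> p0 by (subst ennreal_mult[symmetric]) (auto intro!: ennreal_leI mult_left_mono powr_mono2)
      finally show ?thesis
        by (subst mult.commute) (intro add_increasing2 mult_right_mono; simp)
    next
      case False
      then have h: "heat_kernel t z \<le> 2 powr (real CARD('d) / 2) * exp (- (\<delta>\<^sup>2 / (4 * t))) * heat_kernel (2 * t) z"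
        by (intro heat_kernel_tail t \<delta>) simp
      have "emeasure lebesgue (exit_set U z) \<le> ennreal m"
        unfolding m[symmetric] by (intro emeasure_mono U) (auto simp: exit_set_def)
      then have "ennreal (heat_kernel t z) * emeasure lebesgue (exit_set U z)
          \<le> ennreal (2 powr (real CARD('d) / 2) * exp (- (\<delta>\<^sup>2 / (4 * t))) * heat_kernel (2 * t) z) * ennreal m"
        by (intro mult_mono ennreal_leI h) auto
      also have "\<dots> = ennreal (c * exp (- (\<delta>\<^sup>2 / (4 * t)))) * ennreal (heat_kernel (2 * t) z)"
        unfolding c_def using m0 heat_kernel_nonneg[of "2 * t" z] by (simp add: mult_ac flip: ennreal_mult)
      finally show ?thesis by (intro add_increasing) auto
    qed
  qed
  also have "\<dots> = ennreal (p * \<delta> powr \<eta>) + ennreal (c * exp (- (\<delta>\<^sup>2 / (4 * t))))"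
    using t by (simp add: nn_integral_add nn_integral_cmult nn_integral_heat_kernel(1))
  finally show ?thesis unfolding c_def p_def m_def .
qed

text \<open>
  The heat kernel mass around each $x \in U$ splits into the parts inside and outside $U$. Integrated over
  $x \in U$, the inside part is the Gaussian energy of the Fourier integral, which is at most the full energy.
\<close>

lemma emeasure_le_fourier_plus_heat_escape:
  fixes U :: "(real^'d) set"
  assumes U: "U \<in> sets lebesgue" "emeasure lebesgue U < \<infinity>" and t: "0 < t"
  shows "emeasure lebesgue U \<le> L2_mass (fourier_integral (indicator U)) + heat_escape t U"
proof -
  let ?F = "fourier_integral (indicator U)"
  have [measurable]: "U \<in> sets lebesgue" by fact
  let ?i = "indicator U :: (real^'d) \<Rightarrow> real"
  define q where "q x = (LINT y|lebesgue. ?i y * heat_kernel t (x - y))" for x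
  have heat_left [measurable]: "(\<lambda>y. heat_kernel t (x - y)) \<in> borel_measurable lebesgue" for x :: "real^'d"
    by (intro measurable_lebesgue_borel) measurable
  have iheat: "integrable lebesgue (\<lambda>y. ?i y * heat_kernel t (x - y))" for x
  proof (rule Bochner_Integration.integrable_bound)
    show "integrable lebesgue (\<lambda>y. heat_kernel t (x - y))"
      using nn_integral_heat_kernel(2)[OF t, of x] heat_left
      by (intro integrableI_nonneg AE_I2 heat_kernel_nonneg) auto
  qed (auto intro!: AE_I2 split: split_indicator)
  have q: "ennreal (q x) = (\<integral>\<^sup>+y. indicator U y * ennreal (heat_kernel t (x - y)) \<partial>lebesgue)" for x
    unfolding q_def
    by (subst nn_integral_eq_integral[OF iheat, symmetric])
       (auto intro!: AE_I2 nn_integral_cong simp: heat_kernel_nonneg split: split_indicator)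
  have q0: "0 \<le> q x" for x unfolding q_def by (intro integral_nonneg_AE AE_I2) (auto simp: heat_kernel_nonneg)
  have q1: "q x \<le> 1" for x
  proof -
    have "ennreal (q x) \<le> (\<integral>\<^sup>+y. ennreal (heat_kernel t (x - y)) \<partial>lebesgue)"
      unfolding q by (intro nn_integral_mono) (auto split: split_indicator)
    then show ?thesis using nn_integral_heat_kernel(2)[OF t, of x] by simp
  qed
  have hm: "(\<lambda>(x, y). ?i y * heat_kernel t (x - y)) \<in> borel_measurable (lebesgue \<Otimes>\<^sub>M lebesgue)"
    unfolding split_def
    by (intro borel_measurable_times measurable_compose[OF measurable_snd] heat_kernel_diff_measurable t) simp
  have [measurable]: "q \<in> borel_measurable lebesgue"
    unfolding q_def by (rule lebesgue.borel_measurable_lebesgue_integral[OF hm])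
  have iq: "integrable lebesgue (\<lambda>x. ?i x * q x)"
  proof (rule Bochner_Integration.integrable_bound)
    show "integrable lebesgue ?i" using U by (intro integrable_real_indicator) auto
  qed (use q0 q1 in \<open>auto intro!: AE_I2 split: split_indicator\<close>)
  have int: "integrable lebesgue (\<lambda>\<xi>. gaussian t \<xi> * (norm (?F \<xi>))\<^sup>2)"
    using fourier_energy_heat_kernel(1)[OF indicator_integrable[OF U] t] by (simp only: complex_of_real_integrable_eq)
  have "complex_of_real (LINT \<xi>|lebesgue. gaussian t \<xi> * (norm (?F \<xi>))\<^sup>2)
     = (LINT x|lebesgue. indicator U x * (LINT y|lebesgue. cnj (indicator U y) * complex_of_real (heat_kernel t (x - y))))"
    using fourier_energy_heat_kernel(2)[OF indicator_integrable[OF U] t] by (simp only: integral_complex_of_real)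
  also have "\<dots> = (LINT x|lebesgue. complex_of_real (?i x * q x))"
  proof (intro Bochner_Integration.integral_cong refl)
    fix x
    have "(LINT y|lebesgue. cnj (indicator U y) * complex_of_real (heat_kernel t (x - y))) = (LINT y|lebesgue. complex_of_real (?i y * heat_kernel t (x - y)))"
      by (intro Bochner_Integration.integral_cong refl) (auto split: split_indicator)
    then show "indicator U x * (LINT y|lebesgue. cnj (indicator U y) * complex_of_real (heat_kernel t (x - y))) = complex_of_real (?i x * q x)"
      unfolding q_def by (simp only: integral_complex_of_real) (simp split: split_indicator)
  qed
  finally have energy: "(LINT \<xi>|lebesgue. gaussian t \<xi> * (norm (?F \<xi>))\<^sup>2) = (LINT x|lebesgue. ?i x * q x)"
    by (simp only: integral_complex_of_real of_real_eq_iff)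
  have part: "(\<integral>\<^sup>+x. indicator U x * ennreal (q x) \<partial>lebesgue) \<le> L2_mass ?F"
  proof -
    have "(\<integral>\<^sup>+x. indicator U x * ennreal (q x) \<partial>lebesgue) = (\<integral>\<^sup>+x. ennreal (?i x * q x) \<partial>lebesgue)"
      by (intro nn_integral_cong) (auto split: split_indicator)
    also have "\<dots> = (\<integral>\<^sup>+\<xi>. ennreal (gaussian t \<xi> * (norm (?F \<xi>))\<^sup>2) \<partial>lebesgue)"
      using q0 by (subst nn_integral_eq_integral[OF iq], simp, subst nn_integral_eq_integral[OF int], simp) (simp only: energy)
    also have "\<dots> \<le> L2_mass ?F"
      using t by (intro nn_integral_mono ennreal_leI mult_left_le_one_le) auto
    finally show ?thesis .
  qed
  have "emeasure lebesgue U = (\<integral>\<^sup>+x. indicator U x \<partial>lebesgue)" by simp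
  also have "\<dots> = (\<integral>\<^sup>+x. indicator U x * ennreal (q x) + (\<integral>\<^sup>+y. indicator U x * indicator (- U) y * ennreal (heat_kernel t (x - y)) \<partial>lebesgue) \<partial>lebesgue)"
  proof (rule nn_integral_cong)
    fix x :: "real^'d"
    have "1 = (\<integral>\<^sup>+y. indicator U y * ennreal (heat_kernel t (x - y)) + indicator (- U) y * ennreal (heat_kernel t (x - y)) \<partial>lebesgue)"
      unfolding nn_integral_heat_kernel(2)[OF t, of x, symmetric] by (intro nn_integral_cong) (auto split: split_indicator)
    also have "\<dots> = ennreal (q x) + (\<integral>\<^sup>+y. indicator (- U) y * ennreal (heat_kernel t (x - y)) \<partial>lebesgue)"
      unfolding q by (rule nn_integral_add) (auto simp: Compl_eq_Diff_UNIV intro!: borel_measurable_times_ennreal borel_measurable_indicator sets.compl_sets[of U lebesgue, simplified])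
    finally show "indicator U x = indicator U x * ennreal (q x) + (\<integral>\<^sup>+y. indicator U x * indicator (- U) y * ennreal (heat_kernel t (x - y)) \<partial>lebesgue)"
      by (cases "x \<in> U") auto
  qed
  also have "\<dots> = (\<integral>\<^sup>+x. indicator U x * ennreal (q x) \<partial>lebesgue) + heat_escape t U"
  proof (rule nn_integral_add)
    have "(\<lambda>p. indicator U (fst p) * indicator (- U) (snd p) * ennreal (heat_kernel t (fst p - snd p))) \<in> borel_measurable (lebesgue \<Otimes>\<^sub>M lebesgue)"
      by (intro borel_measurable_times_ennreal measurable_compose[OF measurable_fst borel_measurable_indicator]
        measurable_compose[OF measurable_snd borel_measurable_indicator] measurable_compose[OF heat_kernel_diff_measurable[OF t] measurable_ennreal])
        (use U sets.compl_sets[OF U(1)] in \<open>auto simp: Compl_eq_Diff_UNIV\<close>)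
    from lebesgue.borel_measurable_nn_integral_fst[OF this]
    show "(\<lambda>x. \<integral>\<^sup>+y. indicator U x * indicator (- U) y * ennreal (heat_kernel t (x - y)) \<partial>lebesgue) \<in> borel_measurable lebesgue"
      by simp
  qed measurable
  also have "\<dots> \<le> L2_mass ?F + heat_escape t U"
    by (rule add_right_mono[OF part])
  finally show ?thesis .
qed

text \<open>
  Letting first $t \to 0$ and then $\delta \to 0$ in the two preceding bounds removes the escaping heat.
\<close>

lemma emeasure_le_fourier_indicator:
  fixes U :: "(real^'d) set"
  assumes U: "U \<in> sets lebesgue" "emeasure lebesgue U < \<infinity>" and P: "perimeter \<eta> U < \<infinity>" and \<eta>: "0 < \<eta>"
  shows "emeasure lebesgue U \<le> L2_mass (fourier_integral (indicator U))"
proof -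
  let ?R = "L2_mass (fourier_integral (indicator U))"
  define p where "p = enn2real (perimeter \<eta> U)"
  define c where "c = measure lebesgue U * 2 powr (real CARD('d) / 2)"
  have E: "emeasure lebesgue U \<le> ?R + (ennreal (p * \<delta> powr \<eta>) + ennreal (c * exp (- (\<delta>\<^sup>2 / (4 * t)))))"
    if "0 < t" "0 < \<delta>" for t \<delta>
    unfolding p_def c_def
    using emeasure_le_fourier_plus_heat_escape[OF U that(1)] add_left_mono[OF heat_escape_le[OF U P \<eta> that]]
    by (rule order_trans)
  \<comment> \<open>The limit $t \to 0$, along $t = 1/(n+1)$.\<close>
  have E': "emeasure lebesgue U \<le> ?R + ennreal (p * \<delta> powr \<eta>)" if \<delta>: "0 < \<delta>" for \<delta>
  proof (rule LIMSEQ_le_const)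
    have "(\<lambda>n. c * exp (- (\<delta>\<^sup>2 / (4 * (1 / real (Suc n)))))) \<longlonglongrightarrow> 0"
    proof -
      have "filterlim (\<lambda>n. \<delta>\<^sup>2 / 4 * real (Suc n)) at_top sequentially"
        using \<delta> by (intro filterlim_tendsto_pos_mult_at_top[OF tendsto_const] filterlim_compose[OF filterlim_real_sequentially filterlim_Suc]) auto
      then have "(\<lambda>n. c * exp (- (\<delta>\<^sup>2 / 4 * real (Suc n)))) \<longlonglongrightarrow> c * 0"
        by (intro tendsto_mult tendsto_const filterlim_compose[OF exp_at_bot] filterlim_compose[OF filterlim_uminus_at_bot_at_top])
      then show ?thesis by (simp add: field_simps)
    qed
    then have "(\<lambda>n. ?R + (ennreal (p * \<delta> powr \<eta>) + ennreal (c * exp (- (\<delta>\<^sup>2 / (4 * (1 / real (Suc n)))))))) \<longlonglongrightarrow> ?R + (ennreal (p * \<delta> powr \<eta>) + ennreal 0)"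
      by (intro tendsto_add tendsto_const tendsto_ennrealI)
    then show "(\<lambda>n. ?R + (ennreal (p * \<delta> powr \<eta>) + ennreal (c * exp (- (\<delta>\<^sup>2 / (4 * (1 / real (Suc n)))))))) \<longlonglongrightarrow> ?R + ennreal (p * \<delta> powr \<eta>)"
      by simp
    show "\<exists>N. \<forall>n\<ge>N. emeasure lebesgue U \<le> ?R + (ennreal (p * \<delta> powr \<eta>) + ennreal (c * exp (- (\<delta>\<^sup>2 / (4 * (1 / real (Suc n)))))))"
      by (intro exI[of _ 0] allI impI E \<delta>) simp
  qed
  show ?thesis
  proof (rule LIMSEQ_le_const)
    have "(\<lambda>n. ?R + ennreal (p * (1 / real (Suc n)) powr \<eta>)) \<longlonglongrightarrow> ?R + ennreal (p * 0)"
      using \<eta> by (intro tendsto_add tendsto_const tendsto_ennrealI tendsto_mult tendsto_zero_powrI[OF LIMSEQ_Suc[OF lim_1_over_n]]) auto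
    then show "(\<lambda>n. ?R + ennreal (p * (1 / real (Suc n)) powr \<eta>)) \<longlonglongrightarrow> ?R" by simp
    show "\<exists>N. \<forall>n\<ge>N. emeasure lebesgue U \<le> ?R + ennreal (p * (1 / real (Suc n)) powr \<eta>)"
      by (intro exI[of _ 0] allI impI E') simp
  qed
qed

section \<open>The limiting operator as an integral operator\<close>

text \<open>
  The convolution kernel of $B_S$.
\<close>

definition band_kernel :: "(real^'d) set \<Rightarrow> real^'d \<Rightarrow> complex" where
  "band_kernel S z = complex_of_real ((2 * pi) powr (- real CARD('d) / 2)) * inverse_fourier_integral (indicator S) z"

lemma norm_band_kernel_sq:
  fixes S :: "(real^'d) set"
  shows "(norm (band_kernel S z))\<^sup>2 = (2 * pi) powr (- real CARD('d)) * (norm (fourier_integral (indicator S) z))\<^sup>2"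
proof -
  have cnj: "(\<lambda>y. cnj (indicator S y)) = (indicator S :: _ \<Rightarrow> complex)"
    by (auto split: split_indicator)
  have "((2 * pi) powr (- real CARD('d) / 2))\<^sup>2 = (2 * pi) powr (- real CARD('d))"
    by (simp add: power2_eq_square flip: powr_add)
  then show ?thesis
    unfolding band_kernel_def inverse_fourier_integral_eq cnj by (simp add: norm_mult power_mult_distrib)
qed

lemma norm_band_kernel_le:
  fixes S :: "(real^'d) set"
  shows "\<exists>B. \<forall>z. norm (band_kernel S z) \<le> B"
proof -
  have cnj: "(\<lambda>y. cnj (indicator S y)) = (indicator S :: _ \<Rightarrow> complex)"
    by (auto split: split_indicator)
  show ?thesis
    unfolding band_kernel_def inverse_fourier_integral_eq cnj norm_mult complex_mod_cnj
    by (rule exI, rule allI, rule mult_left_mono[OF norm_fourier_integral_le norm_ge_zero])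
qed

lemma band_kernel_measurable:
  fixes S :: "(real^'d) set"
  assumes "S \<in> sets lebesgue"
  shows "band_kernel S \<in> borel_measurable borel"
  unfolding band_kernel_def[abs_def] inverse_fourier_integral_eq
  using assms by (intro borel_measurable_times borel_measurable_const borel_measurable_cnj fourier_integral_measurable_borel) auto

lemma band_kernel_diff_measurable:
  fixes S :: "(real^'d) set"
  assumes "S \<in> sets lebesgue"
  shows "(\<lambda>p. band_kernel S (fst p - snd p)) \<in> borel_measurable (lebesgue \<Otimes>\<^sub>M lebesgue)"
  by (rule measurable_compose[OF _ band_kernel_measurable[OF assms]])
     (intro continuous_imp_measurable_lebesgue_pair continuous_intros)

lemma space_proj_L2:
  assumes "U \<in> sets lebesgue" "f \<in> L2"
  shows "space_proj U f \<in> L2"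
proof -
  have [measurable]: "f \<in> borel_measurable lebesgue" "U \<in> sets lebesgue" using assms by (auto dest: L2_measurable)
  have "integrable lebesgue (\<lambda>x. (norm (space_proj U f x))\<^sup>2)"
    by (rule Bochner_Integration.integrable_bound[OF L2_integrable_square[OF assms(2)]])
       (auto simp: space_proj_def intro!: AE_I2 split: split_indicator)
  then show ?thesis unfolding L2_def by (auto simp: space_proj_def)
qed

text \<open>
  Since $|f| \le 1 + |f|^2$, restriction to a set of finite measure makes square-integrable functions
  integrable.
\<close>

lemma space_proj_integrable:
  assumes U: "U \<in> sets lebesgue" "emeasure lebesgue U < \<infinity>" and f: "f \<in> L2"
  shows "integrable lebesgue (space_proj U f)"
proof (rule Bochner_Integration.integrable_bound)
  show "integrable lebesgue (\<lambda>x. indicator U x + (norm (f x))\<^sup>2 :: real)"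
    using integrable_real_indicator[OF U] L2_integrable_square[OF f] by simp
  show "space_proj U f \<in> borel_measurable lebesgue"
    using space_proj_L2[OF U(1) f] by (rule L2_measurable)
  show "AE x in lebesgue. norm (space_proj U f x) \<le> norm (indicator U x + (norm (f x))\<^sup>2 :: real)"
  proof (rule AE_I2)
    fix x
    have "0 \<le> (norm (f x) - 1)\<^sup>2" by simp
    then have "2 * norm (f x) \<le> 1 + (norm (f x))\<^sup>2" by (simp add: power2_diff)
    then have "norm (f x) \<le> 1 + (norm (f x))\<^sup>2" using norm_ge_zero[of "f x"] by linarith
    then show "norm (space_proj U f x) \<le> norm (indicator U x + (norm (f x))\<^sup>2 :: real)"
      by (auto simp: space_proj_def split: split_indicator)
  qed
qed

lemma inverse_fourier_integral_cong_AE: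
  fixes u v :: "(real^'d) \<Rightarrow> complex"
  assumes "integrable lebesgue u" "integrable lebesgue v" "AE x in lebesgue. u x = v x"
  shows "inverse_fourier_integral u = inverse_fourier_integral v"
proof -
  have "fourier_integral (\<lambda>y. cnj (u y)) x = fourier_integral (\<lambda>y. cnj (v y)) x" for x
    unfolding fourier_integral_def
    using assms(3) integrable_plane_wave_mult[of "\<lambda>y. cnj (u y)" x] integrable_plane_wave_mult[of "\<lambda>y. cnj (v y)" x] assms(1,2)
    by (intro arg_cong2[where f="(*)"] refl Bochner_Integration.integral_cong_AE)
       (auto elim!: eventually_mono)
  then show ?thesis by (intro ext) (simp add: inverse_fourier_integral_eq)
qed

lemma inverse_fourier_integral_plane_wave:
  "inverse_fourier_integral g x = complex_of_real ((2 * pi) powr (- real CARD('d) / 2)) *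
     (LINT \<xi>|lebesgue. g \<xi> * cnj (plane_wave (\<xi>, x)))"
  for g :: "(real^'d) \<Rightarrow> complex"
  unfolding inverse_fourier_integral_def by (simp add: exp_cnj inner_commute)

lemma inverse_fourier_integral_adjoint:
  fixes a b :: "(real^'d) \<Rightarrow> complex"
  assumes a: "integrable lebesgue a" and b: "integrable lebesgue b"
  shows "(LINT x|lebesgue. inverse_fourier_integral a x * cnj (b x)) = (LINT \<xi>|lebesgue. a \<xi> * cnj (fourier_integral b \<xi>))"
proof -
  define c where "c = complex_of_real ((2 * pi) powr (- real CARD('d) / 2))"
  have nb: "norm (cnj (plane_wave p)) \<le> 1" for p :: "(real^'d) \<times> (real^'d)" by simp
  have b': "integrable lebesgue (\<lambda>x. c * cnj (b x))" using b by simp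
  have "(LINT x|lebesgue. inverse_fourier_integral a x * cnj (b x))
     = (LINT x|lebesgue. (LINT \<xi>|lebesgue. a \<xi> * cnj (plane_wave (\<xi>, x))) * (c * cnj (b x)))"
    unfolding inverse_fourier_integral_plane_wave c_def by (simp add: mult_ac)
  also have "\<dots> = (LINT \<xi>|lebesgue. a \<xi> * (LINT x|lebesgue. cnj (plane_wave (\<xi>, x)) * (c * cnj (b x))))"
    by (rule integral_swap_bounded_kernel[OF lebesgue_pair.pair_sigma_finite_axioms a b' cnj_plane_wave_measurable nb])
  also have "(\<lambda>\<xi>. LINT x|lebesgue. cnj (plane_wave (\<xi>, x)) * (c * cnj (b x))) = (\<lambda>\<xi>. cnj (fourier_integral b \<xi>))"
  proof
    fix \<xi>
    have "cnj (fourier_integral b \<xi>) = c * (LINT x|lebesgue. cnj (b x * iexp (x \<bullet> \<xi>)))"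
      unfolding fourier_integral_def c_def
      by (subst complex_cnj_mult) (simp only: Bochner_Integration.integral_cnj complex_cnj_complex_of_real)
    also have "\<dots> = (LINT x|lebesgue. c * cnj (b x * iexp (x \<bullet> \<xi>)))"
      by (rule integral_mult_right_zero[symmetric])
    also have "\<dots> = (LINT x|lebesgue. cnj (plane_wave (\<xi>, x)) * (c * cnj (b x)))"
      by (intro Bochner_Integration.integral_cong refl) (simp add: inner_commute mult_ac)
    finally show "(LINT x|lebesgue. cnj (plane_wave (\<xi>, x)) * (c * cnj (b x))) = cnj (fourier_integral b \<xi>)" ..
  qed
  finally show ?thesis .
qed

lemma sums_if_ennreal_suminf:
  assumes "\<And>n. 0 \<le> a n" "(\<Sum>n. ennreal (a n)) = ennreal t" "0 \<le> t"
  shows "a sums t"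
proof -
  have s: "summable a" using assms by (intro summable_suminf_not_top) auto
  then have "ennreal (suminf a) = ennreal t" using suminf_ennreal2[OF assms(1) s] assms(2) by simp
  then have "suminf a = t" using assms(3) suminf_nonneg[OF s assms(1)] by simp
  then show ?thesis using s by (simp add: sums_iff)
qed

lemma Parseval_ennreal:
  assumes "L2_orthonormal_basis e" "f \<in> L2"
  shows "(\<Sum>n. ennreal ((norm (L2_inner (e n) f))\<^sup>2)) = L2_mass f"
proof -
  have eq: "norm (L2_inner (e n) f) = norm (L2_inner f (e n))" for n
    by (subst L2_inner_commute) simp
  show ?thesis
    unfolding eq nn_integral_L2[OF assms(2)]
    by (rule suminf_ennreal_eq[OF _ Parseval[OF assms]]) simp
qed

text \<open>
  The integral of $|k(x-y)|^2$ over $U \times V$. For $U = V = F$ it is the squared Hilbert--Schmidt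
  norm of the limiting operator.
\<close>

definition double_energy :: "(real^'d) set \<Rightarrow> (real^'d) set \<Rightarrow> (real^'d) set \<Rightarrow> ennreal" where
  "double_energy S U V = (\<integral>\<^sup>+x. (\<integral>\<^sup>+y. indicator U x * indicator V y * ennreal ((norm (band_kernel S (x - y)))\<^sup>2) \<partial>lebesgue) \<partial>lebesgue)"

lemma double_energy_finite:
  assumes "F \<in> sets lebesgue" "emeasure lebesgue F < \<infinity>"
  shows "double_energy S F F < \<infinity>"
proof -
  obtain B where B: "\<And>z. norm (band_kernel S z) \<le> B" using norm_band_kernel_le by blast
  have "double_energy S F F \<le> (\<integral>\<^sup>+x. (\<integral>\<^sup>+y. indicator F x * (ennreal (B\<^sup>2) * indicator F y) \<partial>lebesgue) \<partial>lebesgue)"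
    unfolding double_energy_def
    by (intro nn_integral_mono) (auto split: split_indicator intro!: ennreal_leI power_mono B)
  also have "\<dots> = ennreal (B\<^sup>2) * emeasure lebesgue F * emeasure lebesgue F"
    using assms by (simp add: nn_integral_cmult nn_integral_multc mult_ac del: emeasure_completion)
  also have "\<dots> < \<infinity>" using assms(2) by (simp add: ennreal_mult_less_top del: emeasure_completion)
  finally show ?thesis .
qed

context
  fixes F S :: "(real^'d) set"
  assumes F: "F \<in> sets lebesgue" "emeasure lebesgue F < \<infinity>"
    and S: "S \<in> sets lebesgue" "emeasure lebesgue S < \<infinity>"
begin

text \<open>
  Both transforms in the definition of the operator are applied to functions that vanish outside a set of
  finite measure. They are therefore given by the integral formula up to null sets, and changes on null sets
  do not affect the next transform.
\<close>

lemma limiting_op_AE: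
  assumes f: "f \<in> L2"
  shows "limiting_op F S f \<in> L2"
    and "AE x in lebesgue. limiting_op F S f x
       = indicator F x * inverse_fourier_integral (space_proj S (fourier_integral (space_proj F f))) x"
    and "integrable lebesgue (space_proj S (fourier_integral (space_proj F f)))"
proof -
  let ?u = "space_proj F f"
  have u: "?u \<in> L2" "integrable lebesgue ?u"
    using space_proj_L2[OF F(1) f] space_proj_integrable[OF F f] .
  let ?g = "L2_fourier ?u"
  have g: "?g \<in> L2" "AE x in lebesgue. ?g x = fourier_integral ?u x" "fourier_integral ?u \<in> L2"
    using L2_fourier_eq[OF u] .
  let ?v = "space_proj S ?g" and ?w = "space_proj S (fourier_integral ?u)"
  have v: "?v \<in> L2" "integrable lebesgue ?v"
    using space_proj_L2[OF S(1) g(1)] space_proj_integrable[OF S g(1)] .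
  show w: "integrable lebesgue ?w" by (rule space_proj_integrable[OF S g(3)])
  have vw: "AE x in lebesgue. ?v x = ?w x"
    using g(2) by eventually_elim (simp add: space_proj_def)
  have op: "limiting_op F S f = space_proj F (L2_inverse_fourier ?v)"
    unfolding limiting_op_def band_proj_def by simp
  show "limiting_op F S f \<in> L2"
    unfolding op by (rule space_proj_L2[OF F(1) L2_inverse_fourier_eq(1)[OF v]])
  show "AE x in lebesgue. limiting_op F S f x = indicator F x * inverse_fourier_integral ?w x"
    using L2_inverse_fourier_eq(2)[OF v]
    unfolding op inverse_fourier_integral_cong_AE[OF v(2) w vw]
    by eventually_elim (simp add: space_proj_def)
qed

lemma limiting_op_eq_kernel:
  assumes f: "f \<in> L2"
  shows "inverse_fourier_integral (space_proj S (fourier_integral (space_proj F f))) x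
     = (LINT y|lebesgue. space_proj F f y * band_kernel S (x - y))"
proof -
  define c where "c = complex_of_real ((2 * pi) powr (- real CARD('d) / 2))"
  let ?u = "space_proj F f"
  have u: "integrable lebesgue ?u" by (rule space_proj_integrable[OF F f])
  define b where "b \<xi> = c * c * (indicator S \<xi> * cnj (plane_wave (\<xi>, x)))" for \<xi>
  have b: "integrable lebesgue b"
  proof -
    have "integrable lebesgue (\<lambda>\<xi>. indicator S \<xi> * cnj (plane_wave (\<xi>, x)))"
    proof (rule Bochner_Integration.integrable_bound[OF indicator_integrable[OF S]])
      have "(\<lambda>\<xi>. cnj (plane_wave (\<xi>, x))) \<in> borel_measurable lebesgue"
        by (intro measurable_lebesgue_borel borel_measurable_continuous_onI continuous_intros)
      then show "(\<lambda>\<xi>. indicator S \<xi> * cnj (plane_wave (\<xi>, x))) \<in> borel_measurable lebesgue"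
        using S(1) by (intro borel_measurable_times) auto
    qed (simp add: norm_mult)
    then show ?thesis unfolding b_def by simp
  qed
  have nb: "norm (plane_wave p) \<le> 1" for p :: "(real^'d) \<times> (real^'d)" by simp
  have "inverse_fourier_integral (space_proj S (fourier_integral ?u)) x
     = c * (LINT \<xi>|lebesgue. space_proj S (fourier_integral ?u) \<xi> * cnj (plane_wave (\<xi>, x)))"
    unfolding inverse_fourier_integral_plane_wave c_def ..
  also have "\<dots> = (LINT \<xi>|lebesgue. c * (space_proj S (fourier_integral ?u) \<xi> * cnj (plane_wave (\<xi>, x))))"
    by (rule integral_mult_right_zero[symmetric])
  also have "\<dots> = (LINT \<xi>|lebesgue. (LINT y|lebesgue. ?u y * plane_wave (y, \<xi>)) * b \<xi>)"
    by (intro Bochner_Integration.integral_cong refl)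
       (simp add: b_def fourier_integral_def c_def space_proj_def[of S] mult_ac)
  also have "\<dots> = (LINT y|lebesgue. ?u y * (LINT \<xi>|lebesgue. plane_wave (y, \<xi>) * b \<xi>))"
    by (rule integral_swap_bounded_kernel[OF lebesgue_pair.pair_sigma_finite_axioms u b plane_wave_measurable nb])
  also have "(\<lambda>y. LINT \<xi>|lebesgue. plane_wave (y, \<xi>) * b \<xi>) = (\<lambda>y. band_kernel S (x - y))"
  proof
    fix y
    have pw: "cnj (plane_wave (\<xi>, x - y)) = plane_wave (y, \<xi>) * cnj (plane_wave (\<xi>, x))" for \<xi>
      by (simp add: exp_cnj inner_diff_right right_diff_distrib inner_commute flip: exp_add)
    have "(LINT \<xi>|lebesgue. plane_wave (y, \<xi>) * b \<xi>) = (LINT \<xi>|lebesgue. (c * c) * (indicator S \<xi> * cnj (plane_wave (\<xi>, x - y))))"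
      unfolding b_def pw by (simp add: mult_ac)
    also have "\<dots> = (c * c) * (LINT \<xi>|lebesgue. indicator S \<xi> * cnj (plane_wave (\<xi>, x - y)))"
      by (rule integral_mult_right_zero)
    finally show "(LINT \<xi>|lebesgue. plane_wave (y, \<xi>) * b \<xi>) = band_kernel S (x - y)"
      unfolding band_kernel_def inverse_fourier_integral_plane_wave c_def by (simp only: mult.assoc)
  qed
  finally show ?thesis .
qed

lemma limiting_op_inner:
  assumes f: "f \<in> L2" and g: "g \<in> L2"
  shows "L2_inner (limiting_op F S g) f =
    (LINT \<xi>|lebesgue. indicator S \<xi> * (fourier_integral (space_proj F g) \<xi> * cnj (fourier_integral (space_proj F f) \<xi>)))"
proof -
  let ?w = "space_proj S (fourier_integral (space_proj F g))"
  note T = limiting_op_AE[OF g]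
  have "L2_inner (limiting_op F S g) f = L2_inner (\<lambda>x. indicator F x * inverse_fourier_integral ?w x) f"
    by (rule L2_inner_cong_AE[OF T(1) f T(2)]) simp
  also have "\<dots> = (LINT x|lebesgue. inverse_fourier_integral ?w x * cnj (space_proj F f x))"
    unfolding L2_inner_def by (intro Bochner_Integration.integral_cong refl) (auto simp: space_proj_def split: split_indicator)
  also have "\<dots> = (LINT \<xi>|lebesgue. ?w \<xi> * cnj (fourier_integral (space_proj F f) \<xi>))"
    by (rule inverse_fourier_integral_adjoint[OF T(3) space_proj_integrable[OF F f]])
  finally show ?thesis by (simp add: space_proj_def[of S] mult.assoc)
qed

text \<open>
  The operator is self-adjoint, so the diagonal entries of its square are the squared norms of the
  images.
\<close>

lemma limiting_op_inner_self:
  assumes f: "f \<in> L2"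
  shows "L2_inner (limiting_op F S f) f =
      complex_of_real (LINT \<xi>|lebesgue. indicator S \<xi> * (norm (fourier_integral (space_proj F f) \<xi>))\<^sup>2)"
    and "L2_inner ((limiting_op F S ^^ 2) f) f = complex_of_real (L2_norm_sq (limiting_op F S f))"
proof -
  show "L2_inner (limiting_op F S f) f =
      complex_of_real (LINT \<xi>|lebesgue. indicator S \<xi> * (norm (fourier_integral (space_proj F f) \<xi>))\<^sup>2)"
    unfolding limiting_op_inner[OF f f] integral_complex_of_real[symmetric]
    by (intro Bochner_Integration.integral_cong refl) (simp add: complex_norm_square del: of_real_power split: split_indicator)
  let ?g = "limiting_op F S f"
  have g: "?g \<in> L2" by (rule limiting_op_AE(1)[OF f])
  have "L2_inner (limiting_op F S ?g) f = cnj (L2_inner (limiting_op F S f) ?g)"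
    unfolding limiting_op_inner[OF f g] limiting_op_inner[OF g f] Bochner_Integration.integral_cnj[symmetric]
    by (intro Bochner_Integration.integral_cong refl) (auto split: split_indicator)
  also have "\<dots> = complex_of_real (L2_norm_sq ?g)" by (simp add: L2_inner_self)
  finally show "L2_inner ((limiting_op F S ^^ 2) f) f = complex_of_real (L2_norm_sq ?g)"
    by (simp add: numeral_2_eq_2)
qed

section \<open>The trace\<close>

text \<open>
  The value of the Fourier integral of $1_F e_n$ at $\xi$ is the inner product of $e_n$ with the
  function $(2\pi)^{-d/2}\,1_F(x)\,e^{-ix\cdot\xi}$, of squared norm $(2\pi)^{-d}|F|$. Parseval sums over $n$ for each
  $\xi \in S$, and integrating over $S$ gives the trace.
\<close>

lemma sums_inner_limiting_op:
  assumes e: "L2_orthonormal_basis e"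
  shows "(\<lambda>n. LINT \<xi>|lebesgue. indicator S \<xi> * (norm (fourier_integral (space_proj F (e n)) \<xi>))\<^sup>2)
     sums ((2 * pi) powr (- real CARD('d)) * measure lebesgue F * measure lebesgue S)"
proof (rule sums_if_ennreal_suminf)
  let ?G = "\<lambda>n \<xi>. (norm (fourier_integral (space_proj F (e n)) \<xi>))\<^sup>2"
  define c where "c = (2 * pi) powr (- real CARD('d) / 2)"
  have c2: "c\<^sup>2 = (2 * pi) powr (- real CARD('d))" unfolding c_def by (simp add: power2_eq_square flip: powr_add)
  have mem: "e n \<in> L2" for n using e by (auto simp: L2_orthonormal_basis_def)
  have [measurable]: "S \<in> sets lebesgue" "F \<in> sets lebesgue" using S F by auto
  note u = space_proj_L2[OF F(1) mem] space_proj_integrable[OF F mem]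
  have Fu: "fourier_integral (space_proj F (e n)) \<in> L2" for n
    using L2_fourier_eq(3)[OF u] .
  have [measurable]: "fourier_integral (space_proj F (e n)) \<in> borel_measurable lebesgue" for n
    using Fu by (rule L2_measurable)
  define g where "g \<xi> x = complex_of_real c * (indicator F x * cnj (plane_wave (x, \<xi>)))" for \<xi> x
  have gn: "norm (g \<xi> x) = c * indicator F x" for \<xi> x
    unfolding g_def c_def by (simp add: norm_mult split: split_indicator)
  have gnn: "L2_mass (g \<xi>) = ennreal (c\<^sup>2) * emeasure lebesgue F" for \<xi>
  proof -
    have "L2_mass (g \<xi>) = (\<integral>\<^sup>+x. ennreal (c\<^sup>2) * indicator F x \<partial>lebesgue)"
      unfolding gn by (intro nn_integral_cong) (auto split: split_indicator)
    then show ?thesis by (simp add: nn_integral_cmult del: emeasure_completion)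
  qed
  have gL2: "g \<xi> \<in> L2" for \<xi>
  proof (rule L2_I)
    have "(\<lambda>x. cnj (plane_wave (x, \<xi>))) \<in> borel_measurable lebesgue"
      by (intro measurable_lebesgue_borel borel_measurable_continuous_onI continuous_intros)
    then show "g \<xi> \<in> borel_measurable lebesgue"
      unfolding g_def using F(1) by (intro borel_measurable_times) auto
    show "L2_mass (g \<xi>) < \<infinity>"
      unfolding gnn using F(2) by (simp add: ennreal_mult_less_top del: emeasure_completion)
  qed
  have inner: "fourier_integral (space_proj F (e n)) \<xi> = L2_inner (e n) (g \<xi>)" for n \<xi>
  proof -
    have "L2_inner (e n) (g \<xi>) = (LINT x|lebesgue. complex_of_real c * (space_proj F (e n) x * iexp (x \<bullet> \<xi>)))"
      unfolding L2_inner_def g_def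
      by (intro Bochner_Integration.integral_cong refl) (auto simp: space_proj_def split: split_indicator)
    also have "\<dots> = complex_of_real c * (LINT x|lebesgue. space_proj F (e n) x * iexp (x \<bullet> \<xi>))"
      by (rule integral_mult_right_zero)
    finally show ?thesis unfolding fourier_integral_def c_def by simp
  qed
  have int: "integrable lebesgue (\<lambda>\<xi>. indicator S \<xi> * ?G n \<xi>)" for n
    by (rule Bochner_Integration.integrable_bound[OF L2_integrable_square[OF Fu]])
       (auto intro!: AE_I2 split: split_indicator)
  show "0 \<le> (LINT \<xi>|lebesgue. indicator S \<xi> * ?G n \<xi>)" for n
    by (intro integral_nonneg_AE AE_I2) auto
  show "0 \<le> (2 * pi) powr (- real CARD('d)) * measure lebesgue F * measure lebesgue S" by simp
  have "(\<Sum>n. ennreal (LINT \<xi>|lebesgue. indicator S \<xi> * ?G n \<xi>)) = (\<Sum>n. \<integral>\<^sup>+\<xi>. indicator S \<xi> * ennreal (?G n \<xi>) \<partial>lebesgue)"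
  proof (intro arg_cong[where f=suminf] ext)
    fix n
    show "ennreal (LINT \<xi>|lebesgue. indicator S \<xi> * ?G n \<xi>) = (\<integral>\<^sup>+\<xi>. indicator S \<xi> * ennreal (?G n \<xi>) \<partial>lebesgue)"
      by (subst nn_integral_eq_integral[OF int, symmetric]) (auto intro!: AE_I2 nn_integral_cong split: split_indicator)
  qed
  also have "\<dots> = (\<integral>\<^sup>+\<xi>. (\<Sum>n. indicator S \<xi> * ennreal (?G n \<xi>)) \<partial>lebesgue)"
    by (rule nn_integral_suminf[symmetric]) measurable
  also have "\<dots> = (\<integral>\<^sup>+\<xi>. (ennreal (c\<^sup>2) * emeasure lebesgue F) * indicator S \<xi> \<partial>lebesgue)"
    unfolding ennreal_suminf_cmult inner Parseval_ennreal[OF e gL2] gnn by (simp only: mult.commute)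
  also have "\<dots> = (ennreal (c\<^sup>2) * emeasure lebesgue F) * emeasure lebesgue S"
    by (rule nn_integral_cmult_indicator) (rule S)
  also have "\<dots> = ennreal ((2 * pi) powr (- real CARD('d)) * measure lebesgue F * measure lebesgue S)"
    unfolding c2 using F(2) S(2)
    by (simp add: emeasure_eq_ennreal_measure less_top ennreal_mult del: emeasure_completion)
  finally show "(\<Sum>n. ennreal (LINT \<xi>|lebesgue. indicator S \<xi> * ?G n \<xi>))
     = ennreal ((2 * pi) powr (- real CARD('d)) * measure lebesgue F * measure lebesgue S)" .
qed

text \<open>
  Likewise the value of $T e_n$ at $x \in F$ is the inner product of $e_n$ with the conjugate of the
  kernel row at $x$.
\<close>

lemma sums_norm_limiting_op:
  assumes e: "L2_orthonormal_basis e"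
  shows "(\<lambda>n. L2_norm_sq (limiting_op F S (e n))) sums enn2real (double_energy S F F)"
proof (rule sums_if_ennreal_suminf)
  have mem: "e n \<in> L2" for n using e by (auto simp: L2_orthonormal_basis_def)
  have [measurable]: "S \<in> sets lebesgue" "F \<in> sets lebesgue" using S F by auto
  obtain B where B: "\<And>z. norm (band_kernel S z) \<le> B" using norm_band_kernel_le by blast
  define \<kappa> where "\<kappa> x y = indicator F y * cnj (band_kernel S (x - y))" for x y
  have \<kappa>n: "ennreal ((norm (\<kappa> x y))\<^sup>2) = indicator F y * ennreal ((norm (band_kernel S (x - y)))\<^sup>2)" for x y
    unfolding \<kappa>_def by (auto simp: norm_mult split: split_indicator)
  have \<kappa>: "\<kappa> x \<in> L2" for x
  proof (rule L2_I)
    have "(\<lambda>y. band_kernel S (x - y)) \<in> borel_measurable lebesgue"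
      by (intro measurable_lebesgue_borel measurable_compose[OF _ band_kernel_measurable[OF S(1)]]) measurable
    then show "\<kappa> x \<in> borel_measurable lebesgue" unfolding \<kappa>_def using F(1) by measurable
    have "L2_mass (\<kappa> x) \<le> (\<integral>\<^sup>+y. ennreal (B\<^sup>2) * indicator F y \<partial>lebesgue)"
      unfolding \<kappa>n by (intro nn_integral_mono) (auto split: split_indicator intro!: ennreal_leI power_mono B)
    also have "\<dots> = ennreal (B\<^sup>2) * emeasure lebesgue F" by (rule nn_integral_cmult_indicator) (rule F)
    also have "\<dots> < \<infinity>" using F(2) by (simp add: ennreal_mult_less_top del: emeasure_completion)
    finally show "L2_mass (\<kappa> x) < \<infinity>" .
  qed
  have T: "AE x in lebesgue. limiting_op F S (e n) x = indicator F x * L2_inner (e n) (\<kappa> x)" for n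
    using limiting_op_AE(2)[OF mem[of n]]
  proof eventually_elim
    fix x assume *: "limiting_op F S (e n) x = indicator F x * inverse_fourier_integral (space_proj S (fourier_integral (space_proj F (e n)))) x"
    have "(LINT y|lebesgue. space_proj F (e n) y * band_kernel S (x - y)) = L2_inner (e n) (\<kappa> x)"
      unfolding L2_inner_def \<kappa>_def
      by (intro Bochner_Integration.integral_cong refl) (auto simp: space_proj_def split: split_indicator)
    then show "limiting_op F S (e n) x = indicator F x * L2_inner (e n) (\<kappa> x)"
      unfolding * limiting_op_eq_kernel[OF mem] by simp
  qed
  have TL2: "(\<lambda>x. indicator F x * L2_inner (e n) (\<kappa> x)) \<in> L2" for n
    by (rule L2_AE_cong[OF limiting_op_AE(1)[OF mem] T])
  show "0 \<le> L2_norm_sq (limiting_op F S (e n))" for n by (rule L2_norm_sq_nonneg)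
  have "(\<Sum>n. ennreal (L2_norm_sq (limiting_op F S (e n))))
      = (\<Sum>n. \<integral>\<^sup>+x. ennreal ((norm (indicator F x * L2_inner (e n) (\<kappa> x)))\<^sup>2) \<partial>lebesgue)"
  proof (intro arg_cong[where f=suminf] ext)
    fix n
    show "ennreal (L2_norm_sq (limiting_op F S (e n))) = (\<integral>\<^sup>+x. ennreal ((norm (indicator F x * L2_inner (e n) (\<kappa> x)))\<^sup>2) \<partial>lebesgue)"
      unfolding nn_integral_L2[OF limiting_op_AE(1)[OF mem], symmetric]
      by (intro nn_integral_cong_AE eventually_mono[OF T[of n]]) auto
  qed
  also have "\<dots> = (\<integral>\<^sup>+x. (\<Sum>n. ennreal ((norm (indicator F x * L2_inner (e n) (\<kappa> x)))\<^sup>2)) \<partial>lebesgue)"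
  proof (rule nn_integral_suminf[symmetric])
    fix n
    show "(\<lambda>x. ennreal ((norm (indicator F x * L2_inner (e n) (\<kappa> x)))\<^sup>2)) \<in> borel_measurable lebesgue"
      by (rule measurable_compose[OF L2_measurable[OF TL2[of n]], of "\<lambda>z. ennreal ((norm z)\<^sup>2)"]) measurable
  qed
  also have "\<dots> = (\<integral>\<^sup>+x. indicator F x * (\<Sum>n. ennreal ((norm (L2_inner (e n) (\<kappa> x)))\<^sup>2)) \<partial>lebesgue)"
  proof (rule nn_integral_cong)
    fix x
    show "(\<Sum>n. ennreal ((norm (indicator F x * L2_inner (e n) (\<kappa> x)))\<^sup>2))
        = indicator F x * (\<Sum>n. ennreal ((norm (L2_inner (e n) (\<kappa> x)))\<^sup>2))"
      by (cases "x \<in> F") simp_all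
  qed
  also have "\<dots> = (\<integral>\<^sup>+x. indicator F x * (\<integral>\<^sup>+y. indicator F y * ennreal ((norm (band_kernel S (x - y)))\<^sup>2) \<partial>lebesgue) \<partial>lebesgue)"
    unfolding Parseval_ennreal[OF e \<kappa>] \<kappa>n ..
  also have "\<dots> = double_energy S F F"
    unfolding double_energy_def by (intro nn_integral_cong) (auto split: split_indicator)
  finally show "(\<Sum>n. ennreal (L2_norm_sq (limiting_op F S (e n)))) = ennreal (enn2real (double_energy S F F))"
    using double_energy_finite[OF F, of S] by (simp add: less_top)
qed simp

text \<open>
  The description in \<open>L2_trace_def\<close> denotes the common value of the sums because at least one
  orthonormal basis exists.
\<close>

theorem trace_limiting_op_minus_square:
  shows "L2_trace (limiting_op F S - limiting_op F S ^^ 2) =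
    complex_of_real ((2 * pi) powr (- real CARD('d)) * measure lebesgue F * measure lebesgue S - enn2real (double_energy S F F))"
proof -
  let ?t = "(2 * pi) powr (- real CARD('d)) * measure lebesgue F * measure lebesgue S - enn2real (double_energy S F F)"
  let ?T = "limiting_op F S"
  have sums: "(\<lambda>n. L2_inner ((?T - ?T ^^ 2) (e n)) (e n)) sums complex_of_real ?t" if e: "L2_orthonormal_basis e" for e
  proof -
    have mem: "e n \<in> L2" for n using e by (auto simp: L2_orthonormal_basis_def)
    have "L2_inner ((?T - ?T ^^ 2) (e n)) (e n) = complex_of_real
       ((LINT \<xi>|lebesgue. indicator S \<xi> * (norm (fourier_integral (space_proj F (e n)) \<xi>))\<^sup>2) - L2_norm_sq (?T (e n)))" for n
    proof -
      have T: "?T (e n) \<in> L2" by (rule limiting_op_AE(1)[OF mem])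
      have TT: "(?T ^^ 2) (e n) \<in> L2"
        using limiting_op_AE(1)[OF T] by (simp add: numeral_2_eq_2)
      have "(?T - ?T ^^ 2) (e n) = (\<lambda>x. ?T (e n) x - (?T ^^ 2) (e n) x)"
        by (simp add: fun_eq_iff)
      then have "L2_inner ((?T - ?T ^^ 2) (e n)) (e n) = L2_inner (?T (e n)) (e n) - L2_inner ((?T ^^ 2) (e n)) (e n)"
        using L2_inner_diff_left[OF T TT mem] by simp
      then show ?thesis unfolding limiting_op_inner_self[OF mem] by simp
    qed
    moreover have "(\<lambda>n. (LINT \<xi>|lebesgue. indicator S \<xi> * (norm (fourier_integral (space_proj F (e n)) \<xi>))\<^sup>2) - L2_norm_sq (?T (e n))) sums ?t"
      by (intro sums_diff sums_inner_limiting_op sums_norm_limiting_op e)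
    ultimately show ?thesis by (simp only: sums_of_real)
  qed
  obtain e0 :: "nat \<Rightarrow> (real^'d) \<Rightarrow> complex" where e0: "L2_orthonormal_basis e0"
    using ex_L2_orthonormal_basis by blast
  show ?thesis
    unfolding L2_trace_def
    by (rule the_equality) (use sums e0 sums_unique2 in blast)+
qed

end

lemma nn_integral_band_kernel:
  fixes S :: "(real^'d) set"
  assumes S: "S \<in> sets lebesgue" "emeasure lebesgue S < \<infinity>"
  shows "(\<integral>\<^sup>+z. ennreal ((norm (band_kernel S z))\<^sup>2) \<partial>lborel) \<le> ennreal ((2 * pi) powr (- real CARD('d))) * emeasure lebesgue S"
    and "perimeter \<eta> S < \<infinity> \<Longrightarrow> 0 < \<eta> \<Longrightarrow>
       (\<integral>\<^sup>+z. ennreal ((norm (band_kernel S z))\<^sup>2) \<partial>lborel) \<ge> ennreal ((2 * pi) powr (- real CARD('d))) * emeasure lebesgue S"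
proof -
  have "(indicator S :: _ \<Rightarrow> complex) \<in> borel_measurable lebesgue" using S(1) by simp
  then have [measurable]: "fourier_integral (indicator S) \<in> borel_measurable borel"
    by (rule fourier_integral_measurable_borel)
  have eq: "(\<integral>\<^sup>+z. ennreal ((norm (band_kernel S z))\<^sup>2) \<partial>lborel)
     = ennreal ((2 * pi) powr (- real CARD('d))) * L2_mass (fourier_integral (indicator S))"
    by (simp add: norm_band_kernel_sq ennreal_mult nn_integral_cmult nn_integral_completion)
  show "(\<integral>\<^sup>+z. ennreal ((norm (band_kernel S z))\<^sup>2) \<partial>lborel) \<le> ennreal ((2 * pi) powr (- real CARD('d))) * emeasure lebesgue S"
    unfolding eq using fourier_integral_contraction[OF indicator_integrable[OF S]] nn_integral_indicator_sq[OF S(1)]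
    by (intro mult_left_mono) auto
  show "(\<integral>\<^sup>+z. ennreal ((norm (band_kernel S z))\<^sup>2) \<partial>lborel) \<ge> ennreal ((2 * pi) powr (- real CARD('d))) * emeasure lebesgue S"
    if "perimeter \<eta> S < \<infinity>" "0 < \<eta>"
    unfolding eq by (intro mult_left_mono emeasure_le_fourier_indicator[OF S that]) simp
qed

text \<open>
  The lower bound for $\int|k|^2$ gives $(2\pi)^{-d}|F||S| \le \int_F\int|k(x-y)|^2\,dy\,dx$. Subtracting
  the part with $y \in F$, the trace of the square, leaves the part with $y \notin F$.
\<close>

lemma trace_le_exit_energy:
  fixes F S :: "(real^'d) set"
  assumes F: "F \<in> sets lebesgue" "emeasure lebesgue F < \<infinity>"
    and S: "S \<in> sets lebesgue" "emeasure lebesgue S < \<infinity>" "perimeter \<eta> S < \<infinity>" "0 < \<eta>"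
    and q: "(\<integral>\<^sup>+z. ennreal ((norm (band_kernel S z))\<^sup>2) * emeasure lebesgue (exit_set F z) \<partial>lborel) \<le> ennreal q" "0 \<le> q"
  shows "L2_trace (limiting_op F S - limiting_op F S ^^ 2) \<le> complex_of_real q"
proof -
  let ?k = "\<lambda>z. ennreal ((norm (band_kernel S z))\<^sup>2)"
  let ?f = "\<lambda>V x. \<integral>\<^sup>+y. indicator F x * indicator V y * ?k (x - y) \<partial>lebesgue"
  let ?A = "(2 * pi) powr (- real CARD('d)) * measure lebesgue F * measure lebesgue S"
  have [measurable]: "band_kernel S \<in> borel_measurable borel" by (rule band_kernel_measurable[OF S(1)])
  have km: "(\<lambda>y. ?k (x - y)) \<in> borel_measurable lebesgue" for x
    by (intro measurable_lebesgue_borel) measurable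
  have km2: "(\<lambda>p. ?k (fst p - snd p)) \<in> borel_measurable (lebesgue \<Otimes>\<^sub>M lebesgue)"
    using band_kernel_diff_measurable[OF S(1)] by measurable
  have F': "- F \<in> sets lebesgue" using sets.compl_sets[OF F(1)] by (simp add: Compl_eq_Diff_UNIV)
  have [measurable]: "F \<in> sets lebesgue" by fact
  have mass: "(\<integral>\<^sup>+y. ?k (x - y) \<partial>lebesgue) = (\<integral>\<^sup>+z. ?k z \<partial>lborel)" for x
    using nn_integral_lborel_reflect[of ?k x] by (simp add: nn_integral_completion)
  have "ennreal ?A = (ennreal ((2 * pi) powr (- real CARD('d))) * emeasure lebesgue S) * emeasure lebesgue F"
    using F(2) S(2) by (simp add: emeasure_eq_ennreal_measure less_top ennreal_mult mult_ac del: emeasure_completion)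
  also have "\<dots> \<le> (\<integral>\<^sup>+z. ?k z \<partial>lborel) * emeasure lebesgue F"
    by (intro mult_right_mono nn_integral_band_kernel(2)[OF S]) simp
  also have "\<dots> = (\<integral>\<^sup>+x. (\<integral>\<^sup>+z. ?k z \<partial>lborel) * indicator F x \<partial>lebesgue)"
    by (rule nn_integral_cmult_indicator[symmetric]) (rule F)
  also have "\<dots> = (\<integral>\<^sup>+x. ?f F x
     + ?f (- F) x \<partial>lebesgue)"
  proof (rule nn_integral_cong)
    fix x
    have "(\<integral>\<^sup>+z. ?k z \<partial>lborel) = (\<integral>\<^sup>+y. indicator F y * ?k (x - y) + indicator (- F) y * ?k (x - y) \<partial>lebesgue)"
      unfolding mass[of x, symmetric] by (intro nn_integral_cong) (auto split: split_indicator)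
    also have "\<dots> = (\<integral>\<^sup>+y. indicator F y * ?k (x - y) \<partial>lebesgue) + (\<integral>\<^sup>+y. indicator (- F) y * ?k (x - y) \<partial>lebesgue)"
      by (intro nn_integral_add borel_measurable_times_ennreal borel_measurable_indicator km F F')
    finally show "(\<integral>\<^sup>+z. ?k z \<partial>lborel) * indicator F x = ?f F x
     + ?f (- F) x"
      by (cases "x \<in> F") auto
  qed
  also have "\<dots> = double_energy S F F + double_energy S F (- F)"
    unfolding double_energy_def
  proof (rule nn_integral_add)
    have *: "?f V \<in> borel_measurable lebesgue" if "V \<in> sets lebesgue" for V
    proof -
      have "(\<lambda>p. indicator F (fst p) * indicator V (snd p) * ?k (fst p - snd p)) \<in> borel_measurable (lebesgue \<Otimes>\<^sub>M lebesgue)"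
        by (intro borel_measurable_times_ennreal measurable_compose[OF measurable_fst borel_measurable_indicator]
          measurable_compose[OF measurable_snd borel_measurable_indicator] km2 F that)
      from lebesgue.borel_measurable_nn_integral_fst[OF this] show ?thesis by simp
    qed
    show "?f F \<in> borel_measurable lebesgue"
      by (rule *[OF F(1)])
    show "?f (- F) \<in> borel_measurable lebesgue"
      by (rule *[OF F'])
  qed
  also have "double_energy S F (- F) = (\<integral>\<^sup>+z. ?k z * emeasure lebesgue (exit_set F z) \<partial>lborel)"
    unfolding double_energy_def by (rule nn_integral_exit_set(1)[OF F(1)]) measurable
  also have "double_energy S F F + \<dots> \<le> ennreal (enn2real (double_energy S F F)) + ennreal q"
    using double_energy_finite[OF F, of S] q(1) by (intro add_mono) (auto simp: less_top)
  also have "\<dots> = ennreal (enn2real (double_energy S F F) + q)" using q(2) by simp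
  finally have "?A \<le> enn2real (double_energy S F F) + q"
    using q(2) by (subst (asm) ennreal_le_iff) auto
  then show ?thesis
    unfolding trace_limiting_op_minus_square[OF F S(1,2)] by (simp add: less_eq_complex_def)
qed

section \<open>Dyadic summation\<close>

definition annulus :: "real \<Rightarrow> 'a::real_normed_vector set" where
  "annulus r = {z. r \<le> norm z \<and> norm z < 2 * r}"

lemma annulus_borel [measurable]: "annulus r \<in> sets (borel :: 'a::real_normed_vector measure)"
  unfolding annulus_def by measurable

lemma nn_integral_dyadic_le:
  fixes \<nu> :: "'a::real_normed_vector measure" and s :: "nat \<Rightarrow> real"
  assumes [measurable_cong]: "sets \<nu> = sets borel" and [measurable]: "W \<in> borel_measurable borel" "\<Omega> \<in> sets borel"
    and cover: "\<Omega> \<subseteq> (\<Union>j. annulus (s j))"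
    and each: "\<And>j. (\<integral>\<^sup>+z. W z * indicator (annulus (s j)) z \<partial>\<nu>) \<le> ennreal (c * q ^ j)"
    and c: "0 \<le> c" and q: "0 \<le> q" "q < 1"
  shows "(\<integral>\<^sup>+z. W z * indicator \<Omega> z \<partial>\<nu>) \<le> ennreal (c / (1 - q))"
proof -
  have "(\<integral>\<^sup>+z. W z * indicator \<Omega> z \<partial>\<nu>) \<le> (\<integral>\<^sup>+z. (\<Sum>j. W z * indicator (annulus (s j)) z) \<partial>\<nu>)"
  proof (rule nn_integral_mono)
    fix z
    show "W z * indicator \<Omega> z \<le> (\<Sum>j. W z * indicator (annulus (s j)) z)"
    proof (cases "z \<in> \<Omega>")
      case True
      then obtain j where j: "z \<in> annulus (s j)" using cover by auto
      have "W z * indicator \<Omega> z = (\<Sum>i\<in>{j}. W z * indicator (annulus (s i)) z)" using True j by simp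
      also have "\<dots> \<le> (\<Sum>j. W z * indicator (annulus (s j)) z)" by (rule sum_le_suminf) auto
      finally show ?thesis .
    qed simp
  qed
  also have "\<dots> = (\<Sum>j. \<integral>\<^sup>+z. W z * indicator (annulus (s j)) z \<partial>\<nu>)"
    by (rule nn_integral_suminf) measurable
  also have "\<dots> \<le> (\<Sum>j. ennreal (c * q ^ j))"
    by (intro suminf_le each) auto
  also have "\<dots> = ennreal (\<Sum>j. c * q ^ j)"
    using c q by (intro suminf_ennreal2 summable_mult summable_geometric) auto
  also have "(\<Sum>j. c * q ^ j) = c / (1 - q)"
    using q by (simp add: suminf_mult suminf_geometric summable_geometric)
  finally show ?thesis .
qed

text \<open>
  A measure whose mass on dyadic shells decays like $r^{-\eta}$, and a weight that is bounded by a constant and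
  by a power $|z|^\gamma$. The integral of the weight is estimated by comparing with geometric series.
  In the application $\nu$ has density $|k|^2$ and $W(z) = |F \setminus (F+z)|$.
\<close>

locale power_decay =
  fixes \<nu> :: "'a::real_normed_vector measure" and W :: "'a \<Rightarrow> ennreal"
    and A B P m \<gamma> \<eta> :: real
  assumes sets_\<nu> [measurable_cong]: "sets \<nu> = sets borel"
    and W_meas [measurable]: "W \<in> borel_measurable borel"
    and nonneg: "0 \<le> A" "0 \<le> B" "0 \<le> P" "0 \<le> m"
    and exponents: "0 < \<gamma>" "\<gamma> \<le> 1" "0 < \<eta>"
    and annulus_mass: "\<And>r. 0 < r \<Longrightarrow> emeasure \<nu> (annulus r) \<le> ennreal (A * r powr (- \<eta>))"
    and total_mass: "emeasure \<nu> UNIV \<le> ennreal B"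
    and W_bounded: "\<And>z. W z \<le> ennreal m"
    and W_power: "\<And>z. W z \<le> ennreal (P * norm z powr \<gamma>)"
begin

abbreviation mass_on :: "'a set \<Rightarrow> ennreal" where
  "mass_on \<Omega> \<equiv> \<integral>\<^sup>+z. W z * indicator \<Omega> z \<partial>\<nu>"

lemma mass_on_le:
  assumes "\<Omega> \<in> sets borel" "\<And>z. z \<in> \<Omega> \<Longrightarrow> W z \<le> ennreal c" "emeasure \<nu> \<Omega> \<le> ennreal b" "0 \<le> c" "0 \<le> b"
  shows "mass_on \<Omega> \<le> ennreal (c * b)"
proof -
  have "mass_on \<Omega> \<le> (\<integral>\<^sup>+z. ennreal c * indicator \<Omega> z \<partial>\<nu>)"
    using assms(2) by (intro nn_integral_mono) (auto split: split_indicator)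
  also have "\<dots> = ennreal c * emeasure \<nu> \<Omega>"
    using assms(1) by (intro nn_integral_cmult_indicator) (simp add: sets_\<nu>)
  also have "\<dots> \<le> ennreal c * ennreal b" by (intro mult_left_mono assms) simp
  finally show ?thesis using assms by (simp add: ennreal_mult)
qed

text \<open>
  The origin, which belongs to no shell, may be left out because the power bound forces the
  weight to vanish there.
\<close>

lemma mass_split:
  assumes "{z. z \<noteq> 0} \<subseteq> X \<union> Y" "X \<in> sets borel" "Y \<in> sets borel" "mass_on X \<le> ennreal a" "mass_on Y \<le> ennreal b" "0 \<le> a" "0 \<le> b"
  shows "(\<integral>\<^sup>+z. W z \<partial>\<nu>) \<le> ennreal (a + b)"
proof -
  note [measurable] = assms(2,3)
  have W0: "W 0 = 0" using W_power[of 0] exponents by simp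
  have "(\<integral>\<^sup>+z. W z \<partial>\<nu>) \<le> (\<integral>\<^sup>+z. W z * indicator X z + W z * indicator Y z \<partial>\<nu>)"
  proof (rule nn_integral_mono)
    fix z show "W z \<le> W z * indicator X z + W z * indicator Y z"
      using assms(1) W0 by (cases "z = 0") (auto split: split_indicator)
  qed
  also have "\<dots> = mass_on X + mass_on Y" by (rule nn_integral_add) measurable
  also have "\<dots> \<le> ennreal a + ennreal b" by (intro add_mono assms)
  finally show ?thesis using assms by simp
qed

lemma mass_on_annulus:
  assumes r: "0 < r"
  shows "mass_on (annulus r) \<le> ennreal (2 * P * A * r powr (\<gamma> - \<eta>))"
proof -
  have "mass_on (annulus r) \<le> ennreal ((2 * P * r powr \<gamma>) * (A * r powr (- \<eta>)))"
  proof (rule mass_on_le[OF annulus_borel _ annulus_mass[OF r]])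
    fix z :: 'a assume "z \<in> annulus r"
    then have "norm z powr \<gamma> \<le> (2 * r) powr \<gamma>" using exponents by (intro powr_mono2) (auto simp: annulus_def)
    also have "\<dots> = 2 powr \<gamma> * r powr \<gamma>" using r by (simp add: powr_mult)
    also have "\<dots> \<le> 2 * r powr \<gamma>" using powr_mono[of \<gamma> 1 2] exponents by (intro mult_right_mono) auto
    finally have "P * norm z powr \<gamma> \<le> 2 * P * r powr \<gamma>"
      using nonneg mult_left_mono by fastforce
    then show "W z \<le> ennreal (2 * P * r powr \<gamma>)"
      using W_power[of z] ennreal_leI order_trans by blast
  qed (use nonneg in auto)
  then show ?thesis by (simp add: powr_diff powr_minus field_simps)
qed

lemma mass_on_near: "0 < r \<Longrightarrow> mass_on {z. norm z < r} \<le> ennreal (P * r powr \<gamma> * B)"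
proof (rule mass_on_le)
  assume r: "0 < r"
  have "emeasure \<nu> {z. norm z < r} \<le> emeasure \<nu> UNIV" by (rule emeasure_mono) (auto simp: sets_\<nu>)
  then show "emeasure \<nu> {z. norm z < r} \<le> ennreal B" using total_mass by simp
  fix z :: 'a assume "z \<in> {z. norm z < r}"
  then have "P * norm z powr \<gamma> \<le> P * r powr \<gamma>"
    using nonneg exponents r by (intro mult_left_mono powr_mono2) auto
  then show "W z \<le> ennreal (P * r powr \<gamma>)"
    using W_power[of z] ennreal_leI order_trans by blast
qed (use nonneg in auto)

lemma dyadic_upward:
  assumes "0 < r" "r \<le> norm (z :: 'a)"
  obtains j :: nat where "z \<in> annulus (r * 2 ^ j)"
proof -
  define j where "j = (LEAST j. norm z < r * 2 ^ Suc j)"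
  have "\<exists>j. norm z < r * 2 ^ Suc j"
  proof -
    obtain n where "norm z / r < 2 ^ n" using real_arch_pow[of 2 "norm z / r"] by auto
    then have "norm z < r * 2 ^ n" using assms by (simp add: field_simps)
    also have "\<dots> \<le> r * 2 ^ Suc n" using assms by simp
    finally show ?thesis by blast
  qed
  then have up: "norm z < r * 2 ^ Suc j" unfolding j_def by (rule LeastI_ex)
  have "r * 2 ^ j \<le> norm z"
  proof (cases j)
    case 0 then show ?thesis using assms by simp
  next
    case (Suc i)
    then have "i < j" by simp
    then have "\<not> norm z < r * 2 ^ Suc i" unfolding j_def by (rule not_less_Least)
    then show ?thesis using Suc by simp
  qed
  with up have "z \<in> annulus (r * 2 ^ j)" unfolding annulus_def by auto
  then show thesis by (rule that)
qed

lemma dyadic_downward: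
  assumes "0 < r" "norm (z :: 'a) < r" "z \<noteq> 0"
  obtains j :: nat where "z \<in> annulus (r / 2 ^ Suc j)"
proof -
  define j where "j = (LEAST j. r / 2 ^ Suc j \<le> norm z)"
  have "\<exists>j. r / 2 ^ Suc j \<le> norm z"
  proof -
    obtain n where "r / norm z < 2 ^ n" using real_arch_pow[of 2 "r / norm z"] by auto
    then have "r / 2 ^ n \<le> norm z" using assms by (simp add: field_simps)
    moreover have "r / 2 ^ Suc n \<le> r / 2 ^ n" using assms by (simp add: field_simps)
    ultimately have "r / 2 ^ Suc n \<le> norm z" by linarith
    then show ?thesis by blast
  qed
  then have low: "r / 2 ^ Suc j \<le> norm z" unfolding j_def by (rule LeastI_ex)
  have "norm z < r / 2 ^ j"
  proof (cases j)
    case 0 then show ?thesis using assms by simp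
  next
    case (Suc i)
    then have "i < j" by simp
    then have "\<not> r / 2 ^ Suc i \<le> norm z" unfolding j_def by (rule not_less_Least)
    then show ?thesis using Suc by simp
  qed
  with low have "z \<in> annulus (r / 2 ^ Suc j)" unfolding annulus_def by auto
  then show thesis by (rule that)
qed

lemma mass_on_far:
  assumes r: "0 < r"
  shows "mass_on {z. r \<le> norm z} \<le> ennreal (m * (A * r powr (- \<eta>)) / (1 - 2 powr (- \<eta>)))"
proof (rule nn_integral_dyadic_le[OF sets_\<nu> W_meas])
  show "{z. r \<le> norm z} \<subseteq> (\<Union>j. annulus (r * 2 ^ j) :: 'a set)"
    using dyadic_upward[OF r] by blast
  show "mass_on (annulus (r * 2 ^ j)) \<le> ennreal (m * (A * r powr (- \<eta>)) * (2 powr (- \<eta>)) ^ j)" for j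
  proof -
    have "mass_on (annulus (r * 2 ^ j)) \<le> ennreal (m * (A * (r * 2 ^ j) powr (- \<eta>)))"
      using r nonneg by (intro mass_on_le[OF annulus_borel W_bounded annulus_mass]) auto
    also have "(r * 2 ^ j) powr (- \<eta>) = r powr (- \<eta>) * (2 powr (- \<eta>)) ^ j"
      using r by (simp add: powr_mult powr_powr mult.commute flip: powr_realpow)
    finally show ?thesis by (simp add: mult.assoc)
  qed
  show "2 powr - \<eta> < 1" using exponents powr_less_mono[of "- \<eta>" 0 2] by simp
qed (use nonneg in auto)

lemma mass_on_near_if_greater:
  assumes r: "0 < r" and less: "\<eta> < \<gamma>"
  shows "mass_on {z. z \<noteq> 0 \<and> norm z < r} \<le> ennreal (2 * P * A * r powr (\<gamma> - \<eta>) / (1 - 2 powr (\<eta> - \<gamma>)))"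
proof (rule nn_integral_dyadic_le[OF sets_\<nu> W_meas])
  show "{z. z \<noteq> 0 \<and> norm z < r} \<subseteq> (\<Union>j. annulus (r / 2 ^ Suc j) :: 'a set)"
    using dyadic_downward[OF r] by blast
  show "{z. z \<noteq> 0 \<and> norm z < r} \<in> sets (borel :: 'a measure)" by measurable
  show "mass_on (annulus (r / 2 ^ Suc j)) \<le> ennreal (2 * P * A * r powr (\<gamma> - \<eta>) * (2 powr (\<eta> - \<gamma>)) ^ j)" for j
  proof -
    have "mass_on (annulus (r / 2 ^ Suc j)) \<le> ennreal (2 * P * A * (r / 2 ^ Suc j) powr (\<gamma> - \<eta>))"
      using r by (intro mass_on_annulus) simp
    also have "\<dots> \<le> ennreal (2 * P * A * (r / 2 ^ j) powr (\<gamma> - \<eta>))"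
      using r less nonneg by (intro ennreal_leI mult_left_mono powr_mono2) (auto simp: field_simps)
    also have "(r / 2 ^ j) powr (\<gamma> - \<eta>) = r powr (\<gamma> - \<eta>) * (2 powr (\<eta> - \<gamma>)) ^ j"
    proof -
      have pow: "(2 powr (\<eta> - \<gamma>)) ^ j = (2 ^ j) powr (- (\<gamma> - \<eta>))"
        by (simp add: powr_powr mult.commute flip: powr_realpow)
      have "(r / 2 ^ j) powr (\<gamma> - \<eta>) = r powr (\<gamma> - \<eta>) / (2 ^ j) powr (\<gamma> - \<eta>)"
        using r by (simp add: powr_divide)
      then show ?thesis unfolding pow powr_minus by (simp only: divide_inverse)
    qed
    finally show ?thesis by (simp add: mult.assoc)
  qed
  show "2 powr (\<eta> - \<gamma>) < 1" using less powr_less_mono[of "\<eta> - \<gamma>" 0 2] by simp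
qed (use nonneg in auto)

lemma mass_on_far_if_less:
  assumes r: "0 < r" and less: "\<gamma> < \<eta>"
  shows "mass_on {z. r \<le> norm z} \<le> ennreal (2 * P * A * r powr (\<gamma> - \<eta>) / (1 - 2 powr (\<gamma> - \<eta>)))"
proof (rule nn_integral_dyadic_le[OF sets_\<nu> W_meas])
  show "{z. r \<le> norm z} \<subseteq> (\<Union>j. annulus (r * 2 ^ j) :: 'a set)"
    using dyadic_upward[OF r] by blast
  show "mass_on (annulus (r * 2 ^ j)) \<le> ennreal (2 * P * A * r powr (\<gamma> - \<eta>) * (2 powr (\<gamma> - \<eta>)) ^ j)" for j
  proof -
    have "mass_on (annulus (r * 2 ^ j)) \<le> ennreal (2 * P * A * (r * 2 ^ j) powr (\<gamma> - \<eta>))"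
      using r by (intro mass_on_annulus) simp
    also have "(r * 2 ^ j) powr (\<gamma> - \<eta>) = r powr (\<gamma> - \<eta>) * (2 powr (\<gamma> - \<eta>)) ^ j"
      using r by (simp add: powr_mult powr_powr mult.commute flip: powr_realpow)
    finally show ?thesis by (simp add: mult.assoc)
  qed
  show "2 powr (\<gamma> - \<eta>) < 1" using less powr_less_mono[of "\<gamma> - \<eta>" 0 2] by simp
qed (use nonneg in auto)

lemma mass_on_middle:
  assumes r: "0 < r" and eq: "\<gamma> = \<eta>"
  shows "mass_on {z. r \<le> norm z \<and> norm z < r * 2 ^ N} \<le> ennreal (real N * (2 * P * A))"
proof (induction N)
  case 0
  have "{z :: 'a. r \<le> norm z \<and> norm z < r * 2 ^ 0} = {}" by auto
  then show ?case by simp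
next
  case (Suc N)
  let ?X = "{z :: 'a. r \<le> norm z \<and> norm z < r * 2 ^ N}" and ?Y = "annulus (r * 2 ^ N) :: 'a set"
  have "mass_on {z. r \<le> norm z \<and> norm z < r * 2 ^ Suc N} \<le> (\<integral>\<^sup>+z. W z * indicator ?X z + W z * indicator ?Y z \<partial>\<nu>)"
    by (intro nn_integral_mono) (auto simp: annulus_def split: split_indicator)
  also have "\<dots> = mass_on ?X + mass_on ?Y" by (rule nn_integral_add) measurable
  also have "\<dots> \<le> ennreal (real N * (2 * P * A)) + ennreal (2 * P * A)"
    using mass_on_annulus[of "r * 2 ^ N"] r eq by (intro add_mono Suc) auto
  also have "\<dots> = ennreal (real (Suc N) * (2 * P * A))"
    using nonneg by (simp add: algebra_simps flip: ennreal_plus)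
  finally show ?case .
qed

lemma mass_greater:
  assumes r: "0 < r" and less: "\<eta> < \<gamma>"
  shows "(\<integral>\<^sup>+z. W z \<partial>\<nu>) \<le> ennreal (2 * P * A * r powr (\<gamma> - \<eta>) / (1 - 2 powr (\<eta> - \<gamma>)) + m * (A * r powr (- \<eta>)) / (1 - 2 powr (- \<eta>)))"
proof (rule mass_split[OF _ _ _ mass_on_near_if_greater[OF r less] mass_on_far[OF r]])
  show "{z. z \<noteq> 0 \<and> norm z < r} \<in> sets (borel :: 'a measure)" by measurable
  show "{z. r \<le> norm z} \<in> sets (borel :: 'a measure)" by measurable
  show "0 \<le> 2 * P * A * r powr (\<gamma> - \<eta>) / (1 - 2 powr (\<eta> - \<gamma>))"
    using nonneg less powr_less_mono[of "\<eta> - \<gamma>" 0 2] by (intro divide_nonneg_nonneg) auto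
  show "0 \<le> m * (A * r powr (- \<eta>)) / (1 - 2 powr (- \<eta>))"
    using nonneg exponents powr_less_mono[of "- \<eta>" 0 2] by (intro divide_nonneg_nonneg) auto
qed auto

lemma mass_less:
  assumes r: "0 < r" and less: "\<gamma> < \<eta>"
  shows "(\<integral>\<^sup>+z. W z \<partial>\<nu>) \<le> ennreal (P * r powr \<gamma> * B + 2 * P * A * r powr (\<gamma> - \<eta>) / (1 - 2 powr (\<gamma> - \<eta>)))"
proof (rule mass_split[OF _ _ _ mass_on_near[OF r] mass_on_far_if_less[OF r less]])
  show "{z. norm z < r} \<in> sets (borel :: 'a measure)" by measurable
  show "{z. r \<le> norm z} \<in> sets (borel :: 'a measure)" by measurable
  show "0 \<le> 2 * P * A * r powr (\<gamma> - \<eta>) / (1 - 2 powr (\<gamma> - \<eta>))"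
    using nonneg less powr_less_mono[of "\<gamma> - \<eta>" 0 2] by (intro divide_nonneg_nonneg) auto
qed (use nonneg in auto)

lemma mass_equal:
  assumes r: "0 < r" and eq: "\<gamma> = \<eta>"
  shows "(\<integral>\<^sup>+z. W z \<partial>\<nu>) \<le> ennreal (P * r powr \<gamma> * B + (real N * (2 * P * A) + m * (A * (r * 2 ^ N) powr (- \<eta>)) / (1 - 2 powr (- \<eta>))))"
proof (rule mass_split[OF _ _ _ mass_on_near[OF r]])
  let ?X = "{z :: 'a. r \<le> norm z \<and> norm z < r * 2 ^ N}" and ?Y = "{z :: 'a. r * 2 ^ N \<le> norm z}"
  show "{z. norm z < r} \<in> sets (borel :: 'a measure)" by measurable
  show "{z. r \<le> norm z} \<in> sets (borel :: 'a measure)" by measurable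
  have far: "0 \<le> m * (A * (r * 2 ^ N) powr (- \<eta>)) / (1 - 2 powr (- \<eta>))"
    using nonneg exponents powr_less_mono[of "- \<eta>" 0 2] by (intro divide_nonneg_nonneg) auto
  then show "0 \<le> real N * (2 * P * A) + m * (A * (r * 2 ^ N) powr (- \<eta>)) / (1 - 2 powr (- \<eta>))"
    using nonneg by simp
  have "mass_on {z. r \<le> norm z} \<le> (\<integral>\<^sup>+z. W z * indicator ?X z + W z * indicator ?Y z \<partial>\<nu>)"
    by (intro nn_integral_mono) (auto split: split_indicator)
  also have "\<dots> = mass_on ?X + mass_on ?Y" by (rule nn_integral_add) measurable
  also have "\<dots> \<le> ennreal (real N * (2 * P * A)) + ennreal (m * (A * (r * 2 ^ N) powr (- \<eta>)) / (1 - 2 powr (- \<eta>)))"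
    using r by (intro add_mono mass_on_middle[OF r eq] mass_on_far) simp
  also have "\<dots> = ennreal (real N * (2 * P * A) + m * (A * (r * 2 ^ N) powr (- \<eta>)) / (1 - 2 powr (- \<eta>)))"
    using nonneg far by (simp add: ennreal_plus)
  finally show "mass_on {z. r \<le> norm z} \<le> ennreal (real N * (2 * P * A) + m * (A * (r * 2 ^ N) powr (- \<eta>)) / (1 - 2 powr (- \<eta>)))" .
qed (use nonneg in auto)

end

section \<open>Decay of the band-limiting kernel\<close>

lemma norm_exp_i_minus_one_sq: "(norm (iexp \<theta> - 1))\<^sup>2 = 4 * (sin (\<theta> / 2))\<^sup>2"
proof -
  have "(norm (iexp \<theta> - 1))\<^sup>2 = (cos \<theta> - 1)\<^sup>2 + (sin \<theta>)\<^sup>2"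
    by (simp add: cmod_power2 cis_conv_exp[symmetric] mult.commute)
  also have "\<dots> = 2 - 2 * cos \<theta>"
    using sin_cos_squared_add[of \<theta>] by (simp add: power2_eq_square algebra_simps)
  also have "cos \<theta> = 1 - 2 * (sin (\<theta> / 2))\<^sup>2"
    using cos_double_sin[of "\<theta> / 2"] by simp
  finally show ?thesis by simp
qed

lemma norm_exp_i_minus_one_sq_ge:
  assumes "\<bar>\<theta>\<bar> \<le> 1"
  shows "\<theta>\<^sup>2 / 2 \<le> (norm (iexp \<theta> - 1))\<^sup>2"
proof -
  let ?x = "\<theta> / 2"
  have "\<bar>sin ?x - ?x\<bar> \<le> \<bar>?x\<bar> ^ 3 / 6"
  proof -
    have "(\<Sum>m<3. sin_coeff m * ?x ^ m) = ?x"
      by (simp add: numeral_3_eq_3 sin_coeff_def)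
    moreover have "fact 3 = (6::real)" by (simp add: numeral_3_eq_3)
    ultimately show ?thesis
      using Maclaurin_sin_bound[of ?x 3] by (simp only: divide_inverse mult.commute)
  qed
  moreover have "\<bar>?x\<bar> ^ 3 \<le> \<bar>?x\<bar> * 1"
    using assms unfolding power3_eq_cube mult.assoc by (intro mult_left_mono mult_le_one) auto
  ultimately have "5 / 6 * \<bar>?x\<bar> \<le> \<bar>sin ?x\<bar>" by linarith
  then have "(5 / 6 * \<bar>?x\<bar>)\<^sup>2 \<le> \<bar>sin ?x\<bar>\<^sup>2" by (intro power_mono) auto
  then have "25 / 144 * \<theta>\<^sup>2 \<le> (sin ?x)\<^sup>2" by (simp add: power_mult_distrib power_divide)
  then show ?thesis unfolding norm_exp_i_minus_one_sq using zero_le_power2[of \<theta>] by linarith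
qed

text \<open>
  With $t = 1/(2r)$ all the phases $t z_b$ on the shell are at most 1 in absolute value, so that
  $|e^{itz_b}-1|^2 \ge (t z_b)^2/2$, and the sum over the coordinates is at least $(t|z|)^2/2 \ge 1/8$. This is
  where the factor 8 and, from the number of coordinates, the factor $d$ come from.
\<close>

lemma band_kernel_annulus:
  fixes S :: "(real^'d) set"
  assumes S: "S \<in> sets lebesgue" "emeasure lebesgue S < \<infinity>" "perimeter \<eta> S < \<infinity>" and \<eta>: "0 < \<eta>" and r: "0 < r"
  shows "(\<integral>\<^sup>+z. ennreal ((norm (band_kernel S z))\<^sup>2) * indicator (annulus r) z \<partial>lborel)
    \<le> ennreal (8 * real CARD('d) * enn2real (perimeter \<eta> S) * r powr (- \<eta>))"
proof -
  let ?B = "Basis :: (real^'d) set"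
  define t where "t = 1 / (2 * r)"
  have t: "0 < t" unfolding t_def using r by simp
  let ?k = "\<lambda>z. (norm (band_kernel S z))\<^sup>2"
  let ?e = "\<lambda>b z. (norm (iexp ((t *\<^sub>R b) \<bullet> z) - 1))\<^sup>2"
  define p where "p = enn2real (perimeter \<eta> S)"
  have p: "perimeter \<eta> S = ennreal p" "0 \<le> p" unfolding p_def using S(3) by (auto simp: less_top)
  have [measurable]: "band_kernel S \<in> borel_measurable borel" by (rule band_kernel_measurable[OF S(1)])
  have each: "(\<integral>\<^sup>+z. ennreal (?k z * ?e b z) \<partial>lborel) \<le> ennreal (p * t powr \<eta>)" if b: "b \<in> ?B" for b
  proof -
    let ?F = "\<lambda>z. (norm (fourier_integral (indicator S) z))\<^sup>2"
    have c1: "(2 * pi) powr (- real CARD('d)) \<le> 1"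
      using powr_mono[of "- real CARD('d)" 0 "2 * pi"] pi_gt3 by simp
    have "(\<integral>\<^sup>+z. ennreal (?k z * ?e b z) \<partial>lborel) \<le> (\<integral>\<^sup>+z. ennreal (?e b z * ?F z) \<partial>lborel)"
    proof (intro nn_integral_mono ennreal_leI)
      fix z
      have "?k z \<le> 1 * ?F z" unfolding norm_band_kernel_sq by (intro mult_right_mono c1) simp
      then show "?k z * ?e b z \<le> ?e b z * ?F z" by (subst mult.commute) (intro mult_left_mono; simp)
    qed
    also have "\<dots> = (\<integral>\<^sup>+z. ennreal (?e b z * ?F z) \<partial>lebesgue)" by (simp add: nn_integral_completion)
    also have "\<dots> \<le> emeasure lebesgue (sym_diff S ((\<lambda>x. x - t *\<^sub>R b) ` S))"
      by (rule fourier_integral_indicator_translation[OF S(1,2)])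
    also have "\<dots> \<le> perimeter \<eta> S * ennreal (norm (t *\<^sub>R b) powr \<eta>)"
      by (rule emeasure_sym_diff_le_perimeter)
    also have "\<dots> = ennreal (p * t powr \<eta>)"
      using b t p by (simp add: ennreal_mult)
    finally show ?thesis .
  qed
  have "(\<integral>\<^sup>+z. ennreal (?k z) * indicator (annulus r) z \<partial>lborel) \<le> (\<integral>\<^sup>+z. (\<Sum>b\<in>?B. 8 * ennreal (?k z * ?e b z)) \<partial>lborel)"
  proof (rule nn_integral_mono)
    fix z :: "real^'d"
    show "ennreal (?k z) * indicator (annulus r) z \<le> (\<Sum>b\<in>?B. 8 * ennreal (?k z * ?e b z))"
    proof (cases "z \<in> annulus r")
      case True
      then have z: "r \<le> norm z" "norm z < 2 * r" by (auto simp: annulus_def)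
      have "1 / 8 \<le> (t * norm z)\<^sup>2 / 2"
      proof -
        have "1 / 2 \<le> t * norm z" unfolding t_def using z r by (simp add: field_simps)
        then have "(1 / 2)\<^sup>2 \<le> (t * norm z)\<^sup>2" by (intro power_mono) auto
        then show ?thesis by (simp add: power2_eq_square)
      qed
      also have "\<dots> = (\<Sum>b\<in>?B. ((t *\<^sub>R b) \<bullet> z)\<^sup>2 / 2)"
        unfolding power_mult_distrib power2_norm_eq_inner euclidean_inner[of z z]
        by (simp add: sum_distrib_left sum_divide_distrib power_mult_distrib power2_eq_square inner_commute mult_ac)
      also have "\<dots> \<le> (\<Sum>b\<in>?B. ?e b z)"
      proof (rule sum_mono)
        fix b assume b: "b \<in> ?B"
        have "\<bar>(t *\<^sub>R b) \<bullet> z\<bar> \<le> t * norm z"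
          using Basis_le_norm[OF b, of z] t by (simp add: abs_mult inner_commute)
        also have "\<dots> \<le> 1" unfolding t_def using z r by (simp add: field_simps)
        finally show "((t *\<^sub>R b) \<bullet> z)\<^sup>2 / 2 \<le> ?e b z" by (rule norm_exp_i_minus_one_sq_ge)
      qed
      finally have "?k z * 1 \<le> ?k z * (8 * (\<Sum>b\<in>?B. ?e b z))" by (intro mult_left_mono) auto
      then have "ennreal (?k z) \<le> ennreal (\<Sum>b\<in>?B. 8 * (?k z * ?e b z))"
        by (intro ennreal_leI) (simp add: sum_distrib_left mult_ac)
      also have "\<dots> = (\<Sum>b\<in>?B. 8 * ennreal (?k z * ?e b z))"
        by (subst sum_ennreal[symmetric]) (auto simp: ennreal_mult' intro!: sum.cong)
      finally show ?thesis using True by simp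
    qed simp
  qed
  also have "\<dots> = (\<Sum>b\<in>?B. 8 * (\<integral>\<^sup>+z. ennreal (?k z * ?e b z) \<partial>lborel))"
    by (subst nn_integral_sum) (auto intro!: sum.cong nn_integral_cmult)
  also have "\<dots> \<le> (\<Sum>b\<in>?B. 8 * ennreal (p * t powr \<eta>))"
    by (intro sum_mono mult_left_mono each) auto
  also have "\<dots> = ennreal (8 * real CARD('d) * p * t powr \<eta>)"
    using p by (simp add: ennreal_mult ennreal_of_nat_eq_real_of_nat mult_ac)
  also have "\<dots> \<le> ennreal (8 * real CARD('d) * p * r powr (- \<eta>))"
  proof (intro ennreal_leI mult_left_mono)
    have "t powr \<eta> \<le> (1 / r) powr \<eta>"
      unfolding t_def using r \<eta> by (intro powr_mono2) (auto simp: field_simps)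
    then show "t powr \<eta> \<le> r powr (- \<eta>)" using r by (simp add: powr_divide powr_minus_divide)
  qed (use p in auto)
  finally show ?thesis unfolding p_def .
qed

lemma power_decay_band_kernel:
  fixes F S :: "(real^'d) set"
  assumes F: "F \<in> sets lebesgue" "emeasure lebesgue F < \<infinity>" "perimeter \<gamma> F < \<infinity>"
    and S: "S \<in> sets lebesgue" "emeasure lebesgue S < \<infinity>" "perimeter \<eta> S < \<infinity>"
    and exponents: "0 < \<gamma>" "\<gamma> \<le> 1" "0 < \<eta>"
  shows "power_decay (density lborel (\<lambda>z. ennreal ((norm (band_kernel S z))\<^sup>2))) (\<lambda>z. emeasure lebesgue (exit_set F z))
    (8 * real CARD('d) * enn2real (perimeter \<eta> S)) (measure lebesgue S) (enn2real (perimeter \<gamma> F)) (measure lebesgue F) \<gamma> \<eta>"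
    (is "power_decay ?\<nu> _ _ _ _ _ _ _")
proof
  have [measurable]: "band_kernel S \<in> borel_measurable borel" by (rule band_kernel_measurable[OF S(1)])
  show "sets ?\<nu> = sets borel" by simp
  show "(\<lambda>z. emeasure lebesgue (exit_set F z)) \<in> borel_measurable borel"
    by (rule nn_integral_exit_set(2)[OF F(1), of "\<lambda>_. 0"]) simp
  show "emeasure ?\<nu> (annulus r) \<le> ennreal (8 * real CARD('d) * enn2real (perimeter \<eta> S) * r powr (- \<eta>))" if "0 < r" for r
    using band_kernel_annulus[OF S exponents(3) that] by (simp add: emeasure_density)
  have "(2 * pi) powr (- real CARD('d)) \<le> 1"
    using powr_mono[of "- real CARD('d)" 0 "2 * pi"] pi_gt3 by simp
  then have "ennreal ((2 * pi) powr (- real CARD('d))) * emeasure lebesgue S \<le> 1 * emeasure lebesgue S"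
    by (intro mult_right_mono) auto
  also have "\<dots> = ennreal (measure lebesgue S)"
    using S(2) by (simp add: emeasure_eq_ennreal_measure less_top del: emeasure_completion)
  finally show "emeasure ?\<nu> UNIV \<le> ennreal (measure lebesgue S)"
    using nn_integral_band_kernel(1)[OF S(1,2)] by (simp add: emeasure_density del: emeasure_completion)
  show "emeasure lebesgue (exit_set F z) \<le> ennreal (measure lebesgue F)" for z
  proof -
    have "emeasure lebesgue (exit_set F z) \<le> emeasure lebesgue F"
      by (intro emeasure_mono F) (auto simp: exit_set_def)
    then show ?thesis using F(2) by (simp add: emeasure_eq_ennreal_measure less_top del: emeasure_completion)
  qed
  show "emeasure lebesgue (exit_set F z) \<le> ennreal (enn2real (perimeter \<gamma> F) * norm z powr \<gamma>)" for z
    using emeasure_exit_set_le_perimeter[OF F(1), of z \<gamma>] F(3) by (simp add: ennreal_mult less_top del: emeasure_completion)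
qed (use exponents in auto)

lemma trace_le_if_mass_le:
  fixes F S :: "(real^'d) set"
  assumes F: "F \<in> sets lebesgue" "emeasure lebesgue F < \<infinity>"
    and S: "S \<in> sets lebesgue" "emeasure lebesgue S < \<infinity>" "perimeter \<eta> S < \<infinity>" "0 < \<eta>"
    and q: "(\<integral>\<^sup>+z. emeasure lebesgue (exit_set F z) \<partial>density lborel (\<lambda>z. ennreal ((norm (band_kernel S z))\<^sup>2))) \<le> ennreal q"
      "q \<le> q'" "0 \<le> q'"
  shows "L2_trace (limiting_op F S - limiting_op F S ^^ 2) \<le> complex_of_real q'"
proof (rule trace_le_exit_energy[OF F S _ q(3)])
  have [measurable]: "band_kernel S \<in> borel_measurable borel" by (rule band_kernel_measurable[OF S(1)])
  have "(\<lambda>z. emeasure lebesgue (exit_set F z)) \<in> borel_measurable borel"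
    by (rule nn_integral_exit_set(2)[OF F(1), of "\<lambda>_. 0"]) simp
  then have "(\<integral>\<^sup>+z. ennreal ((norm (band_kernel S z))\<^sup>2) * emeasure lebesgue (exit_set F z) \<partial>lborel)
     = (\<integral>\<^sup>+z. emeasure lebesgue (exit_set F z) \<partial>density lborel (\<lambda>z. ennreal ((norm (band_kernel S z))\<^sup>2)))"
    by (subst nn_integral_density) auto
  also have "\<dots> \<le> ennreal q" by (rule q)
  also have "\<dots> \<le> ennreal q'" by (rule ennreal_leI[OF q(2)])
  finally show "(\<integral>\<^sup>+z. ennreal ((norm (band_kernel S z))\<^sup>2) * emeasure lebesgue (exit_set F z) \<partial>lborel) \<le> ennreal q'" .
qed

section \<open>The trace estimate\<close>

theorem theorem1p4:
  fixes \<gamma> \<eta> :: real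
  assumes "0 < \<gamma>" "\<gamma> \<le> 1" "0 < \<eta>" "\<eta> \<le> 1"
  shows "\<exists>C::real. \<forall>F S :: (real^'d) set.
    F \<in> sets lebesgue \<longrightarrow> 0 < emeasure lebesgue F \<longrightarrow> emeasure lebesgue F < \<infinity> \<longrightarrow>
    S \<in> sets lebesgue \<longrightarrow> 0 < emeasure lebesgue S \<longrightarrow> emeasure lebesgue S < \<infinity> \<longrightarrow>
    perimeter \<gamma> F < \<infinity> \<longrightarrow> perimeter \<eta> S < \<infinity> \<longrightarrow>
    L2_trace (limiting_op F S - limiting_op F S ^^ 2) \<le> complex_of_real (C *
      (let PF = enn2real (perimeter \<gamma> F); PS = enn2real (perimeter \<eta> S) in
       if \<gamma> = \<eta> then
         PF * PS * log_plus (perimeter_scale \<gamma> F * perimeter_scale \<eta> S)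
       else if \<gamma> > \<eta> then
         PS * PF powr (\<eta> / \<gamma>) * measure lebesgue F powr (1 - \<eta> / \<gamma>)
       else
         PS powr (\<gamma> / \<eta>) * PF * measure lebesgue S powr (1 - \<gamma> / \<eta>)))"
proof -
  define D where "D = 8 * real CARD('d)"
  define \<tau> where "\<tau> = 1 / (1 - 2 powr (- \<eta>))"
  define \<sigma> where "\<sigma> = 1 / (1 - 2 powr (- \<bar>\<gamma> - \<eta>\<bar>))"
  have D: "0 \<le> D" unfolding D_def by simp
  have \<tau>: "0 \<le> \<tau>"
    unfolding \<tau>_def using assms powr_less_mono[of "- \<eta>" 0 2] by simp
  have \<sigma>: "0 \<le> \<sigma>"
    unfolding \<sigma>_def using powr_mono[of "- \<bar>\<gamma> - \<eta>\<bar>" 0 2] by simp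
  \<comment> \<open>The four terms cover the ball around the origin, the shells in the logarithmic case, the geometric series with ratio $2^{-|\gamma-\eta|}$, and the tail with ratio $2^{-\eta}$. If $\gamma = \eta$ then $\sigma = 1/0 = 0$.\<close>
  define C where "C = 1 + 4 * D + 2 * D * \<sigma> + D * \<tau>"
  have C: "0 \<le> C" unfolding C_def using D \<tau> \<sigma> by simp
  show ?thesis
  proof (intro exI[of _ C] allI impI)
    fix F S :: "(real^'d) set"
    assume F: "F \<in> sets lebesgue" "0 < emeasure lebesgue F" "emeasure lebesgue F < \<infinity>"
      and S: "S \<in> sets lebesgue" "0 < emeasure lebesgue S" "emeasure lebesgue S < \<infinity>"
      and per: "perimeter \<gamma> F < \<infinity>" "perimeter \<eta> S < \<infinity>"
    define PF where "PF = enn2real (perimeter \<gamma> F)"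
    define PS where "PS = enn2real (perimeter \<eta> S)"
    define mF where "mF = measure lebesgue F"
    define mS where "mS = measure lebesgue S"
    have PF: "0 < PF" unfolding PF_def using perimeter_pos[OF F] per by (simp add: enn2real_positive_iff less_top)
    have PS: "0 < PS" unfolding PS_def using perimeter_pos[OF S] per by (simp add: enn2real_positive_iff less_top)
    have mF: "0 < mF" unfolding mF_def measure_def using F(2,3) by (simp add: enn2real_positive_iff less_top del: emeasure_completion)
    have mS: "0 < mS" unfolding mS_def measure_def using S(2,3) by (simp add: enn2real_positive_iff less_top del: emeasure_completion)
    define \<delta>F where "\<delta>F = perimeter_scale \<gamma> F"
    define \<delta>S where "\<delta>S = perimeter_scale \<eta> S"
    have \<delta>F_eq: "\<delta>F = (mF / PF) powr (1 / \<gamma>)" and \<delta>S_eq: "\<delta>S = (mS / PS) powr (1 / \<eta>)"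
      unfolding \<delta>F_def \<delta>S_def perimeter_scale_def mF_def mS_def PF_def PS_def by auto
    have \<delta>F: "0 < \<delta>F" and \<delta>S: "0 < \<delta>S" unfolding \<delta>F_eq \<delta>S_eq using mF mS PF PS by auto
    have \<delta>F_powr: "\<delta>F powr a = (mF / PF) powr (a / \<gamma>)" for a
      unfolding \<delta>F_eq by (simp add: powr_powr)
    have \<delta>S_powr: "(1 / \<delta>S) powr a = (mS / PS) powr (- a / \<eta>)" for a
      unfolding \<delta>S_eq using mS PS by (simp add: powr_divide powr_powr powr_minus_divide)
    let ?I = "\<integral>\<^sup>+z. emeasure lebesgue (exit_set F z) \<partial>density lborel (\<lambda>z. ennreal ((norm (band_kernel S z))\<^sup>2))"
    interpret power_decay "density lborel (\<lambda>z. ennreal ((norm (band_kernel S z))\<^sup>2))" "\<lambda>z. emeasure lebesgue (exit_set F z)"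
      "D * PS" mS PF mF \<gamma> \<eta>
      using power_decay_band_kernel[OF F(1,3) per(1) S(1,3) per(2) assms(1-3)]
      unfolding D_def PS_def mS_def PF_def mF_def .
    have bound: "L2_trace (limiting_op F S - limiting_op F S ^^ 2) \<le> complex_of_real q'"
      if "?I \<le> ennreal q" "q \<le> q'" "0 \<le> q'" for q q'
      using trace_le_if_mass_le[OF F(1,3) S(1,3) per(2) assms(3) that] .
    consider (eq) "\<gamma> = \<eta>" | (greater) "\<eta> < \<gamma>" | (less) "\<gamma> < \<eta>" by linarith
    then have "L2_trace (limiting_op F S - limiting_op F S ^^ 2) \<le> complex_of_real (C *
       (if \<gamma> = \<eta> then PF * PS * log_plus (\<delta>F * \<delta>S)
        else if \<gamma> > \<eta> then PS * PF powr (\<eta> / \<gamma>) * mF powr (1 - \<eta> / \<gamma>)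
        else PS powr (\<gamma> / \<eta>) * PF * mS powr (1 - \<gamma> / \<eta>)))"
    proof cases
      case eq
      define l where "l = log_plus (\<delta>F * \<delta>S)"
      have l: "1 \<le> l" "log 2 (\<delta>F * \<delta>S) \<le> l" unfolding l_def log_plus_def by auto
      \<comment> \<open>So many dyadic shells suffice to get from $1/\delta_S$ beyond $\delta_F$.\<close>
      define N where "N = nat \<lceil>l\<rceil>"
      have N: "l \<le> real N" "real N \<le> 2 * l"
        unfolding N_def using l(1) by linarith+
      have "\<delta>F * \<delta>S = 2 powr log 2 (\<delta>F * \<delta>S)" using \<delta>F \<delta>S by simp
      also have "\<dots> \<le> 2 powr real N" using l N by (intro powr_mono) auto
      finally have reach: "\<delta>F \<le> 1 / \<delta>S * 2 ^ N" using \<delta>S by (simp add: powr_realpow field_simps)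
      have near: "PF * (1 / \<delta>S) powr \<gamma> * mS = PF * PS"
        unfolding \<delta>S_powr using eq assms mS PS by (simp add: powr_minus_divide)
      have far: "mF * (1 / \<delta>S * 2 ^ N) powr (- \<eta>) \<le> PF"
      proof -
        have "(1 / \<delta>S * 2 ^ N) powr (- \<eta>) \<le> \<delta>F powr (- \<eta>)"
          using reach \<delta>F assms by (intro powr_mono2') auto
        also have "\<dots> = PF / mF" unfolding \<delta>F_powr using eq assms mF PF by (simp add: powr_minus_divide)
        finally show ?thesis using mF by (simp add: field_simps)
      qed
      have "PF * (1 / \<delta>S) powr \<gamma> * mS + (real N * (2 * PF * (D * PS)) + mF * (D * PS * (1 / \<delta>S * 2 ^ N) powr (- \<eta>)) / (1 - 2 powr (- \<eta>)))
         = PF * PS + real N * (2 * D * (PF * PS)) + (mF * (1 / \<delta>S * 2 ^ N) powr (- \<eta>)) * (D * \<tau> * PS)"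
        unfolding near \<tau>_def by (simp add: divide_inverse mult_ac)
      also have "\<dots> \<le> PF * PS + 2 * l * (2 * D * (PF * PS)) + PF * (D * \<tau> * PS)"
        using N far PF PS D \<tau> by (intro add_mono mult_right_mono) auto
      also have "\<dots> \<le> PF * PS * l + 2 * l * (2 * D * (PF * PS)) + PF * (D * \<tau> * PS) * l + 2 * D * \<sigma> * (PF * PS * l)"
      proof -
        have "PF * PS * 1 \<le> PF * PS * l" using l PF PS by (intro mult_left_mono) auto
        moreover have "PF * (D * \<tau> * PS) * 1 \<le> PF * (D * \<tau> * PS) * l" using l PF PS D \<tau> by (intro mult_left_mono) auto
        moreover have "0 \<le> 2 * D * \<sigma> * (PF * PS * l)" using l PF PS D \<sigma> by simp
        ultimately show ?thesis by linarith
      qed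
      also have "\<dots> = C * (PF * PS * l)" unfolding C_def by (simp add: algebra_simps)
      finally have "L2_trace (limiting_op F S - limiting_op F S ^^ 2) \<le> complex_of_real (C * (PF * PS * l))"
        using \<delta>S C PF PS l by (intro bound[OF mass_equal[OF _ eq, of "1 / \<delta>S" N]]) auto
      then show ?thesis using eq unfolding l_def by simp
    next
      case greater
      let ?X = "PS * PF powr (\<eta> / \<gamma>) * mF powr (1 - \<eta> / \<gamma>)"
      have X: "0 \<le> ?X" using PS by simp
      have far: "mF * \<delta>F powr (- \<eta>) = PF powr (\<eta> / \<gamma>) * mF powr (1 - \<eta> / \<gamma>)"
        unfolding \<delta>F_powr using mF PF by (simp add: powr_divide powr_diff powr_minus_divide)
      have near: "PF * \<delta>F powr (\<gamma> - \<eta>) = mF * \<delta>F powr (- \<eta>)"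
      proof -
        have "\<delta>F powr (\<gamma> - \<eta>) = \<delta>F powr \<gamma> * \<delta>F powr (- \<eta>)" by (simp flip: powr_add)
        moreover have "\<delta>F powr \<gamma> = mF / PF" unfolding \<delta>F_powr using assms mF PF by simp
        ultimately show ?thesis using PF by simp
      qed
      have "2 * PF * (D * PS) * \<delta>F powr (\<gamma> - \<eta>) / (1 - 2 powr (\<eta> - \<gamma>)) + mF * (D * PS * \<delta>F powr (- \<eta>)) / (1 - 2 powr (- \<eta>))
        = 2 * D * \<sigma> * (PS * (PF * \<delta>F powr (\<gamma> - \<eta>))) + D * \<tau> * (PS * (mF * \<delta>F powr (- \<eta>)))"
        unfolding \<tau>_def \<sigma>_def using greater by (simp add: divide_inverse mult_ac)
      also have "\<dots> = (2 * D * \<sigma> + D * \<tau>) * ?X" unfolding near far by (simp add: algebra_simps)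
      also have "\<dots> \<le> C * ?X" unfolding C_def using D X by (intro mult_right_mono) auto
      finally have "L2_trace (limiting_op F S - limiting_op F S ^^ 2) \<le> complex_of_real (C * ?X)"
        using C X by (intro bound[OF mass_greater[OF \<delta>F greater]]) auto
      then show ?thesis using greater by simp
    next
      case less
      let ?X = "PS powr (\<gamma> / \<eta>) * PF * mS powr (1 - \<gamma> / \<eta>)"
      have X: "0 \<le> ?X" using PF by simp
      have near: "(1 / \<delta>S) powr \<gamma> * mS = PS powr (\<gamma> / \<eta>) * mS powr (1 - \<gamma> / \<eta>)"
        unfolding \<delta>S_powr using mS PS by (simp add: powr_divide powr_diff powr_minus_divide)
      have far: "PS * (1 / \<delta>S) powr (\<gamma> - \<eta>) = (1 / \<delta>S) powr \<gamma> * mS"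
      proof -
        have "(1 / \<delta>S) powr (\<gamma> - \<eta>) = (1 / \<delta>S) powr \<gamma> * (1 / \<delta>S) powr (- \<eta>)" by (simp flip: powr_add)
        moreover have "(1 / \<delta>S) powr (- \<eta>) = mS / PS" unfolding \<delta>S_powr using assms mS PS by simp
        ultimately show ?thesis using PS by simp
      qed
      have "PF * (1 / \<delta>S) powr \<gamma> * mS + 2 * PF * (D * PS) * (1 / \<delta>S) powr (\<gamma> - \<eta>) / (1 - 2 powr (\<gamma> - \<eta>))
        = PF * ((1 / \<delta>S) powr \<gamma> * mS) + 2 * D * \<sigma> * (PF * (PS * (1 / \<delta>S) powr (\<gamma> - \<eta>)))"
        unfolding \<sigma>_def using less by (simp add: divide_inverse mult_ac)
      also have "\<dots> = (1 + 2 * D * \<sigma>) * ?X" unfolding far near by (simp add: algebra_simps)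
      also have "\<dots> \<le> C * ?X" unfolding C_def using D \<tau> X by (intro mult_right_mono) auto
      finally have "L2_trace (limiting_op F S - limiting_op F S ^^ 2) \<le> complex_of_real (C * ?X)"
        using C X \<delta>S by (intro bound[OF mass_less[OF _ less, of "1 / \<delta>S"]]) auto
      then show ?thesis using less by simp
    qed
    then show "L2_trace (limiting_op F S - limiting_op F S ^^ 2) \<le> complex_of_real (C *
      (let PF = enn2real (perimeter \<gamma> F); PS = enn2real (perimeter \<eta> S) in
       if \<gamma> = \<eta> then
         PF * PS * log_plus (perimeter_scale \<gamma> F * perimeter_scale \<eta> S)
       else if \<gamma> > \<eta> then
         PS * PF powr (\<eta> / \<gamma>) * measure lebesgue F powr (1 - \<eta> / \<gamma>)
       else
         PS powr (\<gamma> / \<eta>) * PF * measure lebesgue S powr (1 - \<gamma> / \<eta>)))"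
      unfolding Let_def PF_def PS_def mF_def mS_def \<delta>F_def \<delta>S_def .
  qed
qed

end
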